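(* Let $n\ge2$, let $\Omega\subset\mathbb R^n$ be a bounded domain with smooth boundary, $c\in\mathbb R$, and let $u$ be a smooth function on $\overline\Omega$ with $|Du|<1$ satisfying $$\mathrm{div}\Big(\frac{Du}{w}\Big)=n\ \text{ in }\Omega,\qquad u=c\ \text{ on }\partial\Omega,\qquad w=\sqrt{1-|Du|^2}.$$ If $\partial\Omega$ is strictly mean-convex (i.e. $H_{\partial\Omega}>0$ on $\partial\Omega$), then $$\frac1{n-1}\int_\Omega\Big(\frac{n-1}{n}S_1^2-2S_2\Big)dx+\int_{\partial\Omega}\frac{\big(1-\frac{|Du|}{w}H_{\partial\Omega}\big)^2}{H_{\partial\Omega}}d\sigma_x=\int_{\partial\Omega}\frac1{H_{\partial\Omega}}d\sigma_x-n|\Omega| .$$ In particular, the Heintze–Karcher inequality $$\int_{\partial\Omega}\frac1{H_{\partial\Omega}}d\sigma_x\ge n|\Omega|$$ holds. Moreover, equality holds in this inequality if and only if $\Omega$ is a ball. If $H_{\partial\Omega}$ is constant, then $\partial\Omega$ is a sphere.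
   Context: $S_1$ and $S_2$ are the first and second elementary symmetric functions of the eigenvalues of the matrix $A=(h_i^j)$, $h_i^j=D_i(u_j/w)$ (the shape operator of the space-like graph of $u$ in Minkowski space $\mathbb R^{n,1}$). $H_{\partial\Omega}$ is the arithmetic mean of the principal curvatures of $\partial\Omega$, positive for balls. $|\Omega|$ is the volume of $\Omega$; $d\sigma_x$ is the surface measure. *)

theory Defs
  imports "HOL-Analysis.Analysis"
begin

primrec higher_differentiable_on ::
  "nat \<Rightarrow> ('a::real_normed_vector \<Rightarrow> 'b::real_normed_vector) \<Rightarrow> 'a set \<Rightarrow> bool"
where
  "higher_differentiable_on 0 f U \<longleftrightarrow> continuous_on U f"
| "higher_differentiable_on (Suc k) f U \<longleftrightarrow>
     (\<forall>x\<in>U. f differentiable (at x)) \<and>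
     (\<forall>v. higher_differentiable_on k (\<lambda>x. frechet_derivative f (at x) v) U)"

(* C-infinity on U; only used for open U. *)
definition smooth_on :: "('a::real_normed_vector \<Rightarrow> 'b::real_normed_vector) \<Rightarrow> 'a set \<Rightarrow> bool"
  where "smooth_on f U \<longleftrightarrow> (\<forall>k. higher_differentiable_on k f U)"

(* Smoothness on the closure of a domain, as smoothness near every point of it.
   Then first derivatives at boundary points are genuine derivatives; by continuity they depend
   only on the values of f in the domain. *)
definition smooth_up_to_boundary :: "('a::real_normed_vector \<Rightarrow> 'b::real_normed_vector) \<Rightarrow> 'a set \<Rightarrow> bool"
  where "smooth_up_to_boundary f \<Omega> \<longleftrightarrow> (\<exists>U. open U \<and> closure \<Omega> \<subseteq> U \<and> smooth_on f U)"

definition pderiv_at :: "'n \<Rightarrow> (real^'n \<Rightarrow> real) \<Rightarrow> real^'n \<Rightarrow> real"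
  where "pderiv_at i f x = frechet_derivative f (at x) (axis i 1)"

definition grad :: "(real^'n \<Rightarrow> real) \<Rightarrow> real^'n \<Rightarrow> real^'n"
  where "grad f x = (\<chi> i. pderiv_at i f x)"

definition divergence :: "(real^'n \<Rightarrow> real^'n) \<Rightarrow> real^'n \<Rightarrow> real"
  where "divergence F x = (\<Sum>i\<in>UNIV. pderiv_at i (\<lambda>y. F y $ i) x)"


subsection \<open>Domains with smooth boundary and the curvature of the boundary\<close>

definition local_defining_function ::
  "(real^'n) set \<Rightarrow> real^'n \<Rightarrow> (real^'n) set \<Rightarrow> (real^'n \<Rightarrow> real) \<Rightarrow> bool"
where
  "local_defining_function \<Omega> p V \<rho> \<longleftrightarrow>
     open V \<and> p \<in> V \<and> smooth_on \<rho> V \<and> (\<forall>x\<in>V. grad \<rho> x \<noteq> 0) \<and> \<Omega> \<inter> V = {x\<in>V. \<rho> x < 0}"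

definition bounded_smooth_domain :: "(real^'n) set \<Rightarrow> bool"
where
  "bounded_smooth_domain \<Omega> \<longleftrightarrow>
     open \<Omega> \<and> connected \<Omega> \<and> \<Omega> \<noteq> {} \<and> bounded \<Omega> \<and>
     (\<forall>p\<in>frontier \<Omega>. \<exists>V \<rho>. local_defining_function \<Omega> p V \<rho>)"

(* The value does not depend on the local defining function; meaningful for p on the frontier. *)
definition outer_unit_normal :: "(real^'n) set \<Rightarrow> real^'n \<Rightarrow> real^'n"
where
  "outer_unit_normal \<Omega> p = (THE \<nu>. \<exists>V \<rho>. local_defining_function \<Omega> p V \<rho> \<and> \<nu> = sgn (grad \<rho> p))"

(* B is an orthonormal basis of the tangent space at p consisting of eigenvectors (principal
   directions) of the differential of the Gauss map, with eigenvalues (principal curvatures) \<kappa>.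
   With the outer normal, the principal curvatures of a sphere of radius r are 1/r.
   The within-derivative L along the frontier is determined on tangent vectors only, which is
   where it is used. *)
definition principal_frame ::
  "(real^'n) set \<Rightarrow> real^'n \<Rightarrow> (real^'n) set \<Rightarrow> (real^'n \<Rightarrow> real) \<Rightarrow> bool"
where
  "principal_frame \<Omega> p B \<kappa> \<longleftrightarrow>
     pairwise orthogonal B \<and> (\<forall>b\<in>B. norm b = 1) \<and>
     span B = {v. v \<bullet> outer_unit_normal \<Omega> p = 0} \<and>
     (\<exists>L. (outer_unit_normal \<Omega> has_derivative L) (at p within frontier \<Omega>) \<and>
          (\<forall>b\<in>B. L b = \<kappa> b *\<^sub>R b))"

(* The arithmetic mean of the principal curvatures; every principal frame gives the same value. *)
definition mean_curvature :: "(real^'n) set \<Rightarrow> real^'n \<Rightarrow> real"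
where
  "mean_curvature \<Omega> p =
     (THE h. \<exists>B \<kappa>. principal_frame \<Omega> p B \<kappa> \<and> h = (\<Sum>b\<in>B. \<kappa> b) / real (card B))"

definition strictly_mean_convex :: "(real^'n) set \<Rightarrow> bool"
  where "strictly_mean_convex \<Omega> \<longleftrightarrow> (\<forall>p\<in>frontier \<Omega>. mean_curvature \<Omega> p > 0)"


subsection \<open>Surface measure\<close>

(* (n-1)-dimensional Lebesgue measure on the coordinate hyperplane where the i-th component is 0. *)
definition hyperplane_lborel :: "'n \<Rightarrow> (real^'n) measure"
where
  "hyperplane_lborel i =
     distr (Pi\<^sub>M (UNIV - {i}) (\<lambda>_. lborel)) borel (\<lambda>y. \<chi> j. if j = i then 0 else y j)"

definition graph_point :: "'n \<Rightarrow> (real^'n \<Rightarrow> real) \<Rightarrow> real^'n \<Rightarrow> real^'n"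
  where "graph_point i \<phi> y = y + \<phi> y *\<^sub>R axis i 1"

(* sigma is concentrated on S, and on every piece of S that is a smooth graph over an open subset
   of a coordinate hyperplane it is given by the classical area formula.  The set W is open in the
   full space, only its intersection with the hyperplane matters. *)
definition is_surface_measure :: "(real^'n) set \<Rightarrow> (real^'n) measure \<Rightarrow> bool"
where
  "is_surface_measure S \<sigma> \<longleftrightarrow>
     sets \<sigma> = sets borel \<and> emeasure \<sigma> (- S) = 0 \<and>
     (\<forall>i W \<phi>. open W \<and> smooth_on \<phi> W \<and> graph_point i \<phi> ` {y\<in>W. y $ i = 0} \<subseteq> S \<longrightarrow>
        (\<forall>E\<in>sets borel. E \<subseteq> graph_point i \<phi> ` {y\<in>W. y $ i = 0} \<longrightarrow>
           emeasure \<sigma> E =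
             (\<integral>\<^sup>+ y. indicator {y\<in>W. graph_point i \<phi> y \<in> E} y *
                    ennreal (sqrt (1 + (\<Sum>j\<in>UNIV - {i}. (pderiv_at j \<phi> y)\<^sup>2)))
               \<partial>hyperplane_lborel i)))"

(* For a compact smooth hypersurface S, which is covered by finitely many such graphs, this
   exists and is unique. *)
definition surface_measure :: "(real^'n) set \<Rightarrow> (real^'n) measure"
  where "surface_measure S = (THE \<sigma>. is_surface_measure S \<sigma>)"


subsection \<open>Space-like graphs\<close>

definition w_fun :: "(real^'n \<Rightarrow> real) \<Rightarrow> real^'n \<Rightarrow> real"
  where "w_fun u x = sqrt (1 - (norm (grad u x))\<^sup>2)"

definition shape_operator :: "(real^'n \<Rightarrow> real) \<Rightarrow> real^'n \<Rightarrow> real^'n^'n"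
  where "shape_operator u x = (\<chi> i j. pderiv_at i (\<lambda>y. pderiv_at j u y / w_fun u y) x)"

(* The family lam lists the eigenvalues of A with algebraic multiplicity.  They are taken over the
   complex numbers so that such a family exists for every A; for the shape operator of a
   space-like graph, which is in general not a symmetric matrix, they are all real. *)
definition eigenvalue_family :: "real^'n^'n \<Rightarrow> ('n \<Rightarrow> complex) \<Rightarrow> bool"
where
  "eigenvalue_family A lam \<longleftrightarrow>
     (\<forall>z. det (mat z - (\<chi> i j. complex_of_real (A $ i $ j))) = (\<Prod>i\<in>UNIV. z - lam i))"

definition esym :: "nat \<Rightarrow> ('n::finite \<Rightarrow> complex) \<Rightarrow> complex"
  where "esym k lam = (\<Sum>I | card I = k. \<Prod>i\<in>I. lam i)"

definition S_fun :: "nat \<Rightarrow> (real^'n \<Rightarrow> real) \<Rightarrow> real^'n \<Rightarrow> real"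
  where "S_fun k u x = Re (esym k (SOME lam. eigenvalue_family (shape_operator u x) lam))"

end

theory Submission
  imports Defs "HOL-Computational_Algebra.Fundamental_Theorem_Algebra"
begin

text \<open>Write X = Du / w, let A = DX be the shape operator, so that S_1 = div X = n and 2 S_2 = (tr A)^2 -
  tr (A^2), let \<open>\<nu>\<close> be the outer normal, H the mean curvature of the boundary and v = X \<open>\<bullet>\<close> \<open>\<nu>\<close> on the
  boundary.

  For the identity: the field (div X) X - (X . D) X has divergence 2 S_2 because second derivatives of X
  commute (\<open>divergence_flux\<close>). On the boundary u is constant, so X = v \<open>\<nu>\<close>, and the normal component of
  this field is v times the tangential divergence of v \<open>\<nu>\<close>, that is (n-1) v^2 H
  (\<open>tangential_trace_normal_field\<close>). The divergence theorem turns this into \<open>integral_S2\<close>, and applied to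
  X itself it says that v has integral n |\<open>\<Omega>\<close>| (\<open>volume_eq\<close>). By the maximum principle u \<open>\<le>\<close> c, hence v
  \<open>\<ge>\<close> 0 and v = |Du| / w. Expanding (1 - v H)^2 / H = 1/H - 2 v + v^2 H and inserting the two integrals
  gives the identity (\<open>main_identity\<close>).

  The inequality holds because A is the product of the Hessian of u with a positive definite matrix of the
  form a I + b Du Du^T; hence A - I is such a product too, with a symmetric first factor, and tr ((A -
  I)^2) \<open>\<ge>\<close> 0 with equality only for A = I (\<open>trace_square_symmetric_times_positive\<close>). As tr A = n, the
  volume integrand is exactly this trace.

  If equality holds then A = I on \<open>\<Omega>\<close>, so X = x - a, so u is a hyperboloid sqrt (1 + |x - a|^2) + k, and u
  = c forces the boundary into a sphere around a; a bounded open set with such a boundary is a ball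
  (\<open>domain_with_frontier_in_sphere\<close>). Conversely, on a ball of radius r the integral of 1/H is that of (x
  - a) \<open>\<bullet>\<close> \<open>\<nu>\<close>. If H is a constant h, the Minkowski formula reads h n |\<open>\<Omega>\<close>| = |boundary| > 0, so h > 0 and
  equality holds (\<open>constant_mean_curvature_implies_ball\<close>).

  On the analytic side, near each of its points the boundary is a graph over a coordinate hyperplane, by
  the implicit function theorem (\<open>frontier_chart_exists\<close>). For a test function supported near such a graph
  the divergence theorem, with the area formula of that graph as boundary measure, is Fubini and the
  fundamental theorem of calculus after straightening the graph by a shear (\<open>chart_divergence\<close>). Applied
  to f N, with N a unit field extending the normal, it expresses the integral of f over the graph by a
  volume integral; hence two graphs induce the same measure where they overlap (\<open>chart_measures_agree\<close>),
  the surface measure exists and is unique, and a partition of unity yields \<open>divergence_theorem\<close>. The mean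
  curvature is brought in as the tangential divergence of any extension of the normal
  (\<open>mean_curvature_eq\<close>), which rests on the spectral theorem for the differential of the normal.\<close>

section \<open>Functions with continuous derivatives up to a given order\<close>

abbreviation Ck_on :: "nat \<Rightarrow> ('a::real_normed_vector \<Rightarrow> 'b::real_normed_vector) \<Rightarrow> 'a set \<Rightarrow> bool"
  where "Ck_on k f U \<equiv> higher_differentiable_on k f U"

lemma Ck_on_mono:
  "Ck_on k f U \<Longrightarrow> V \<subseteq> U \<Longrightarrow> Ck_on k f V"
  by (induction k arbitrary: f) (auto intro: continuous_on_subset)

lemma frechet_derivative_cong_open:
  assumes "open U" "x \<in> U" "\<And>y. y \<in> U \<Longrightarrow> f y = g y"
  shows "frechet_derivative f (at x) = frechet_derivative g (at x)"
proof -
  have "(f has_derivative L) (at x) \<longleftrightarrow> (g has_derivative L) (at x)" for L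
    by (rule iffI; erule has_derivative_transform_within_open[OF _ assms(1,2)]) (use assms(3) in auto)
  then show ?thesis by (simp add: frechet_derivative_def)
qed

lemma differentiable_cong_open:
  assumes "open U" "x \<in> U" "\<And>y. y \<in> U \<Longrightarrow> f y = g y" "f differentiable (at x)"
  shows "g differentiable (at x)"
  using assms has_derivative_transform_within_open unfolding differentiable_def by blast

lemma Ck_on_cong:
  "open U \<Longrightarrow> (\<And>x. x \<in> U \<Longrightarrow> f x = g x) \<Longrightarrow> Ck_on k f U \<Longrightarrow> Ck_on k g U"
proof (induction k arbitrary: f g)
  case 0
  then show ?case using continuous_on_cong by fastforce
next
  case (Suc k)
  have "g differentiable (at x)" if "x \<in> U" for x
    using Suc.prems that by (auto intro: differentiable_cong_open)
  moreover have "Ck_on k (\<lambda>x. frechet_derivative g (at x) v) U" for v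
  proof (rule Suc.IH[of "\<lambda>x. frechet_derivative f (at x) v"])
    show "frechet_derivative f (at x) v = frechet_derivative g (at x) v" if "x \<in> U" for x
      using frechet_derivative_cong_open[OF Suc.prems(1) that Suc.prems(2)] by simp
  qed (use Suc.prems in auto)
  ultimately show ?case by simp
qed

lemma Ck_on_UN:
  "(\<And>i. i \<in> I \<Longrightarrow> open (V i)) \<Longrightarrow> (\<And>i. i \<in> I \<Longrightarrow> Ck_on k f (V i)) \<Longrightarrow>
     Ck_on k f (\<Union>i\<in>I. V i)"
  by (induction k arbitrary: f) (auto intro: continuous_on_open_UN)

lemma Ck_on_Un:
  assumes "open V" "open W" "Ck_on k f V" "Ck_on k f W"
  shows "Ck_on k f (V \<union> W)"
  using Ck_on_UN[of "{V,W}" id k f] assms by auto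

lemma Ck_on_continuous_on:
  "Ck_on k f U \<Longrightarrow> continuous_on U f"
  by (cases k) (auto intro!: continuous_at_imp_continuous_on differentiable_imp_continuous_within)

lemma Ck_on_SucD:
  "Ck_on (Suc k) f U \<Longrightarrow> Ck_on k f U"
proof (induction k arbitrary: f)
  case 0
  then show ?case using Ck_on_continuous_on[of "Suc 0"] by simp
next
  case (Suc k)
  have "Ck_on (Suc k) (\<lambda>x. frechet_derivative f (at x) v) U" for v
    using Suc.prems by (subst (asm) higher_differentiable_on.simps) blast
  then show ?case using Suc.IH Suc.prems by (simp del: higher_differentiable_on.simps add:
      higher_differentiable_on.simps(2)[of k f] higher_differentiable_on.simps(2)[of "Suc k" f])
qed

lemma Ck_on_le:
  "Ck_on k f U \<Longrightarrow> l \<le> k \<Longrightarrow> Ck_on l f U"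
  by (induction k) (use Ck_on_SucD le_Suc_eq in \<open>auto simp del: higher_differentiable_on.simps\<close>)

text \<open>The closure rules below go by induction on the order, with the function arbitrary. Each of them
  supplies a formula f' v for the derivative in direction v; that f' v is again built by the operations
  for which the rule is being proved is what makes the induction work.\<close>
lemma Ck_on_SucI:
  assumes "\<And>x. x \<in> U \<Longrightarrow> (f has_derivative (\<lambda>v. f' v x)) (at x)"
    and "open U" "\<And>v. Ck_on k (f' v) U"
  shows "Ck_on (Suc k) f U"
proof -
  have "frechet_derivative f (at x) v = f' v x" if "x \<in> U" for x v
    using frechet_derivative_at[OF assms(1)[OF that]] by metis
  then have "Ck_on k (\<lambda>x. frechet_derivative f (at x) v) U" for v
    using Ck_on_cong[OF assms(2) _ assms(3)[of v]] by simp
  then show ?thesis using assms(1) by (auto simp: differentiable_def)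
qed

lemma Ck_on_has_derivative:
  "Ck_on (Suc k) f U \<Longrightarrow> x \<in> U \<Longrightarrow> (f has_derivative frechet_derivative f (at x)) (at x)"
  by (simp add: frechet_derivative_works)

lemma Ck_on_frechet:
  "Ck_on (Suc k) f U \<Longrightarrow> Ck_on k (\<lambda>x. frechet_derivative f (at x) v) U"
  by simp

lemma Ck_on_const: "open U \<Longrightarrow> Ck_on k (\<lambda>x. c) U"
proof (induction k arbitrary: c)
  case (Suc k)
  then show ?case by (intro Ck_on_SucI[where f'="\<lambda>_ _. 0"]) auto
qed simp

lemma Ck_on_linear:
  assumes "bounded_linear f" "open U" shows "Ck_on k f U"
proof (cases k)
  case 0
  then show ?thesis using assms by (simp add: linear_continuous_on)
next
  case (Suc l)
  show ?thesis unfolding Suc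
    by (rule Ck_on_SucI[where f'="\<lambda>v _. f v"])
      (use assms bounded_linear_imp_has_derivative in \<open>auto intro: Ck_on_const\<close>)
qed

lemma Ck_on_add:
  "open U \<Longrightarrow> Ck_on k f U \<Longrightarrow> Ck_on k g U \<Longrightarrow>
    Ck_on k (\<lambda>x. f x + g x) U"
proof (induction k arbitrary: f g)
  case 0 then show ?case by (simp add: continuous_on_add)
next
  case (Suc k)
  show ?case
  proof (rule Ck_on_SucI[OF _ Suc.prems(1)])
    show "((\<lambda>x. f x + g x) has_derivative
       (\<lambda>v. (\<lambda>v x. frechet_derivative f (at x) v + frechet_derivative g (at x) v) v x)) (at x)" if "x \<in> U" for x
      using Ck_on_has_derivative[OF Suc.prems(2) that]
        Ck_on_has_derivative[OF Suc.prems(3) that] by (auto intro: has_derivative_add)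
  qed (use Suc in \<open>auto intro!: Suc.IH\<close>)
qed

lemma Ck_on_sum:
  "open U \<Longrightarrow> (\<And>i. i \<in> I \<Longrightarrow> Ck_on k (f i) U) \<Longrightarrow>
    Ck_on k (\<lambda>x. \<Sum>i\<in>I. f i x) U"
  by (induction I rule: infinite_finite_induct)
    (auto intro: Ck_on_const Ck_on_add)

lemma Ck_on_linear_comp:
  "bounded_linear L \<Longrightarrow> open U \<Longrightarrow> Ck_on k f U \<Longrightarrow>
    Ck_on k (\<lambda>x. L (f x)) U"
proof (induction k arbitrary: f)
  case 0 then show ?case by (auto intro: bounded_linear.continuous_on)
next
  case (Suc k)
  show ?case
    by (rule Ck_on_SucI[where f'="\<lambda>v x. L (frechet_derivative f (at x) v)"])
      (use Suc Ck_on_has_derivative[OF Suc.prems(3)] in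
        \<open>auto intro!: Suc.IH bounded_linear.has_derivative[of L]\<close>)
qed

lemma Ck_on_bilinear:
  assumes bil: "bounded_bilinear pr"
  shows "open U \<Longrightarrow> Ck_on k f U \<Longrightarrow> Ck_on k g U \<Longrightarrow>
    Ck_on k (\<lambda>x. pr (f x) (g x)) U"
proof (induction k arbitrary: f g)
  case 0 then show ?case by (auto intro: bounded_bilinear.continuous_on[OF bil])
next
  case (Suc k)
  have fk: "Ck_on k f U" "Ck_on k g U"
    using Suc.prems Ck_on_SucD by blast+
  show ?case
  proof (rule Ck_on_SucI[OF _ Suc.prems(1)])
    show "((\<lambda>x. pr (f x) (g x)) has_derivative
       (\<lambda>v. (\<lambda>v x. pr (f x) (frechet_derivative g (at x) v) + pr (frechet_derivative f (at x) v) (g x)) v x))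
           (at x)" if "x \<in> U" for x
      using bounded_bilinear.FDERIV[OF bil Ck_on_has_derivative[OF Suc.prems(2) that]
        Ck_on_has_derivative[OF Suc.prems(3) that]] by simp
  qed (use Suc fk in \<open>auto intro!: Suc.IH Ck_on_add\<close>)
qed

lemmas Ck_on_mult = Ck_on_bilinear[OF bounded_bilinear_mult]
  and Ck_on_scaleR = Ck_on_bilinear[OF bounded_bilinear_scaleR]
  and Ck_on_inner = Ck_on_bilinear[OF bounded_bilinear_inner]

lemma Ck_on_minus:
  "open U \<Longrightarrow> Ck_on k f U \<Longrightarrow> Ck_on k (\<lambda>x. - f x) U"
  using Ck_on_linear_comp[OF bounded_linear_minus[OF bounded_linear_ident]] by auto

lemma Ck_on_diff:
  "open U \<Longrightarrow> Ck_on k f U \<Longrightarrow> Ck_on k g U \<Longrightarrow>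
    Ck_on k (\<lambda>x. f x - g x) U"
  using Ck_on_add[OF _ _ Ck_on_minus] by fastforce

text \<open>By the chain rule a directional derivative of the composition is a finite sum of components of Dg
  times partial derivatives of f evaluated at g, so the induction reduces to products and to the claim for
  these partial derivatives.\<close>
lemma Ck_on_compose:
  fixes g :: "'a::real_normed_vector \<Rightarrow> 'b::euclidean_space"
  shows "open U \<Longrightarrow> open V \<Longrightarrow> g ` U \<subseteq> V \<Longrightarrow> Ck_on k f V \<Longrightarrow>
    Ck_on k g U \<Longrightarrow> Ck_on k (\<lambda>x. f (g x)) U"
proof (induction k arbitrary: f)
  case 0 then show ?case by (auto intro: continuous_on_compose2)
next
  case (Suc k)
  have gk: "Ck_on k g U"
    using Suc.prems Ck_on_SucD by blast
  let ?D = "\<lambda>v x. \<Sum>b\<in>Basis. (frechet_derivative g (at x) v \<bullet> b) *\<^sub>R frechet_derivative f (at (g x)) b"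
  show ?case
  proof (rule Ck_on_SucI[where f'="?D"])
    show "((\<lambda>x. f (g x)) has_derivative (\<lambda>v. ?D v x)) (at x)" if x: "x \<in> U" for x
    proof -
      have f: "(f has_derivative frechet_derivative f (at (g x))) (at (g x))"
        using Ck_on_has_derivative[OF Suc.prems(4)] x Suc.prems(3) by blast
      have g: "(g has_derivative frechet_derivative g (at x)) (at x)"
        using Ck_on_has_derivative[OF Suc.prems(5) x] .
      have lin: "linear (frechet_derivative f (at (g x)))"
        using f has_derivative_linear by blast
      have "frechet_derivative f (at (g x)) (frechet_derivative g (at x) v) = ?D v x" for v
        by (subst euclidean_representation[of "frechet_derivative g (at x) v", symmetric])
          (simp only: linear_sum[OF lin] linear_scale[OF lin])
      then show ?thesis
        using has_derivative_compose[OF g f] by simp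
    qed
    show "Ck_on k (?D v) U" for v
    proof (intro Ck_on_sum Ck_on_scaleR Suc.prems)
      show "Ck_on k (\<lambda>x. frechet_derivative g (at x) v \<bullet> b) U" for b :: 'b
        using Suc.prems(1,5) by (intro Ck_on_linear_comp[OF bounded_linear_inner_left]) auto
      show "Ck_on k (\<lambda>x. frechet_derivative f (at (g x)) b) U" for b
        by (rule Suc.IH[of "\<lambda>y. frechet_derivative f (at y) b"]) (use Suc.prems gk in auto)
    qed
  qed (use Suc.prems in auto)
qed

lemma Ck_on_inverse_real: "Ck_on k inverse (- {0::real})"
proof (induction k)
  case (Suc k)
  show ?case
  proof (rule Ck_on_SucI[where f'="\<lambda>v x. - (inverse x * v * inverse x)"])
    show "Ck_on k (\<lambda>x. - (inverse x * v * inverse x)) (- {0})" for v :: real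
      by (intro Ck_on_minus Ck_on_mult Ck_on_const Suc open_Compl closed_singleton)
    show "(inverse has_derivative (\<lambda>v. - (inverse x * v * inverse x))) (at x)" if "x \<in> - {0}" for x :: real
      using that has_derivative_inverse'[of x] by simp
  qed (rule open_Compl[OF closed_singleton])
qed (auto intro: continuous_on_inverse)

lemma Ck_on_inverse:
  fixes f :: "'a::real_normed_vector \<Rightarrow> real"
  assumes "open U" "Ck_on k f U" "\<And>x. x \<in> U \<Longrightarrow> f x \<noteq> 0"
  shows "Ck_on k (\<lambda>x. inverse (f x)) U"
  by (rule Ck_on_compose[OF assms(1) _ _ Ck_on_inverse_real assms(2)])
    (use assms(3) in \<open>auto intro: open_Compl\<close>)

lemma Ck_on_divide:
  fixes f :: "'a::real_normed_vector \<Rightarrow> real"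
  assumes "open U" "Ck_on k f U" "Ck_on k g U" "\<And>x. x \<in> U \<Longrightarrow> g x \<noteq> 0"
  shows "Ck_on k (\<lambda>x. f x / g x) U"
  using assms unfolding divide_inverse
  by (intro Ck_on_mult Ck_on_inverse) auto

lemma Ck_on_sqrt_real: "Ck_on k sqrt {0<..}"
proof (induction k)
  case (Suc k)
  show ?case
  proof (rule Ck_on_SucI[where f'="\<lambda>v x. v * inverse (2 * sqrt x)"])
    show "Ck_on k (\<lambda>x. v * inverse (2 * sqrt x)) {0<..}" for v :: real
      by (intro Ck_on_inverse Ck_on_mult Ck_on_const Suc) auto
    show "(sqrt has_derivative (\<lambda>v. v * inverse (2 * sqrt x))) (at x)" if "x \<in> {0<..}" for x
      using that by (auto intro!: derivative_eq_intros simp: field_simps)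
  qed auto
qed (auto intro: continuous_on_real_sqrt)

lemma Ck_on_sqrt:
  fixes f :: "'a::real_normed_vector \<Rightarrow> real"
  assumes "open U" "Ck_on k f U" "\<And>x. x \<in> U \<Longrightarrow> f x > 0"
  shows "Ck_on k (\<lambda>x. sqrt (f x)) U"
  by (rule Ck_on_compose[OF assms(1) _ _ Ck_on_sqrt_real assms(2)])
    (use assms(3) in auto)

lemma Ck_on_power:
  fixes f :: "'a::real_normed_vector \<Rightarrow> real"
  assumes "open U" "Ck_on k f U"
  shows "Ck_on k (\<lambda>x. f x ^ m) U"
  using assms by (induction m) (auto intro!: Ck_on_mult Ck_on_const)

lemma Ck_on_prod:
  fixes f :: "'i \<Rightarrow> 'a::real_normed_vector \<Rightarrow> real"
  shows "open U \<Longrightarrow> (\<And>i. i \<in> I \<Longrightarrow> Ck_on k (f i) U) \<Longrightarrow>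
    Ck_on k (\<lambda>x. \<Prod>i\<in>I. f i x) U"
  by (induction I rule: infinite_finite_induct)
    (auto intro: Ck_on_const Ck_on_mult)

text \<open>The source of all cut-off functions: its derivative is a multiple of the previous power, so order
  k comes with only power k + 1, and everything stays piecewise polynomial.\<close>
lemma Ck_on_pos_part_power:
  "Ck_on k (\<lambda>t::real. max 0 t ^ Suc k) UNIV"
proof (induction k)
  case 0 then show ?case by (auto intro!: continuous_intros)
next
  case (Suc k)
  show ?case
  proof (rule Ck_on_SucI[where f'="\<lambda>v x. (real (Suc (Suc k)) * v) * max 0 x ^ Suc k"])
    show "Ck_on k (\<lambda>x::real. (real (Suc (Suc k)) * v) * max 0 x ^ Suc k) UNIV" for v
      using Suc by (intro Ck_on_mult Ck_on_const) auto
    fix x :: real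
    have "((\<lambda>t::real. max 0 t ^ Suc (Suc k)) has_real_derivative real (Suc (Suc k)) * max 0 x ^ Suc k) (at x)"
    proof -
      consider "x > 0" | "x < 0" | "x = 0" by linarith
      then show ?thesis
      proof cases
        case 1
        have "((\<lambda>t::real. t ^ Suc (Suc k)) has_real_derivative real (Suc (Suc k)) * max 0 x ^ Suc k) (at x)"
          using DERIV_pow[of "Suc (Suc k)" x] 1 by simp
        then show ?thesis
          by (rule has_field_derivative_transform_within_open[where S="{0<..}"]) (use 1 in auto)
      next
        case 2
        have "((\<lambda>t::real. 0) has_real_derivative real (Suc (Suc k)) * max 0 x ^ Suc k) (at x)"
          using 2 by (auto intro!: derivative_eq_intros simp: max_def)
        then show ?thesis
          by (rule has_field_derivative_transform_within_open[where S="{..<0}"]) (use 2 in auto)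
      next
        case 3
        have "((\<lambda>t. (max 0 t ^ Suc (Suc k) - max 0 0 ^ Suc (Suc k)) / (t - 0)) \<longlongrightarrow> (0::real)) (at 0)"
        proof (rule Lim_null_comparison)
          show "\<forall>\<^sub>F t in at 0. norm ((max 0 t ^ Suc (Suc k) - max 0 0 ^ Suc (Suc k)) / (t - 0)) \<le> \<bar>t\<bar> ^ Suc k"
            by (rule always_eventually) (auto simp: max_def power_abs mult_nonpos_nonneg)
          show "((\<lambda>t::real. \<bar>t\<bar> ^ Suc k) \<longlongrightarrow> 0) (at 0)"
            by (rule tendsto_eq_intros refl | simp)+
        qed
        then show ?thesis using 3 by (simp add: has_field_derivative_iff)
      qed
    qed
    moreover have "(\<lambda>v. real (Suc (Suc k)) * v * max 0 x ^ Suc k) = (*) (real (Suc (Suc k)) * max 0 x ^ Suc k)"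
      by (simp add: fun_eq_iff)
    ultimately show "((\<lambda>t::real. max 0 t ^ Suc (Suc k)) has_derivative
      (\<lambda>v. real (Suc (Suc k)) * v * max 0 x ^ Suc k)) (at x)"
      unfolding has_field_derivative_def by simp
  qed auto
qed

lemma pderiv_at_eq: "(f has_derivative L) (at x) \<Longrightarrow> pderiv_at i f x = L (axis i 1)"
  unfolding pderiv_at_def by (metis frechet_derivative_at)

lemma has_derivative_pderivs:
  assumes "(f has_derivative L) (at x)" shows "L v = (\<Sum>j\<in>UNIV. v $ j * pderiv_at j f x)"
proof -
  have "linear L" using assms has_derivative_linear by blast
  then have "L (\<Sum>j\<in>UNIV. (v $ j) *\<^sub>R axis j 1) = (\<Sum>j\<in>UNIV. v $ j * L (axis j 1))"
    by (simp add: linear_sum linear_scale)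
  moreover have "(\<Sum>j\<in>UNIV. (v $ j) *\<^sub>R axis j 1) = v"
    using basis_expansion[of v] by (simp add: scalar_mult_eq_scaleR)
  ultimately show ?thesis by (simp add: pderiv_at_eq[OF assms])
qed

lemma Ck_on_pderiv_at:
  "Ck_on (Suc k) f U \<Longrightarrow> Ck_on k (pderiv_at i f) U"
  unfolding pderiv_at_def[abs_def] by simp

lemma Ck_on_has_pderivs:
  assumes "Ck_on (Suc k) f U" "x \<in> U"
  shows "(f has_derivative (\<lambda>v. \<Sum>j\<in>UNIV. v $ j * pderiv_at j f x)) (at x)"
  using Ck_on_has_derivative[OF assms] has_derivative_pderivs by (metis (no_types, lifting) ext)

lemma pderiv_at_cong_open:
  "open U \<Longrightarrow> x \<in> U \<Longrightarrow> (\<And>y. y \<in> U \<Longrightarrow> f y = g y) \<Longrightarrow> pderiv_at i f x = pderiv_at i g x"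
  unfolding pderiv_at_def by (metis frechet_derivative_cong_open)

lemma Ck_on_vec_nth:
  "open U \<Longrightarrow> Ck_on k f U \<Longrightarrow> Ck_on k (\<lambda>x. f x $ i) U"
  by (rule Ck_on_linear_comp[OF bounded_linear_vec_nth])

lemma Ck_on_vec_lambda:
  fixes f :: "'n::finite \<Rightarrow> 'a::real_normed_vector \<Rightarrow> real"
  assumes "open U" "\<And>i. Ck_on k (f i) U"
  shows "Ck_on k (\<lambda>x. \<chi> i. f i x) U"
proof -
  have "Ck_on k (\<lambda>x. \<Sum>i\<in>UNIV. f i x *\<^sub>R (axis i 1 :: real^'n)) U"
    using assms by (intro Ck_on_sum Ck_on_scaleR Ck_on_const)
  moreover have "(\<Sum>i\<in>UNIV. f i x *\<^sub>R (axis i 1 :: real^'n)) = (\<chi> i. f i x)" for x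
    using basis_expansion[of "\<chi> i. f i x"] by (simp add: scalar_mult_eq_scaleR)
  ultimately show ?thesis by simp
qed

lemma Ck_on_grad:
  "open U \<Longrightarrow> Ck_on (Suc k) f U \<Longrightarrow> Ck_on k (grad f) U"
  unfolding grad_def[abs_def]
  by (intro Ck_on_vec_lambda Ck_on_pderiv_at) auto

lemma has_derivative_grad:
  "Ck_on (Suc k) f U \<Longrightarrow> x \<in> U \<Longrightarrow> (f has_derivative (\<lambda>v. grad f x \<bullet> v)) (at x)"
  using Ck_on_has_pderivs[of k f U x]
  by (simp add: inner_vec_def grad_def mult.commute)

lemma mean_value_1d:
  assumes "\<And>s. \<lbrakk>0 \<le> s; s \<le> h\<rbrakk> \<Longrightarrow> (g has_real_derivative g' s) (at s)" "0 < h"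
  obtains \<xi> where "0 < \<xi>" "\<xi> < h" "g h - g 0 = h * g' \<xi>"
  using MVT2[of 0 h g g'] assms by auto

text \<open>Schwarz: the second difference of f over the parallelogram spanned by h v and h w equals, by two
  applications of the mean value theorem, h^2 times either mixed derivative at some point of the
  parallelogram. Let h tend to 0.\<close>
lemma mixed_derivatives_commute:
  fixes f :: "'a::real_normed_vector \<Rightarrow> real"
  assumes U: "open U" "x \<in> U" and f: "Ck_on 2 f U"
  shows "frechet_derivative (\<lambda>y. frechet_derivative f (at y) v) (at x) w =
         frechet_derivative (\<lambda>y. frechet_derivative f (at y) w) (at x) v"
proof -
  define D where "D = (\<lambda>v y. frechet_derivative f (at y) v)"
  define DD where "DD = (\<lambda>v w y. frechet_derivative (D v) (at y) w)"
  have f2: "Ck_on (Suc (Suc 0)) f U" using f by (simp add: numeral_2_eq_2)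
  have Df: "(f has_derivative (\<lambda>v. D v y)) (at y)" if "y \<in> U" for y
    unfolding D_def using Ck_on_has_derivative[OF f2 that] .
  have D1: "Ck_on (Suc 0) (D v) U" for v
    unfolding D_def using f2 Ck_on_frechet by blast
  have DDf: "(D v has_derivative (\<lambda>w. DD v w y)) (at y)" if "y \<in> U" for y v
    unfolding DD_def using Ck_on_has_derivative[OF D1 that] .
  have cont: "continuous_on U (DD v w)" for v w
    unfolding DD_def using Ck_on_frechet[OF D1] by simp
  have lin: "linear (\<lambda>v. D v y)" if "y \<in> U" for y using Df[OF that] has_derivative_linear by blast
  have lin2: "linear (\<lambda>w. DD v w y)" if "y \<in> U" for y v using DDf[OF that] has_derivative_linear by blast
  have key: "\<exists>a b. 0 < a \<and> a < h \<and> 0 < b \<and> b < h \<and>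
      f (x + h *\<^sub>R v + h *\<^sub>R w) - f (x + h *\<^sub>R v) - (f (x + h *\<^sub>R w) - f x) = h *
          (h * DD v w (x + a *\<^sub>R v + b *\<^sub>R w))"
    if h: "0 < h" and inU: "\<And>a b. \<lbrakk>0 \<le> a; a \<le> h; 0 \<le> b; b \<le> h\<rbrakk> \<Longrightarrow> x + a *\<^sub>R v + b *\<^sub>R w \<in> U" for h v w
  proof -
    have d: "((\<lambda>s. f (x + s *\<^sub>R v + b *\<^sub>R w)) has_real_derivative D v (x + s *\<^sub>R v + b *\<^sub>R w)) (at s)"
      if "0 \<le> s" "s \<le> h" "0 \<le> b" "b \<le> h" for s b
    proof -
      have "((\<lambda>s. x + s *\<^sub>R v + b *\<^sub>R w) has_derivative (\<lambda>t. t *\<^sub>R v)) (at s)"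
        by (auto intro!: derivative_eq_intros)
      from has_derivative_compose[OF this Df[OF inU[OF that]]]
      show ?thesis using linear_scale[OF lin[OF inU[OF that]]]
        by (simp add: has_field_derivative_def mult_commute_abs)
    qed
    have d2: "((\<lambda>s. D v (x + a *\<^sub>R v + s *\<^sub>R w)) has_real_derivative DD v w (x + a *\<^sub>R v + s *\<^sub>R w)) (at s)"
      if "0 \<le> a" "a \<le> h" "0 \<le> s" "s \<le> h" for s a
    proof -
      have "((\<lambda>s. x + a *\<^sub>R v + s *\<^sub>R w) has_derivative (\<lambda>t. t *\<^sub>R w)) (at s)"
        by (auto intro!: derivative_eq_intros)
      from has_derivative_compose[OF this DDf[OF inU[OF that]]]
      show ?thesis using linear_scale[OF lin2[OF inU[OF that]]]
        by (simp add: has_field_derivative_def mult_commute_abs)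
    qed
    let ?g = "\<lambda>s. f (x + s *\<^sub>R v + h *\<^sub>R w) - f (x + s *\<^sub>R v + 0 *\<^sub>R w)"
    obtain a where a: "0 < a" "a < h" "?g h - ?g 0 = h * (D v (x + a *\<^sub>R v + h *\<^sub>R w) - D v
        (x + a *\<^sub>R v + 0 *\<^sub>R w))"
      by (rule mean_value_1d[of h ?g "\<lambda>s. D v (x + s *\<^sub>R v + h *\<^sub>R w) - D v (x + s *\<^sub>R v + 0 *\<^sub>R w)"])
        (use h in \<open>auto intro!: DERIV_diff d simp del: scaleR_zero_left\<close>)
    obtain b where b: "0 < b" "b < h" "D v (x + a *\<^sub>R v + h *\<^sub>R w) - D v (x + a *\<^sub>R v + 0 *\<^sub>R w) = h * DD v w
        (x + a *\<^sub>R v + b *\<^sub>R w)"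
      by (rule mean_value_1d[of h "\<lambda>s. D v (x + a *\<^sub>R v + s *\<^sub>R w)" "\<lambda>s. DD v w (x + a *\<^sub>R v + s *\<^sub>R w)"])
        (use h a in \<open>auto intro!: d2\<close>)
    show ?thesis using a b by (intro exI[of _ a] exI[of _ b]) (simp add: algebra_simps)
  qed
  have "\<bar>DD v w x - DD w v x\<bar> \<le> e" if e: "e > 0" for e
  proof -
    have "\<exists>d>0. \<forall>y. dist y x < d \<longrightarrow> y \<in> U \<and> \<bar>DD v w y - DD v w x\<bar> < e/2" for v w
    proof -
      have "isCont (DD v w) x" using cont U continuous_on_eq_continuous_at by blast
      then obtain d where "d > 0" "\<forall>y. dist y x < d \<longrightarrow> \<bar>DD v w y - DD v w x\<bar> < e/2"
        using e unfolding continuous_at_eps_delta dist_real_def by (meson half_gt_zero)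
      moreover obtain d' where "d' > 0" "\<forall>y. dist y x < d' \<longrightarrow> y \<in> U"
        using U open_dist by blast
      ultimately show ?thesis by (intro exI[of _ "min d d'"]) auto
    qed
    then obtain d1 d2 where d1: "d1 > 0" "\<And>y. dist y x < d1 \<Longrightarrow> y \<in> U \<and> \<bar>DD v w y - DD v w x\<bar> < e/2"
      and d2: "d2 > 0" "\<And>y. dist y x < d2 \<Longrightarrow> y \<in> U \<and> \<bar>DD w v y - DD w v x\<bar> < e/2" by metis
    \<comment> \<open>so small that the whole parallelogram lies within distance min d1 d2 of x\<close>
    define h where "h = min d1 d2 / (2 * (norm v + norm w + 1))"
    have h: "h > 0" unfolding h_def using d1(1) d2(1) by (auto intro!: divide_pos_pos add_nonneg_pos)
    have near: "dist (x + a *\<^sub>R v + b *\<^sub>R w) x < min d1 d2" if "0 \<le> a" "a \<le> h" "0 \<le> b" "b \<le> h" for a b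
    proof -
      have "norm (a *\<^sub>R v + b *\<^sub>R w) \<le> h * norm v + h * norm w"
        by (rule order_trans[OF norm_triangle_ineq]) (use that in \<open>auto intro!: add_mono mult_right_mono\<close>)
      also have "\<dots> < h * (2 * (norm v + norm w + 1))" using h by (auto simp: algebra_simps add_nonneg_pos)
      also have "\<dots> = min d1 d2" unfolding h_def by (simp add: add_nonneg_eq_0_iff add_nonneg_pos field_simps)
      finally show ?thesis by (simp add: dist_norm add.assoc)
    qed
    obtain a b where ab: "0 < a" "a < h" "0 < b" "b < h"
      "f (x + h *\<^sub>R v + h *\<^sub>R w) - f (x + h *\<^sub>R v) - (f (x + h *\<^sub>R w) - f x) = h *
          (h * DD v w (x + a *\<^sub>R v + b *\<^sub>R w))"
      using key[of h v w] h near d1 by force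
    have near': "x + a *\<^sub>R w + b *\<^sub>R v \<in> U" if "0 \<le> a" "a \<le> h" "0 \<le> b" "b \<le> h" for a b
      using d1(2)[of "x + b *\<^sub>R v + a *\<^sub>R w"] near[of b a] that by (simp add: algebra_simps)
    obtain a' b' where ab': "0 < a'" "a' < h" "0 < b'" "b' < h"
      "f (x + h *\<^sub>R w + h *\<^sub>R v) - f (x + h *\<^sub>R w) - (f (x + h *\<^sub>R v) - f x) = h *
          (h * DD w v (x + a' *\<^sub>R w + b' *\<^sub>R v))"
      using key[of h w v] h near' by force
    have "DD v w (x + a *\<^sub>R v + b *\<^sub>R w) = DD w v (x + a' *\<^sub>R w + b' *\<^sub>R v)"
      using ab(5) ab'(5) h by (simp add: algebra_simps)
    moreover have "dist (x + a' *\<^sub>R w + b' *\<^sub>R v) x < min d1 d2"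
      using near[of b' a'] ab' by (simp add: algebra_simps)
    moreover have c1: "\<bar>DD v w (x + a *\<^sub>R v + b *\<^sub>R w) - DD v w x\<bar> < e/2"
      using d1(2)[of "x + a *\<^sub>R v + b *\<^sub>R w"] near[of a b] ab by auto
    moreover have c2: "\<bar>DD w v (x + a' *\<^sub>R w + b' *\<^sub>R v) - DD w v x\<bar> < e/2" if "dist (x + a' *\<^sub>R w + b' *\<^sub>R v) x <
        min d1 d2"
      using d2(2) that by auto
    ultimately show ?thesis using c1 c2 by (simp only:) arith
  qed
  then have "\<bar>DD v w x - DD w v x\<bar> \<le> 0" by (rule field_le_epsilon) simp
  then have "DD v w x = DD w v x" by simp
  then show ?thesis unfolding DD_def D_def .
qed

lemma pderiv_at_commute:
  assumes "open U" "x \<in> U" "Ck_on 2 f U"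
  shows "pderiv_at i (pderiv_at j f) x = pderiv_at j (pderiv_at i f) x"
  using mixed_derivatives_commute[OF assms] unfolding pderiv_at_def[abs_def] .

section \<open>The boundary as a graph\<close>

text \<open>The charts in the definition of the surface measure live on coordinate hyperplanes inside the full
  space; this is the projection onto such a hyperplane.\<close>
definition drop_coord :: "'n \<Rightarrow> real^'n \<Rightarrow> real^'n"
  where "drop_coord i y = y - (y $ i) *\<^sub>R axis i 1"

lemma drop_coord_nth [simp]: "drop_coord i y $ j = (if j = i then 0 else y $ j)"
  by (simp add: drop_coord_def axis_def)

lemma drop_coord_add: "drop_coord i (x + y) = drop_coord i x + drop_coord i y"
  and drop_coord_scaleR: "drop_coord i (c *\<^sub>R x) = c *\<^sub>R drop_coord i x"
  and drop_coord_axis [simp]: "drop_coord i (axis i c) = 0"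
  and drop_coord_idem: "y $ i = 0 \<Longrightarrow> drop_coord i y = y"
  by (auto simp: vec_eq_iff axis_def)

lemma drop_coord_recompose: "drop_coord i y + (y $ i) *\<^sub>R axis i 1 = y"
  by (simp add: drop_coord_def)

lemma bounded_linear_drop_coord: "bounded_linear (drop_coord i)"
  by (rule linear_conv_bounded_linear[THEN iffD1], rule linearI) (simp_all add: drop_coord_add
      drop_coord_scaleR)

lemma continuous_on_drop_coord [continuous_intros]: "continuous_on A (drop_coord i)"
  by (simp add: linear_continuous_on bounded_linear_drop_coord)

lemma has_derivative_drop_coord: "(drop_coord i has_derivative drop_coord i) F"
  by (rule bounded_linear_imp_has_derivative[OF bounded_linear_drop_coord])

lemma inner_drop_coord: "x \<bullet> drop_coord i v = (\<Sum>j\<in>UNIV - {i}. x $ j * v $ j)"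
  unfolding inner_vec_def by (subst sum.remove[of UNIV i]) (auto intro!: sum.cong)

lemma has_real_derivativeI:
  "(f has_derivative D) F \<Longrightarrow> (\<And>s. D s = c * s) \<Longrightarrow> (f has_field_derivative c) F"
  by (metis (no_types, lifting) ext has_field_derivative_def)

lemma mean_value_along_axis:
  fixes \<rho> :: "real^'n \<Rightarrow> real"
  assumes "convex B" "x \<in> B" "x + h *\<^sub>R axis i 1 \<in> B"
    and der: "\<And>x. x \<in> B \<Longrightarrow> (\<rho> has_derivative (\<lambda>v. g x \<bullet> v)) (at x)"
  obtains \<xi> where "\<xi> \<in> B" "\<rho> (x + h *\<^sub>R axis i 1) - \<rho> x = h * g \<xi> $ i"
proof -
  have inB: "x + (t * h) *\<^sub>R axis i 1 \<in> B" if "0 \<le> t" "t \<le> 1" for t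
  proof -
    have "(1 - t) *\<^sub>R x + t *\<^sub>R (x + h *\<^sub>R axis i 1) \<in> B" using assms that by (intro convexD) auto
    then show ?thesis by (simp add: algebra_simps)
  qed
  have "((\<lambda>t. \<rho> (x + (t * h) *\<^sub>R axis i 1)) has_real_derivative h * g (x + (t * h) *\<^sub>R axis i 1) $ i) (at t)"
    if "0 \<le> t" "t \<le> 1" for t
  proof -
    have "((\<lambda>t. x + (t * h) *\<^sub>R axis i 1) has_derivative (\<lambda>s. (s * h) *\<^sub>R axis i 1)) (at t)"
      by (auto intro!: derivative_eq_intros)
    from has_derivative_compose[OF this der[OF inB[OF that]]]
    show ?thesis by (rule has_real_derivativeI) (simp add: inner_axis)
  qed
  then obtain t where "0 < t" "t < 1" "\<rho> (x + (1 * h) *\<^sub>R axis i 1) - \<rho> (x + (0 * h) *\<^sub>R axis i 1) = 1 *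
      (h * g (x + (t * h) *\<^sub>R axis i 1) $ i)"
    by (rule mean_value_1d[where h=1]) auto
  then show ?thesis using that inB[of t] by auto
qed

lemma smooth_on_has_derivative_grad:
  "smooth_on \<rho> V \<Longrightarrow> x \<in> V \<Longrightarrow> (\<rho> has_derivative (\<lambda>v. grad \<rho> x \<bullet> v)) (at x)"
  using has_derivative_grad[of 0] unfolding smooth_on_def by blast

lemma directional_derivative:
  assumes "(\<rho> has_derivative (\<lambda>v. g \<bullet> v)) (at x)"
  shows "((\<lambda>t. \<rho> (x + t *\<^sub>R v)) has_real_derivative g \<bullet> v) (at 0)"
proof -
  have "((\<lambda>t. x + t *\<^sub>R v) has_derivative (\<lambda>s. s *\<^sub>R v)) (at 0)"
    by (auto intro!: derivative_eq_intros)
  from has_derivative_compose[OF this, of \<rho> "\<lambda>v. g \<bullet> v"] assms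
  show ?thesis by (auto intro: has_real_derivativeI)
qed

lemma eventually_on_ray:
  assumes "open V" "x \<in> V"
  obtains d :: real where "d > 0" "\<And>t. 0 < t \<Longrightarrow> t < d \<Longrightarrow> x + t *\<^sub>R (v::'a::real_normed_vector) \<in> V"
proof -
  obtain e where e: "e > 0" "ball x e \<subseteq> V" using assms open_contains_ball by blast
  have pos: "norm v + 1 > 0" by (simp add: add_nonneg_pos)
  show ?thesis
  proof (rule that[of "e / (norm v + 1)"])
    show "e / (norm v + 1) > 0" using e pos by simp
    fix t :: real assume t: "0 < t" "t < e / (norm v + 1)"
    have "t * norm v \<le> t * (norm v + 1)" using t by simp
    also have "\<dots> < e" using t pos by (simp add: pos_less_divide_eq)
    finally show "x + t *\<^sub>R v \<in> V" using e t by (auto simp: dist_norm)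
  qed
qed

context
  fixes \<Omega> :: "(real^'n) set" and q V \<rho>
  assumes ldf: "local_defining_function \<Omega> q V \<rho>"
begin

lemma local_defining_functionD: "open V" "q \<in> V" "smooth_on \<rho> V" "\<And>x. x \<in> V \<Longrightarrow> grad \<rho> x \<noteq> 0"
  "\<And>x. x \<in> V \<Longrightarrow> x \<in> \<Omega> \<longleftrightarrow> \<rho> x < 0"
  using ldf unfolding local_defining_function_def by blast+

text \<open>This lemma and the next one give one-sided information about rays; it suffices to compare two
  defining functions at a common boundary point, and to transfer the maximum principle to the normal
  derivative.\<close>
lemma inward_ray:
  assumes "x \<in> V" "\<rho> x \<le> 0" "grad \<rho> x \<bullet> v < 0"
  obtains d where "d > 0" "\<And>t. 0 < t \<Longrightarrow> t < d \<Longrightarrow> x + t *\<^sub>R v \<in> \<Omega>"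
proof -
  obtain d where d: "d > 0" "\<And>t. 0 < t \<Longrightarrow> t < d \<Longrightarrow> x + t *\<^sub>R v \<in> V"
    using eventually_on_ray[of V x v] local_defining_functionD assms by metis
  obtain d' where d': "d' > 0" "\<And>t. 0 < t \<Longrightarrow> t < d' \<Longrightarrow> \<rho> (x + t *\<^sub>R v) < \<rho> x"
    using has_real_derivative_neg_dec_right[OF directional_derivative[OF smooth_on_has_derivative_grad[OF
        local_defining_functionD(3) assms(1)]] assms(3)]
    by auto
  show ?thesis
  proof (rule that[of "min d d'"])
    show "x + t *\<^sub>R v \<in> \<Omega>" if "0 < t" "t < min d d'" for t
      using d(2)[of t] d'(2)[of t] that assms(2) local_defining_functionD(5)[of "x + t *\<^sub>R v"] by auto
  qed (use d d' in auto)
qed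

lemma outward_ray:
  assumes "x \<in> V" "\<rho> x \<ge> 0" "grad \<rho> x \<bullet> v > 0"
  obtains d where "d > 0" "\<And>t. 0 < t \<Longrightarrow> t < d \<Longrightarrow> x + t *\<^sub>R v \<notin> \<Omega>"
proof -
  obtain d where d: "d > 0" "\<And>t. 0 < t \<Longrightarrow> t < d \<Longrightarrow> x + t *\<^sub>R v \<in> V"
    using eventually_on_ray[of V x v] local_defining_functionD assms by metis
  obtain d' where d': "d' > 0" "\<And>t. 0 < t \<Longrightarrow> t < d' \<Longrightarrow> \<rho> (x + t *\<^sub>R v) > \<rho> x"
    using has_real_derivative_pos_inc_right[OF directional_derivative[OF smooth_on_has_derivative_grad[OF
        local_defining_functionD(3) assms(1)]] assms(3)]
    by auto
  show ?thesis
  proof (rule that[of "min d d'"])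
    show "x + t *\<^sub>R v \<notin> \<Omega>" if "0 < t" "t < min d d'" for t
      using d(2)[of t] d'(2)[of t] that assms(2) local_defining_functionD(5)[of "x + t *\<^sub>R v"] by auto
  qed (use d d' in auto)
qed

text \<open>A zero of \<open>\<rho>\<close> is approached from inside the domain along the negative gradient; here the gradient
  being nonzero enters.\<close>
lemma local_defining_function_frontier_iff:
  assumes "open \<Omega>" "x \<in> V" shows "x \<in> frontier \<Omega> \<longleftrightarrow> \<rho> x = 0"
proof
  assume x: "x \<in> frontier \<Omega>"
  then have "x \<notin> \<Omega>" "x \<in> closure \<Omega>" using assms(1) by (auto simp: frontier_def interior_open)
  moreover have "\<not> \<rho> x > 0"
  proof
    assume "\<rho> x > 0"
    have "open {y\<in>V. \<rho> y > 0}"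
      using continuous_open_preimage[of V \<rho> "{0<..}"] local_defining_functionD(1,3)
        Ck_on_continuous_on[of 0 \<rho> V] unfolding smooth_on_def
      by (simp add: vimage_def Int_def)
    moreover have "{y\<in>V. \<rho> y > 0} \<inter> \<Omega> = {}" using local_defining_functionD(5) by auto
    ultimately show False using \<open>x \<in> closure \<Omega>\<close> \<open>\<rho> x > 0\<close> assms(2)
      by (metis (mono_tags, lifting) disjoint_iff mem_Collect_eq open_Int_closure_eq_empty)
  qed
  ultimately show "\<rho> x = 0" using local_defining_functionD(5)[OF assms(2)] by auto
next
  assume x: "\<rho> x = 0"
  obtain d where d: "d > 0" "\<And>t. 0 < t \<Longrightarrow> t < d \<Longrightarrow> x + t *\<^sub>R (- grad \<rho> x) \<in> \<Omega>"
    using inward_ray[of x "- grad \<rho> x"] x assms local_defining_functionD by auto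
  have "((\<lambda>t. x + t *\<^sub>R (- grad \<rho> x)) \<longlongrightarrow> x + 0 *\<^sub>R (- grad \<rho> x)) (at_right 0)"
    by (intro tendsto_intros)
  moreover have "\<forall>\<^sub>F t in at_right 0. x + t *\<^sub>R (- grad \<rho> x) \<in> closure \<Omega>"
    unfolding eventually_at_right_field using d closure_subset by (metis subsetD)
  ultimately have "x + 0 *\<^sub>R (- grad \<rho> x) \<in> closure \<Omega>"
    by (intro Lim_in_closed_set[OF closed_closure]) auto
  then have "x \<in> closure \<Omega>" by simp
  then show "x \<in> frontier \<Omega>" using local_defining_functionD(5)[OF assms(2)] x assms(1) by
      (auto simp: frontier_def interior_open)
qed

end

lemma local_defining_function_moved:
  "local_defining_function \<Omega> q V \<rho> \<Longrightarrow> x \<in> V \<Longrightarrow> local_defining_function \<Omega> x V \<rho>"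
  by (simp add: local_defining_function_def)

text \<open>If the two unit normals a and b differ, then the direction b - a decreases the first defining
  function and increases the second one, so short steps along it would lie both inside and outside the
  domain.\<close>
lemma sgn_grad_unique:
  assumes "local_defining_function \<Omega> p V1 \<rho>1" "local_defining_function \<Omega> p V2 \<rho>2" "open \<Omega>" "p \<in> frontier \<Omega>"
  shows "sgn (grad \<rho>1 p) = sgn (grad \<rho>2 p)"
proof (rule ccontr)
  let ?a = "sgn (grad \<rho>1 p)" and ?b = "sgn (grad \<rho>2 p)"
  assume ne: "?a \<noteq> ?b"
  have g: "grad \<rho>1 p \<noteq> 0" "grad \<rho>2 p \<noteq> 0" and V: "p \<in> V1" "p \<in> V2"
    using local_defining_functionD[OF assms(1)] local_defining_functionD[OF assms(2)] by blast+
  have z: "\<rho>1 p = 0" "\<rho>2 p = 0" using local_defining_function_frontier_iff[OF assms(1,3) V(1)]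
      local_defining_function_frontier_iff[OF assms(2,3) V(2)] assms(4) by auto
  have n: "?a \<bullet> ?a = 1" "?b \<bullet> ?b = 1" using g by (simp_all add: norm_sgn flip: norm_eq_1)
  have "(?b - ?a) \<bullet> (?b - ?a) > 0" using ne by simp
  then have ab: "?a \<bullet> ?b < 1" using n by (simp add: inner_diff inner_commute)
  have s: "grad \<rho>1 p = norm (grad \<rho>1 p) *\<^sub>R ?a" "grad \<rho>2 p = norm (grad \<rho>2 p) *\<^sub>R ?b"
    by (simp_all add: sgn_div_norm g)
  have "grad \<rho>1 p \<bullet> (?b - ?a) < 0"
    by (subst s) (use g n ab in \<open>simp add: inner_diff mult_less_0_iff\<close>)
  then obtain d where d: "d > 0" "\<And>t. 0 < t \<Longrightarrow> t < d \<Longrightarrow> p + t *\<^sub>R (?b - ?a) \<in> \<Omega>"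
    using inward_ray[OF assms(1) V(1)] z by auto
  have "grad \<rho>2 p \<bullet> (?b - ?a) > 0"
    by (subst s) (use g n ab in \<open>simp add: inner_diff inner_commute\<close>)
  then obtain d' where d': "d' > 0" "\<And>t. 0 < t \<Longrightarrow> t < d' \<Longrightarrow> p + t *\<^sub>R (?b - ?a) \<notin> \<Omega>"
    using outward_ray[OF assms(2) V(2)] z by auto
  obtain t where "0 < t" "t < d" "t < d'" using field_lbound_gt_zero[OF d(1) d'(1)] by blast
  then show False using d(2) d'(2) by blast
qed

lemma outer_unit_normal_eq:
  assumes "local_defining_function \<Omega> p V \<rho>" "open \<Omega>" "p \<in> frontier \<Omega>"
  shows "outer_unit_normal \<Omega> p = sgn (grad \<rho> p)"
  unfolding outer_unit_normal_def
  by (rule the_equality) (use assms sgn_grad_unique in blast)+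

text \<open>The graphs over which the definition of a surface measure quantifies, for the boundary of \<open>\<Omega>\<close>.\<close>
definition frontier_chart :: "(real^'n) set \<Rightarrow> 'n \<Rightarrow> (real^'n) set \<Rightarrow> (real^'n \<Rightarrow> real) \<Rightarrow> bool"
  where "frontier_chart \<Omega> i W \<phi> \<longleftrightarrow> open W \<and> smooth_on \<phi> W \<and> graph_point i \<phi> ` {y\<in>W. y $ i = 0} \<subseteq> frontier \<Omega>"

lemma graph_point_nth [simp]:
  "graph_point i \<phi> y $ j = (if j = i then y $ i + \<phi> y else y $ j)"
  by (simp add: graph_point_def axis_def)

lemma drop_coord_graph_point: "y $ i = 0 \<Longrightarrow> drop_coord i (graph_point i \<phi> y) = y"
  by (auto simp: vec_eq_iff)

text \<open>Implicit function theorem. Choose i with nonzero i-th partial derivative of \<open>\<rho>\<close> at p and let \<open>\<Psi>\<close>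
  replace the i-th coordinate of x by \<open>\<rho>\<close> x. By the mean value theorem along the i-th axis \<open>\<Psi>\<close> is
  injective near p, so by invariance of domain it has an open image and a differentiable inverse, whose
  i-th component is \<open>\<phi>\<close>. The derivative of \<open>\<phi>\<close> is an expression in \<open>\<phi>\<close> and derivatives of \<open>\<rho>\<close>, which
  yields all orders of differentiability inductively.\<close>
lemma frontier_chart_exists:
  fixes \<Omega> :: "(real^'n) set"
  assumes \<Omega>: "open \<Omega>" and ldf: "local_defining_function \<Omega> p V \<rho>" and p: "p \<in> frontier \<Omega>"
  obtains i W \<phi> where "frontier_chart \<Omega> i W \<phi>" "p \<in> graph_point i \<phi> ` {y\<in>W. y $ i = 0}"
proof -
  note V = local_defining_functionD[OF ldf]
  obtain i where i: "grad \<rho> p $ i \<noteq> 0" using V(4)[OF V(2)] by (auto simp: vec_eq_iff)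
  define s where "s = sgn (grad \<rho> p $ i)"
  have hd: "Ck_on k \<rho> V" for k using V(3) by (simp add: smooth_on_def)
  have hdg: "Ck_on k (grad \<rho>) V" for k
    using Ck_on_grad[OF V(1) hd] .
  define N where "N = (\<lambda>x. s * grad \<rho> x $ i) -` {0<..} \<inter> V"
  have "open N" unfolding N_def
    by (rule continuous_on_open_vimage[OF V(1), THEN iffD1, rule_format])
      (auto intro!: continuous_intros Ck_on_continuous_on[OF hdg[of 0]])
  moreover have "p \<in> N" using i V(2) by (simp add: N_def s_def sgn_if)
  ultimately obtain r where r: "r > 0" "ball p r \<subseteq> N" using open_contains_ball by blast
  let ?B = "ball p r"
  have BV: "x \<in> V" and gi: "s * grad \<rho> x $ i > 0" if "x \<in> ?B" for x
    using r that by (auto simp: N_def)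
  have gi0: "grad \<rho> x $ i \<noteq> 0" if "x \<in> ?B" for x using gi[OF that] by auto
  define \<Psi> where "\<Psi> = (\<lambda>x. drop_coord i x + \<rho> x *\<^sub>R axis i 1)"
  have der\<rho>: "(\<rho> has_derivative (\<lambda>v. grad \<rho> x \<bullet> v)) (at x)" if "x \<in> ?B" for x
    using smooth_on_has_derivative_grad[OF V(3) BV[OF that]] .
  have der: "(\<Psi> has_derivative (\<lambda>v. drop_coord i v + (grad \<rho> x \<bullet> v) *\<^sub>R axis i 1)) (at x)" if "x \<in> ?B" for x
    unfolding \<Psi>_def using der\<rho>[OF that] has_derivative_drop_coord[of i "at x"] by
        (auto intro!: derivative_eq_intros)
  have inj: "inj_on \<Psi> ?B"
  proof (rule inj_onI)
    fix x y assume xy: "x \<in> ?B" "y \<in> ?B" "\<Psi> x = \<Psi> y"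
    have d: "x $ j = y $ j" if "j \<noteq> i" for j
      using arg_cong[OF xy(3), of "\<lambda>z. z $ j"] that by (simp add: \<Psi>_def axis_def)
    have \<rho>: "\<rho> x = \<rho> y" using arg_cong[OF xy(3), of "\<lambda>z. z $ i"] by (simp add: \<Psi>_def axis_def)
    define h where "h = y $ i - x $ i"
    have y: "y = x + h *\<^sub>R axis i 1" unfolding h_def vec_eq_iff by (auto simp: axis_def d)
    obtain \<xi> where "\<xi> \<in> ?B" "\<rho> y - \<rho> x = h * grad \<rho> \<xi> $ i"
      using mean_value_along_axis[OF convex_ball xy(1), of h i \<rho> "grad \<rho>"] xy der\<rho> unfolding y by metis
    then show "x = y" using \<rho> gi0 y by auto
  qed
  define W where "W = \<Psi> ` ?B"
  have cont: "continuous_on ?B \<Psi>" 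
    by (rule has_derivative_continuous_on[OF has_derivative_at_withinI[OF der]])
  have W: "open W" unfolding W_def using invariance_of_domain[OF cont open_ball inj] .
  define g where "g = inv_into ?B \<Psi>"
  define \<phi> where "\<phi> = (\<lambda>y. g y $ i)"
  have g\<Psi>: "g (\<Psi> x) = x" if "x \<in> ?B" for x unfolding g_def using inj that by simp
  have gB: "g y \<in> ?B" and \<Psi>g: "\<Psi> (g y) = y" if "y \<in> W" for y
    using that g\<Psi> unfolding W_def by auto
  have geq: "g y = drop_coord i y + \<phi> y *\<^sub>R axis i 1" if "y \<in> W" for y
  proof -
    have "drop_coord i (g y) = drop_coord i y"
      using arg_cong[OF \<Psi>g[OF that], of "drop_coord i"]
      by (simp add: \<Psi>_def drop_coord_add drop_coord_scaleR drop_coord_idem)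
    then show ?thesis using drop_coord_recompose[of i "g y"] unfolding \<phi>_def by simp
  qed
  let ?g' = "\<lambda>x w. drop_coord i w + ((w $ i - grad \<rho> x \<bullet> drop_coord i w) / grad \<rho> x $ i) *\<^sub>R axis i 1"
  have derg: "(g has_derivative ?g' (g y)) (at y)" if "y \<in> W" for y
  proof -
    have "(g has_derivative ?g' (g y)) (at (\<Psi> (g y)))"
    proof (rule has_derivative_inverse_on[where f'="\<lambda>x v. drop_coord i v + (grad \<rho> x \<bullet> v) *\<^sub>R axis i 1"
          and g'="?g'", OF open_ball der g\<Psi> _ gB[OF that]])
      let ?x = "g y"
      show "(\<lambda>v. drop_coord i v + (grad \<rho> ?x \<bullet> v) *\<^sub>R axis i 1) \<circ> ?g' ?x = id"
      proof (rule ext)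
        fix w
        have "drop_coord i (?g' ?x w) = drop_coord i w"
          by (simp add: drop_coord_add drop_coord_scaleR drop_coord_idem)
        moreover have "grad \<rho> ?x \<bullet> ?g' ?x w = w $ i"
          using gi0[OF gB[OF that]] by (simp add: inner_add_right inner_axis)
        ultimately show "((\<lambda>v. drop_coord i v + (grad \<rho> ?x \<bullet> v) *\<^sub>R axis i 1) \<circ> ?g' ?x) w = id w"
          by (simp only: comp_apply id_apply drop_coord_recompose)
      qed
    qed auto
    then show ?thesis using \<Psi>g[OF that] by simp
  qed
  have der\<phi>: "(\<phi> has_derivative (\<lambda>w. (w $ i - grad \<rho> (g y) \<bullet> drop_coord i w) / grad \<rho> (g y) $ i)) (at y)" if
      "y \<in> W" for y
    using bounded_linear.has_derivative[OF bounded_linear_vec_nth derg[OF that], of i] unfolding \<phi>_def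
    by (simp add: axis_def)
  have hd\<phi>: "Ck_on k \<phi> W" for k
  proof (induction k)
    case 0 then show ?case using has_derivative_continuous_on[OF has_derivative_at_withinI[OF der\<phi>]] by simp
  next
    case (Suc k)
    have gk: "Ck_on k g W"
      by (rule Ck_on_cong[OF W geq[symmetric]])
        (simp_all add: Ck_on_add[OF W Ck_on_linear[OF bounded_linear_drop_coord W]
          Ck_on_scaleR[OF W Suc Ck_on_const[OF W]]])
    have hg: "Ck_on k (\<lambda>y. grad \<rho> (g y)) W"
      by (rule Ck_on_compose[OF W V(1) _ hdg gk]) (use gB BV in auto)
    show ?case
    proof (rule Ck_on_SucI[OF der\<phi> W])
      show "Ck_on k (\<lambda>y. (v $ i - grad \<rho> (g y) \<bullet> drop_coord i v) / grad \<rho> (g y) $ i) W" for v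
        by (intro Ck_on_divide Ck_on_diff Ck_on_const
            Ck_on_inner Ck_on_vec_nth W hg) (use gB gi0 in auto)
    qed
  qed
  show thesis
  proof (rule that[of i W \<phi>])
    have gp: "graph_point i \<phi> y = g y" if "y \<in> W" "y $ i = 0" for y
      using geq[OF that(1)] that(2) by (simp add: graph_point_def drop_coord_idem)
    have "g y \<in> frontier \<Omega>" if "y \<in> W" "y $ i = 0" for y
      using local_defining_function_frontier_iff[OF ldf \<Omega> BV[OF gB[OF that(1)]]]
          arg_cong[OF \<Psi>g[OF that(1)], of "\<lambda>z. z $ i"] that(2)
      by (simp add: \<Psi>_def axis_def)
    then show "frontier_chart \<Omega> i W \<phi>" using W hd\<phi> gp by (auto simp: frontier_chart_def smooth_on_def)
    have pB: "p \<in> ?B" using r by simp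
    have "\<rho> p = 0" using local_defining_function_frontier_iff[OF ldf \<Omega> V(2)] p by simp
    then have "\<Psi> p $ i = 0" "\<Psi> p \<in> W" using pB imageI[OF pB, of \<Psi>] unfolding W_def by
        (auto simp: \<Psi>_def axis_def)
    then show "p \<in> graph_point i \<phi> ` {y\<in>W. y $ i = 0}"
      using gp g\<Psi>[OF pB] by (auto intro!: image_eqI[of _ _ "\<Psi> p"])
  qed
qed

text \<open>The gradient of the function \<open>x $ i - \<phi> x\<close> when \<open>\<phi>\<close> does not depend on the i-th coordinate: a
  normal of the graph whose length is the density in the area formula.\<close>
definition graph_normal :: "'n \<Rightarrow> (real^'n \<Rightarrow> real) \<Rightarrow> real^'n \<Rightarrow> real^'n"
  where "graph_normal i \<phi> y = (\<chi> j. if j = i then 1 else - pderiv_at j \<phi> y)"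

lemma graph_normal_nonzero [simp]: "graph_normal i \<phi> y \<noteq> 0"
  by (auto simp: graph_normal_def vec_eq_iff intro!: exI[of _ i])

lemma norm_graph_normal: "norm (graph_normal i \<phi> y) = sqrt (1 + (\<Sum>j\<in>UNIV - {i}. (pderiv_at j \<phi> y)\<^sup>2))"
proof -
  have "(\<Sum>j\<in>UNIV. (graph_normal i \<phi> y $ j)\<^sup>2) = 1 + (\<Sum>j\<in>UNIV - {i}. (pderiv_at j \<phi> y)\<^sup>2)"
    by (subst sum.remove[of UNIV i]) (auto simp: graph_normal_def intro!: sum.cong)
  then show ?thesis by (simp add: norm_eq_sqrt_inner inner_vec_def power2_eq_square)
qed

text \<open>Precomposing with the projection parametrises the graph by an open set of the full space, so that
  ordinary derivatives can be used instead of derivatives within a hyperplane.\<close>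
lemma has_derivative_graph_projection:
  fixes \<phi> :: "real^'n \<Rightarrow> real"
  assumes "smooth_on \<phi> W" "drop_coord i x \<in> W"
  shows "((\<lambda>x. graph_point i \<phi> (drop_coord i x)) has_derivative
    (\<lambda>v. drop_coord i v + (grad \<phi> (drop_coord i x) \<bullet> drop_coord i v) *\<^sub>R axis i 1)) (at x)"
proof -
  have "((\<lambda>x. \<phi> (drop_coord i x)) has_derivative (\<lambda>v. grad \<phi> (drop_coord i x) \<bullet> drop_coord i v)) (at x)"
    using has_derivative_compose[OF has_derivative_drop_coord smooth_on_has_derivative_grad[OF assms]] .
  then show ?thesis unfolding graph_point_def using has_derivative_drop_coord[of i "at x"]
    by (auto intro!: derivative_eq_intros)
qed

lemma open_graph_projection_vimage:
  fixes \<phi> :: "real^'n \<Rightarrow> real"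
  assumes W: "open W" "smooth_on \<phi> W" and U: "open U"
  shows "open {x. drop_coord i x \<in> W \<and> graph_point i \<phi> (drop_coord i x) \<in> U}"
proof -
  have M: "open (drop_coord i -` W)" by (rule open_vimage[OF W(1)]) (intro continuous_intros)
  have "continuous_on (drop_coord i -` W) (\<lambda>x. graph_point i \<phi> (drop_coord i x))"
    using has_derivative_graph_projection[OF W(2)]
    by (meson continuous_at_imp_continuous_on has_derivative_continuous vimageE)
  from continuous_open_preimage[OF this M U] show ?thesis by (simp add: vimage_def Int_def)
qed

text \<open>Differentiate \<open>\<rho>\<close> = 0 along the graph. In particular the i-th partial derivative of \<open>\<rho>\<close> is nonzero
  at every point of every chart over the i-th hyperplane, whether or not the chart was obtained from the
  implicit function theorem.\<close>
lemma frontier_chart_grad_rho: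
  fixes \<Omega> :: "(real^'n) set"
  assumes \<Omega>: "open \<Omega>" and ldf: "local_defining_function \<Omega> p V \<rho>" and ch: "frontier_chart \<Omega> i W \<phi>"
    and y: "y \<in> W" "y $ i = 0" "graph_point i \<phi> y \<in> V"
  shows "grad \<rho> (graph_point i \<phi> y) = (grad \<rho> (graph_point i \<phi> y) $ i) *\<^sub>R graph_normal i \<phi> y"
    "grad \<rho> (graph_point i \<phi> y) $ i \<noteq> 0"
proof -
  note V = local_defining_functionD[OF ldf]
  have W: "open W" "smooth_on \<phi> W" using ch by (auto simp: frontier_chart_def)
  let ?\<gamma> = "\<lambda>x. graph_point i \<phi> (drop_coord i x)" and ?g = "grad \<rho> (graph_point i \<phi> y)"
  have dy: "drop_coord i y = y" using y drop_coord_idem by blast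
  have d\<gamma>: "(?\<gamma> has_derivative (\<lambda>v. drop_coord i v + (grad \<phi> y \<bullet> drop_coord i v) *\<^sub>R axis i 1)) (at y)"
    using has_derivative_graph_projection[OF W(2), of i y] y dy by simp
  have d\<rho>: "(\<rho> has_derivative (\<lambda>v. ?g \<bullet> v)) (at (?\<gamma> y))"
    using smooth_on_has_derivative_grad[OF V(3) y(3)] dy by simp
  define S where "S = {x. drop_coord i x \<in> W \<and> ?\<gamma> x \<in> V}"
  have S: "open S" "y \<in> S" unfolding S_def using open_graph_projection_vimage[OF W V(1)] y dy by auto
  have "\<rho> (?\<gamma> x) = 0" if x: "x \<in> S" for x
  proof -
    have "?\<gamma> x \<in> frontier \<Omega>" using ch x unfolding frontier_chart_def S_def by auto
    then show "\<rho> (?\<gamma> x) = 0" using local_defining_function_frontier_iff[OF ldf \<Omega>] x by (simp add: S_def)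
  qed
  then have "((\<lambda>x. \<rho> (?\<gamma> x)) has_derivative (\<lambda>v. 0)) (at y)"
    by (intro has_derivative_transform_within_open[OF has_derivative_const[of 0] S]) auto
  from has_derivative_unique[OF this has_derivative_compose[OF d\<gamma> d\<rho>]]
  have *: "?g \<bullet> drop_coord i v + (grad \<phi> y \<bullet> drop_coord i v) * ?g $ i = 0" for v
    by (simp add: fun_eq_iff inner_add_right inner_axis)
  have "?g $ j = - ?g $ i * pderiv_at j \<phi> y" if "j \<noteq> i" for j
  proof -
    have "drop_coord i (axis j 1) = (axis j 1 :: real^'n)" using that by (auto simp: vec_eq_iff axis_def)
    then show ?thesis using *[of "axis j 1"] by (simp add: inner_axis grad_def eq_neg_iff_add_eq_0 mult.commute)
  qed
  then show eq: "?g = (?g $ i) *\<^sub>R graph_normal i \<phi> y"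
    by (auto simp: vec_eq_iff graph_normal_def)
  show "?g $ i \<noteq> 0" using V(4)[OF y(3)] eq by auto
qed

lemma outer_unit_normal_graph_normal:
  assumes "open \<Omega>" "local_defining_function \<Omega> p V \<rho>" "frontier_chart \<Omega> i W \<phi>"
    "y \<in> W" "y $ i = 0" "graph_point i \<phi> y \<in> V"
  shows "outer_unit_normal \<Omega> (graph_point i \<phi> y) = sgn (grad \<rho> (graph_point i \<phi> y) $ i) *\<^sub>R sgn
      (graph_normal i \<phi> y)"
proof -
  have "graph_point i \<phi> y \<in> frontier \<Omega>" using assms(3,4,5) by (auto simp: frontier_chart_def)
  then have "outer_unit_normal \<Omega> (graph_point i \<phi> y) = sgn (grad \<rho> (graph_point i \<phi> y))"
    using outer_unit_normal_eq[OF local_defining_function_moved[OF assms(2,6)] assms(1)] by simp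
  then show ?thesis using frontier_chart_grad_rho[OF assms] by (metis sgn_scaleR)
qed

text \<open>In Q the domain is the part below (s = 1) or above (s = -1) the graph.\<close>
definition chart_neighbourhood ::
  "(real^'n) set \<Rightarrow> 'n \<Rightarrow> (real^'n) set \<Rightarrow> (real^'n \<Rightarrow> real) \<Rightarrow> real \<Rightarrow> (real^'n) set \<Rightarrow> bool"
where
  "chart_neighbourhood \<Omega> i W \<phi> s Q \<longleftrightarrow> open Q \<and> (s = 1 \<or> s = -1) \<and>
     (\<forall>x\<in>Q. drop_coord i x \<in> W \<and> (x \<in> \<Omega> \<longleftrightarrow> s * (x $ i - \<phi> (drop_coord i x)) < 0)) \<and>
     (\<forall>x\<in>Q \<inter> frontier \<Omega>. x = graph_point i \<phi> (drop_coord i x) \<and>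
        outer_unit_normal \<Omega> x = s *\<^sub>R sgn (graph_normal i \<phi> (drop_coord i x)))"

text \<open>In a ball where the i-th partial derivative of \<open>\<rho>\<close> has constant sign s, a point whose foot on the
  graph also lies in the ball is joined to that foot by a segment inside the ball, and the mean value
  theorem gives the sign of \<open>\<rho>\<close>.\<close>
lemma chart_neighbourhood_exists:
  fixes \<Omega> :: "(real^'n) set"
  assumes \<Omega>: "bounded_smooth_domain \<Omega>" and ch: "frontier_chart \<Omega> i W \<phi>"
    and y: "y \<in> W" "y $ i = 0" and U: "open U" "graph_point i \<phi> y \<in> U"
  obtains s Q where "chart_neighbourhood \<Omega> i W \<phi> s Q" "graph_point i \<phi> y \<in> Q" "Q \<subseteq> U"
proof -
  define p where "p = graph_point i \<phi> y"
  have o\<Omega>: "open \<Omega>" using \<Omega> by (simp add: bounded_smooth_domain_def)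
  have W: "open W" "smooth_on \<phi> W" using ch by (auto simp: frontier_chart_def)
  have pf: "p \<in> frontier \<Omega>" using ch y unfolding p_def by (auto simp: frontier_chart_def)
  then obtain V \<rho> where ldf: "local_defining_function \<Omega> p V \<rho>"
    using \<Omega> unfolding bounded_smooth_domain_def by blast
  note V = local_defining_functionD[OF ldf]
  have hdg: "Ck_on k (grad \<rho>) V" for k
    using Ck_on_grad[OF V(1)] V(3) unfolding smooth_on_def by blast
  have dp: "drop_coord i p = y" unfolding p_def using y drop_coord_graph_point by blast
  define s where "s = sgn (grad \<rho> p $ i)"
  have gi: "grad \<rho> p $ i \<noteq> 0" using frontier_chart_grad_rho(2)[OF o\<Omega> ldf ch y] V(2) unfolding p_def by simp
  define N where "N = (\<lambda>x. s * grad \<rho> x $ i) -` {0<..} \<inter> V"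
  have "open N" unfolding N_def
    by (rule continuous_on_open_vimage[OF V(1), THEN iffD1, rule_format])
      (auto intro!: continuous_intros Ck_on_continuous_on[OF hdg[of 0]])
  define M where "M = drop_coord i -` W"
  have M: "open M" unfolding M_def by (rule open_vimage[OF W(1)]) (intro continuous_intros)
  have "p \<in> N \<inter> M \<inter> U" using gi V(2) U(2) y(1) dp by (simp add: N_def M_def s_def sgn_if p_def)
  moreover have "open (N \<inter> M \<inter> U)" using \<open>open N\<close> M U(1) by blast
  ultimately obtain r where r: "r > 0" "ball p r \<subseteq> N \<inter> M \<inter> U" using open_contains_ball by blast
  let ?B = "ball p r" and ?\<gamma> = "\<lambda>x. graph_point i \<phi> (drop_coord i x)"
  have B: "x \<in> V" "s * grad \<rho> x $ i > 0" "drop_coord i x \<in> W" "x \<in> U" if "x \<in> ?B" for x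
    using r that by (auto simp: N_def M_def)
  define Q where "Q = ?\<gamma> -` ?B \<inter> ?B"
  have cont: "continuous_on ?B ?\<gamma>"
    using has_derivative_graph_projection[OF W(2) B(3)]
    by (meson continuous_at_imp_continuous_on has_derivative_continuous)
  have Q: "open Q" unfolding Q_def
    by (rule continuous_on_open_vimage[OF open_ball, THEN iffD1, rule_format]) (use cont in auto)
  have zero: "\<rho> (?\<gamma> x) = 0" "?\<gamma> x \<in> frontier \<Omega>" if "x \<in> Q" for x
  proof -
    show "?\<gamma> x \<in> frontier \<Omega>" using ch B(3) that unfolding frontier_chart_def Q_def by auto
    then show "\<rho> (?\<gamma> x) = 0" using local_defining_function_frontier_iff[OF ldf o\<Omega>, of "?\<gamma> x"] B(1) that by
        (auto simp: Q_def)
  qed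
  have mvt: "\<exists>\<xi>\<in>?B. \<rho> x = (x $ i - \<phi> (drop_coord i x)) * grad \<rho> \<xi> $ i" if x: "x \<in> Q" for x
  proof -
    have eq: "?\<gamma> x + (x $ i - \<phi> (drop_coord i x)) *\<^sub>R axis i 1 = x"
      by (auto simp: vec_eq_iff axis_def)
    obtain \<xi> where "\<xi> \<in> ?B" "\<rho> (?\<gamma> x + (x $ i - \<phi> (drop_coord i x)) *\<^sub>R axis i 1) - \<rho> (?\<gamma> x) =
        (x $ i - \<phi> (drop_coord i x)) * grad \<rho> \<xi> $ i"
      by (rule mean_value_along_axis[OF convex_ball[of p r], of "?\<gamma> x" "x $ i - \<phi> (drop_coord i x)" i \<rho>
          "grad \<rho>"])
        (use x eq smooth_on_has_derivative_grad[OF V(3) B(1)] in \<open>auto simp: Q_def\<close>)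
    then show ?thesis using eq zero[OF x] by auto
  qed
  have s: "s = 1 \<or> s = -1" using gi by (auto simp: s_def sgn_if)
  show thesis
  proof (rule that[of s Q])
    show "graph_point i \<phi> y \<in> Q" using dp r(1) by (simp add: Q_def p_def)
    show "Q \<subseteq> U" using B(4) by (auto simp: Q_def)
    show "chart_neighbourhood \<Omega> i W \<phi> s Q"
      unfolding chart_neighbourhood_def
    proof (intro conjI ballI Q s)
      fix x assume x: "x \<in> Q"
      show "drop_coord i x \<in> W" using x B(3) by (auto simp: Q_def)
      obtain \<xi> where \<xi>: "\<xi> \<in> ?B" "\<rho> x = (x $ i - \<phi> (drop_coord i x)) * grad \<rho> \<xi> $ i" using mvt[OF x] by blast
      have "x \<in> \<Omega> \<longleftrightarrow> (x $ i - \<phi> (drop_coord i x)) * grad \<rho> \<xi> $ i < 0"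
        using V(5)[OF B(1)] x \<xi> by (auto simp: Q_def)
      also have "\<dots> \<longleftrightarrow> s * (x $ i - \<phi> (drop_coord i x)) < 0"
        using B(2)[OF \<xi>(1)] s by (auto simp: mult_less_0_iff zero_less_mult_iff)
      finally show "x \<in> \<Omega> \<longleftrightarrow> s * (x $ i - \<phi> (drop_coord i x)) < 0" .
    next
      fix x assume x: "x \<in> Q \<inter> frontier \<Omega>"
      then obtain \<xi> where \<xi>: "\<xi> \<in> ?B" "\<rho> x = (x $ i - \<phi> (drop_coord i x)) * grad \<rho> \<xi> $ i" using mvt by blast
      have "\<rho> x = 0" using local_defining_function_frontier_iff[OF ldf o\<Omega>, of x] B(1) x by (auto simp: Q_def)
      then have "x $ i = \<phi> (drop_coord i x)" using \<xi> B(2)[OF \<xi>(1)] by auto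
      then show eq: "x = ?\<gamma> x" by (auto simp: vec_eq_iff)
      have xB: "x \<in> ?B" using x by (auto simp: Q_def)
      have "outer_unit_normal \<Omega> (?\<gamma> x) = sgn (grad \<rho> (?\<gamma> x) $ i) *\<^sub>R sgn (graph_normal i \<phi> (drop_coord i x))"
        by (rule outer_unit_normal_graph_normal[OF o\<Omega> ldf ch]) (use B[OF xB] eq in auto)
      moreover have "sgn (grad \<rho> x $ i) = s" using B(2)[OF xB] s by (auto simp: sgn_if zero_less_mult_iff)
      ultimately show "outer_unit_normal \<Omega> x = s *\<^sub>R sgn (graph_normal i \<phi> (drop_coord i x))" using eq by simp
    qed
  qed
qed

lemma frontier_chart_at:
  assumes "bounded_smooth_domain \<Omega>" "p \<in> frontier \<Omega>"
  obtains i W \<phi> where "frontier_chart \<Omega> i W \<phi>" "p \<in> graph_point i \<phi> ` {y\<in>W. y $ i = 0}"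
  using frontier_chart_exists[of \<Omega> p] assms unfolding bounded_smooth_domain_def by blast

text \<open>The parametrisation of a chart has the tangent space as the range of its differential, so the
  derivative of a function that is constant on the boundary vanishes on tangent vectors. All tangential
  information below (uniqueness of the differential of the normal on tangent vectors, the direction of Du,
  the form of DX on tangent vectors) comes from this lemma.\<close>
lemma derivative_along_frontier_zero:
  fixes \<Omega> :: "(real^'n) set" and F :: "real^'n \<Rightarrow> 'b::real_normed_vector"
  assumes \<Omega>: "bounded_smooth_domain \<Omega>" and p: "p \<in> frontier \<Omega>"
    and F: "(F has_derivative L) (at p within frontier \<Omega>)"
    and U: "open U" "p \<in> U" and F0: "\<And>x. x \<in> frontier \<Omega> \<inter> U \<Longrightarrow> F x = c"
    and v: "v \<bullet> outer_unit_normal \<Omega> p = 0"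
  shows "L v = 0"
proof -
  obtain i W \<phi> y where ch: "frontier_chart \<Omega> i W \<phi>" and y: "y \<in> W" "y $ i = 0" "p = graph_point i \<phi> y"
    using frontier_chart_at[OF \<Omega> p] by (metis (mono_tags, lifting) imageE mem_Collect_eq)
  obtain V \<rho> where ldf: "local_defining_function \<Omega> p V \<rho>"
    using \<Omega> p unfolding bounded_smooth_domain_def by blast
  have o\<Omega>: "open \<Omega>" using \<Omega> by (simp add: bounded_smooth_domain_def)
  have W: "open W" "smooth_on \<phi> W" using ch by (auto simp: frontier_chart_def)
  let ?\<gamma> = "\<lambda>x. graph_point i \<phi> (drop_coord i x)"
  let ?D = "\<lambda>v. drop_coord i v + (grad \<phi> y \<bullet> drop_coord i v) *\<^sub>R axis i 1"
  have dy: "drop_coord i y = y" using y drop_coord_idem by blast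
  have d\<gamma>: "(?\<gamma> has_derivative ?D) (at y)"
    using has_derivative_graph_projection[OF W(2), of i y] y dy by simp
  define S where "S = {x. drop_coord i x \<in> W \<and> ?\<gamma> x \<in> U}"
  have S: "open S" unfolding S_def using open_graph_projection_vimage[OF W U(1)] .
  have yS: "y \<in> S" using y dy U(2) by (simp add: S_def)
  have S\<gamma>: "?\<gamma> x \<in> frontier \<Omega> \<inter> U" if "x \<in> S" for x
    using that ch unfolding frontier_chart_def S_def by auto
  have "(F has_derivative L) (at (?\<gamma> y) within ?\<gamma> ` S)"
    by (rule has_derivative_subset[of _ _ _ "frontier \<Omega>"]) (use F y dy S\<gamma> in auto)
  from diff_chain_within[OF has_derivative_at_withinI[OF d\<gamma>] this]
  have "(F \<circ> ?\<gamma> has_derivative L \<circ> ?D) (at y)" by (simp only: at_within_open[OF yS S])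
  moreover have "(F \<circ> ?\<gamma> has_derivative (\<lambda>v. 0)) (at y)"
    by (rule has_derivative_transform_within_open[OF has_derivative_const[of c] S yS]) (use F0 S\<gamma> in auto)
  ultimately have "L \<circ> ?D = (\<lambda>v. 0)" using has_derivative_unique by blast
  then have LD: "(L \<circ> ?D) v = 0" by (rule fun_cong)
  have "L (?D v) = 0" using LD unfolding comp_def .
  moreover have "?D v = v"
  proof -
    have pV: "graph_point i \<phi> y \<in> V" using local_defining_functionD(2)[OF ldf] y by simp
    have "v \<bullet> graph_normal i \<phi> y = 0"
      using v outer_unit_normal_graph_normal[OF o\<Omega> ldf ch y(1,2) pV] frontier_chart_grad_rho(2)[OF o\<Omega> ldf ch
          y(1,2) pV] y(3)
      by (simp add: sgn_div_norm sgn_zero_iff)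
    then have "v $ i + (\<Sum>j\<in>UNIV - {i}. v $ j * - pderiv_at j \<phi> y) = 0"
      unfolding inner_vec_def by (subst (asm) sum.remove[of UNIV i]) (simp_all add: graph_normal_def)
    moreover have "grad \<phi> y \<bullet> drop_coord i v = - (\<Sum>j\<in>UNIV - {i}. v $ j * - pderiv_at j \<phi> y)"
      unfolding inner_drop_coord by (simp add: grad_def sum_negf mult.commute)
    ultimately have "v $ i = grad \<phi> y \<bullet> drop_coord i v" by simp
    then show ?thesis using drop_coord_recompose[of i v] by simp
  qed
  ultimately show ?thesis by simp
qed

section \<open>Test functions and slices of Lebesgue measure\<close>

(* Unfolding would expose frechet_derivative; from here on the closure rules handle the order. *)
declare higher_differentiable_on.simps(2) [simp del]

text \<open>The two open sets V and the complement of T cover the space, and the product is of the required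
  order on each.\<close>
lemma Ck_on_zero_extension:
  fixes f :: "'a::real_normed_vector \<Rightarrow> 'b::real_normed_vector"
  assumes V: "open V" and T: "closed T" "T \<subseteq> V" and \<eta>: "Ck_on k \<eta> UNIV"
    and z: "\<And>x. x \<notin> T \<Longrightarrow> \<eta> x = 0" and f: "Ck_on k f V"
  shows "Ck_on k (\<lambda>x. \<eta> x *\<^sub>R f x) UNIV"
proof -
  have "Ck_on k (\<lambda>x. \<eta> x *\<^sub>R f x) V"
    by (intro Ck_on_scaleR V f Ck_on_mono[OF \<eta>]) simp
  moreover have "Ck_on k (\<lambda>x. \<eta> x *\<^sub>R f x) (- T)"
    by (rule Ck_on_cong[OF _ _ Ck_on_const[of _ k 0]])
      (use T z in \<open>auto intro: open_Compl\<close>)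
  moreover have "V \<union> - T = UNIV" using T by auto
  ultimately show ?thesis using Ck_on_Un[of V "- T"] V T by (metis open_Compl)
qed

definition bump :: "nat \<Rightarrow> real^'n \<Rightarrow> real^'n \<Rightarrow> real^'n \<Rightarrow> real"
  where "bump k a b x = (\<Prod>i\<in>UNIV. max 0 (x $ i - a $ i) ^ Suc k * max 0 (b $ i - x $ i) ^ Suc k)"

lemma Ck_on_bump: "Ck_on k (bump k a b) UNIV"
proof -
  have c: "Ck_on k (\<lambda>x. max 0 (g x) ^ Suc k) UNIV"
    if "Ck_on k g UNIV" for g :: "real^'n \<Rightarrow> real"
    by (rule Ck_on_compose[OF _ _ _ Ck_on_pos_part_power that]) auto
  have l: "Ck_on k (\<lambda>x::real^'n. x $ i) UNIV" for i
    by (rule Ck_on_linear[OF bounded_linear_vec_nth]) simp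
  show ?thesis unfolding bump_def[abs_def]
    by (intro Ck_on_prod Ck_on_mult c Ck_on_diff l
        Ck_on_const) auto
qed

lemma bump_nonneg: "bump k a b x \<ge> 0"
  unfolding bump_def by (auto intro!: prod_nonneg)

lemma bump_pos_iff: "bump k a b x > 0 \<longleftrightarrow> x \<in> box a b"
proof
  assume "bump k a b x > 0"
  then have "(\<Prod>i\<in>UNIV. max 0 (x $ i - a $ i) ^ Suc k * max 0 (b $ i - x $ i) ^ Suc k) \<noteq> 0"
    unfolding bump_def by linarith
  then have "\<forall>i. max 0 (x $ i - a $ i) \<noteq> 0 \<and> max 0 (b $ i - x $ i) \<noteq> 0" by auto
  then show "x \<in> box a b" by (auto simp: mem_box_cart max_def split: if_splits) (smt (verit))+
next
  assume "x \<in> box a b"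
  then show "bump k a b x > 0" unfolding bump_def by (auto simp: mem_box_cart intro!: prod_pos)
qed

lemma bump_eq_0: "x \<notin> box a b \<Longrightarrow> bump k a b x = 0"
  using bump_pos_iff[of k a b x] bump_nonneg[of k a b x] by linarith

lemma box_neighbourhood:
  fixes p :: "real^'n"
  assumes "open U" "p \<in> U" obtains a b where "p \<in> box a b" "cbox a b \<subseteq> U"
  using open_contains_cbox assms by (metis subsetD)

text \<open>Let \<open>\<theta>\<close> be the bump of the box a, b. The test functions \<open>\<theta>\<close> m g / (1 + m g), with g the bump of
  another box, increase to \<open>\<theta>\<close> times the indicator of that box, so the finite measures with density \<open>\<theta>\<close>
  agree on all boxes, hence everywhere. Dividing by \<open>\<theta>\<close>, which is positive on the box a, b, recovers the
  original measures there.\<close>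
lemma measures_agree_on_box:
  fixes a b :: "real^'n"
  assumes M: "sets M = sets borel" and N: "sets N = sets borel"
    and test: "\<And>f. \<lbrakk>Ck_on 1 f UNIV; \<And>x. 0 \<le> f x; \<And>x. x \<notin> box a b \<Longrightarrow> f x = 0\<rbrakk> \<Longrightarrow>
       (\<integral>\<^sup>+x. ennreal (f x) \<partial>M) = (\<integral>\<^sup>+x. ennreal (f x) \<partial>N) \<and> (\<integral>\<^sup>+x. ennreal (f x) \<partial>M) < \<infinity>"
    and E: "E \<in> sets borel" "E \<subseteq> box a b"
  shows "emeasure M E = emeasure N E"
proof -
  define \<theta> where "\<theta> = bump 1 a b"
  have \<theta>: "Ck_on 1 \<theta> UNIV" "\<And>x. \<theta> x \<ge> 0" "\<And>x. x \<notin> box a b \<Longrightarrow> \<theta> x = 0" "\<And>x. x \<in> box a b \<Longrightarrow> \<theta> x > 0"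
    unfolding \<theta>_def by (rule Ck_on_bump bump_nonneg bump_eq_0 | simp add: bump_pos_iff)+
  have meas: "(\<lambda>x. ennreal (f x)) \<in> borel_measurable K" if "Ck_on 1 f UNIV" "sets K = sets borel" for f ::
      "real^'n \<Rightarrow> real" and K
    using Ck_on_continuous_on[OF that(1)] measurable_cong_sets[OF that(2) refl]
    by (auto intro!: measurable_compose[OF _ measurable_ennreal] borel_measurable_continuous_onI)
  have D: "density M \<theta> = density N \<theta>"
  proof (rule measure_eqI_generator_eq[where E="range (\<lambda>(l,u). box l u)" and \<Omega>=UNIV and A="\<lambda>n::nat. box
      (- real n *\<^sub>R One) (real n *\<^sub>R One)"])
    show "Int_stable (range (\<lambda>(l, u). box l u :: (real^'n) set))"
      by (auto simp: Int_stable_def box_Int_box)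
    have s: "sigma_sets UNIV (range (\<lambda>(l, u). box l u :: (real^'n) set)) = sets borel"
      by (simp add: borel_eq_box)
    show "sets (density M \<theta>) = sigma_sets UNIV (range (\<lambda>(l, u). box l u))"
      "sets (density N \<theta>) = sigma_sets UNIV (range (\<lambda>(l, u). box l u))"
      using M N by (simp_all add: s)
    show "(\<Union>n::nat. box (- real n *\<^sub>R One) (real n *\<^sub>R One)) = (UNIV :: (real^'n) set)"
      using UN_box_eq_UNIV by auto
    show "emeasure (density M \<theta>) (box (- real n *\<^sub>R One) (real n *\<^sub>R One)) \<noteq> \<infinity>" for n
    proof -
      have "emeasure (density M \<theta>) (box (- real n *\<^sub>R One) (real n *\<^sub>R One)) \<le> emeasure (density M \<theta>) UNIV"
        by (rule emeasure_mono) (use M in auto)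
      also have "\<dots> = (\<integral>\<^sup>+x. \<theta> x \<partial>M)"
        by (subst emeasure_density) (use M meas[OF \<theta>(1) M] in auto)
      also have "\<dots> < \<infinity>" using test[OF \<theta>(1-3)] by blast
      finally show ?thesis by auto
    qed
    fix X assume "X \<in> range (\<lambda>(l, u). box l u :: (real^'n) set)"
    then obtain c d where X: "X = box c d" by auto
    \<comment> \<open>increases to \<open>\<theta>\<close> on the box c, d and vanishes outside\<close>
    define f where "f = (\<lambda>(m::nat) x. \<theta> x * (real m * bump 1 c d x / (1 + real m * bump 1 c d x)))"
    have pos: "1 + real m * bump 1 c d x > 0" for m x using bump_nonneg[of 1 c d x] by
        (simp add: add_pos_nonneg)
    have f: "Ck_on 1 (f m) UNIV" for m unfolding f_def
      by (intro Ck_on_mult \<theta> Ck_on_divide Ck_on_add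
          Ck_on_const Ck_on_bump) (use pos in \<open>auto simp: less_imp_neq[symmetric]\<close>)
    have f0: "f m x \<ge> 0" "x \<notin> box a b \<Longrightarrow> f m x = 0" for m x
      unfolding f_def using \<theta>(2,3) bump_nonneg[of 1 c d x] pos[of m x] by auto
    have f_eq: "f m x = \<theta> x * (1 - 1 / (1 + real m * bump 1 c d x))" for m x
      using pos[of m x] unfolding f_def by (simp add: field_simps)
    have inc: "incseq (\<lambda>m x. ennreal (f m x))"
    proof (intro incseq_SucI le_funI ennreal_leI)
      fix m x
      show "f m x \<le> f (Suc m) x" unfolding f_eq
        by (intro mult_left_mono diff_left_mono divide_left_mono \<theta>)
          (use bump_nonneg[of 1 c d x] pos[of m x] pos[of "Suc m" x] in
            \<open>auto simp del: of_nat_Suc intro!: mult_pos_pos mult_right_mono\<close>)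
    qed
    have lim: "(SUP m. ennreal (f m x)) = ennreal (\<theta> x) * indicator X x" for x
    proof (cases "x \<in> X")
      case False
      then show ?thesis unfolding X f_def by (simp add: bump_eq_0)
    next
      case True
      then have b: "bump 1 c d x > 0" unfolding X by (simp add: bump_pos_iff)
      have "(\<lambda>m. \<theta> x * (real m * bump 1 c d x / (1 + real m * bump 1 c d x))) \<longlonglongrightarrow> \<theta> x * 1"
      proof (intro tendsto_intros)
        have "(\<lambda>m. 1 - 1 / (1 + real m * bump 1 c d x)) \<longlonglongrightarrow> 1 - 0"
          using b by (intro tendsto_intros tendsto_divide_0[OF tendsto_const] filterlim_at_top_imp_at_infinity
              filterlim_tendsto_add_at_top[OF tendsto_const] filterlim_at_top_mult_tendsto_pos[OF
                  tendsto_const b]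
              filterlim_real_sequentially)
        moreover have "1 - 1 / (1 + real m * bump 1 c d x) = real m * bump 1 c d x /
            (1 + real m * bump 1 c d x)" for m
          using pos[of m x] by (simp add: field_simps)
        ultimately show "(\<lambda>m. real m * bump 1 c d x / (1 + real m * bump 1 c d x)) \<longlonglongrightarrow> 1" by simp
      qed
      then have "(\<lambda>m. ennreal (f m x)) \<longlonglongrightarrow> ennreal (\<theta> x)" unfolding f_def by (intro tendsto_ennrealI) simp
      moreover have "incseq (\<lambda>m. ennreal (f m x))" using inc by (simp add: incseq_def le_fun_def)
      ultimately show ?thesis using True by (simp add: LIMSEQ_unique[OF LIMSEQ_SUP])
    qed
    have em: "emeasure (density K \<theta>) X = (SUP m. \<integral>\<^sup>+x. ennreal (f m x) \<partial>K)" if K: "sets K = sets borel" for K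
    proof -
      have "emeasure (density K \<theta>) X = (\<integral>\<^sup>+x. ennreal (\<theta> x) * indicator X x \<partial>K)"
        by (rule emeasure_density) (use meas[OF \<theta>(1) K] K X in auto)
      also have "\<dots> = (\<integral>\<^sup>+x. (SUP m. ennreal (f m x)) \<partial>K)" by (simp only: lim)
      also have "\<dots> = (SUP m. \<integral>\<^sup>+x. ennreal (f m x) \<partial>K)"
        by (rule nn_integral_monotone_convergence_SUP[OF inc]) (rule meas[OF f K])
      finally show ?thesis .
    qed
    show "emeasure (density M \<theta>) X = emeasure (density N \<theta>) X"
      unfolding em[OF M] em[OF N] using test[OF f f0(1) f0(2)] by simp
  qed auto
  have em: "emeasure K E = (\<integral>\<^sup>+x. ennreal (1 / \<theta> x) * indicator E x \<partial>density K \<theta>)" if K: "sets K = sets borel"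
      for K
  proof -
    have E': "E \<in> sets K" using E K by simp
    have c\<theta>: "\<theta> \<in> borel_measurable borel" using Ck_on_continuous_on[OF \<theta>(1)] by
        (rule borel_measurable_continuous_onI)
    have "(\<integral>\<^sup>+x. ennreal (1 / \<theta> x) * indicator E x \<partial>density K \<theta>) =
        (\<integral>\<^sup>+x. ennreal (\<theta> x) * (ennreal (1 / \<theta> x) * indicator E x) \<partial>K)"
    proof (rule nn_integral_density)
      show "(\<lambda>x. ennreal (\<theta> x)) \<in> borel_measurable K" by (rule meas[OF \<theta>(1) K])
      have "(\<lambda>x. ennreal (1 / \<theta> x) * indicator E x) \<in> borel_measurable borel" using c\<theta> E(1) by measurable
      then show "(\<lambda>x. ennreal (1 / \<theta> x) * indicator E x) \<in> borel_measurable K"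
        using measurable_cong_sets[OF K refl] by blast
    qed
    also have "\<dots> = (\<integral>\<^sup>+x. indicator E x \<partial>K)"
    proof (rule nn_integral_cong)
      fix x
      show "ennreal (\<theta> x) * (ennreal (1 / \<theta> x) * indicator E x) = indicator E x"
        using \<theta>(4)[of x] E(2) by (auto simp: indicator_def ennreal_mult'[symmetric])
    qed
    also have "\<dots> = emeasure K E" using E' by simp
    finally show ?thesis by simp
  qed
  show ?thesis unfolding em[OF M] em[OF N] D ..
qed

lemma sets_hyperplane_lborel [measurable_cong, simp]: "sets (hyperplane_lborel i) = sets borel"
  by (simp add: hyperplane_lborel_def)

lemma space_hyperplane_lborel [simp]: "space (hyperplane_lborel i) = UNIV"
  by (simp add: hyperplane_lborel_def)

lemma measurable_hyperplane_embedding: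
  "(\<lambda>y. \<chi> j. if j = i then 0 else y j) \<in> measurable (Pi\<^sub>M (UNIV - {i}) (\<lambda>_. lborel))
      (borel :: (real^'n) measure)"
proof (rule borel_measurable_euclidean_space[THEN iffD2], rule ballI)
  fix b :: "real^'n" assume "b \<in> Basis"
  then obtain j where b: "b = axis j 1" by (auto simp: Basis_vec_def)
  show "(\<lambda>y. (\<chi> j. if j = i then 0 else y j) \<bullet> b) \<in> borel_measurable (Pi\<^sub>M (UNIV - {i}) (\<lambda>_. lborel))"
    by (cases "j = i") (auto simp: b inner_axis)
qed

lemma AE_hyperplane_lborel: "AE y in hyperplane_lborel i. y $ i = 0"
  unfolding hyperplane_lborel_def
  by (subst AE_distr_iff) (auto intro: measurable_hyperplane_embedding)

lemma emeasure_hyperplane_slice: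
  fixes l u :: "real^'n"
  assumes lu: "\<And>j. l $ j \<le> u $ j"
  shows "(\<integral>\<^sup>+y. \<integral>\<^sup>+t. indicator (box l u) (y + t *\<^sub>R axis i 1) \<partial>lborel \<partial>hyperplane_lborel i) = ennreal
      (\<Prod>j\<in>UNIV. u $ j - l $ j)"
proof -
  interpret product_sigma_finite "\<lambda>_::'n. lborel :: real measure" by standard
  let ?e = "\<lambda>y. (\<chi> j. if j = i then 0 else y j) :: real^'n"
  let ?P = "PiE (UNIV - {i}) (\<lambda>j. {l $ j <..< u $ j})"
  have m: "(\<lambda>y::real^'n. \<integral>\<^sup>+t. indicator (box l u) (y + t *\<^sub>R axis i 1) \<partial>lborel) \<in> borel_measurable borel"
    by measurable
  have "(\<integral>\<^sup>+y. \<integral>\<^sup>+t. indicator (box l u) (y + t *\<^sub>R axis i 1) \<partial>lborel \<partial>hyperplane_lborel i)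
      = (\<integral>\<^sup>+y. \<integral>\<^sup>+t. indicator (box l u) (?e y + t *\<^sub>R axis i 1) \<partial>lborel \<partial>Pi\<^sub>M (UNIV - {i}) (\<lambda>_. lborel))"
    unfolding hyperplane_lborel_def
    by (subst nn_integral_distr[OF measurable_hyperplane_embedding]) (use m in simp_all)
  also have "\<dots> = (\<integral>\<^sup>+y. ennreal (u $ i - l $ i) * indicator ?P y \<partial>Pi\<^sub>M (UNIV - {i}) (\<lambda>_. lborel))"
  proof (rule nn_integral_cong)
    fix y :: "'n \<Rightarrow> real" assume y: "y \<in> space (Pi\<^sub>M (UNIV - {i}) (\<lambda>_. lborel))"
    have "indicator (box l u) (?e y + t *\<^sub>R axis i 1) = (indicator ?P y * indicator {l $ i <..< u $ i} t ::
        ennreal)" for t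
    proof -
      have "?e y + t *\<^sub>R axis i 1 \<in> box l u \<longleftrightarrow> (\<forall>j. l $ j < (if j = i then t else y j) \<and>
          (if j = i then t else y j) < u $ j)"
        unfolding mem_box_cart by (intro all_cong1) (auto simp: axis_def)
      also have "\<dots> \<longleftrightarrow> y \<in> ?P \<and> t \<in> {l $ i <..< u $ i}"
        using y by (auto simp: space_PiM PiE_iff)
      finally show ?thesis by (simp add: indicator_def)
    qed
    then have "(\<integral>\<^sup>+t. indicator (box l u) (?e y + t *\<^sub>R axis i 1) \<partial>lborel)
        = (\<integral>\<^sup>+t. indicator ?P y * indicator {l $ i <..< u $ i} t \<partial>lborel)" by (simp only:)
    also have "\<dots> = indicator ?P y * ennreal (u $ i - l $ i)"
      by (subst nn_integral_cmult) (use lu[of i] in auto)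
    finally show "(\<integral>\<^sup>+t. indicator (box l u) (?e y + t *\<^sub>R axis i 1) \<partial>lborel) = ennreal (u $ i - l $ i) *
        indicator ?P y"
      by (simp only: mult.commute)
  qed
  also have "\<dots> = ennreal (u $ i - l $ i) * emeasure (Pi\<^sub>M (UNIV - {i}) (\<lambda>_. lborel)) ?P"
    by (subst nn_integral_cmult_indicator) (auto intro!: sets_PiM_I_finite)
  also have "emeasure (Pi\<^sub>M (UNIV - {i}) (\<lambda>_. lborel)) ?P = (\<Prod>j\<in>UNIV - {i}. ennreal (u $ j - l $ j))"
    by (subst emeasure_PiM) (use lu in auto)
  also have "\<dots> = ennreal (\<Prod>j\<in>UNIV - {i}. u $ j - l $ j)" by (rule prod_ennreal) (use lu in auto)
  also have "ennreal (u $ i - l $ i) * \<dots> = ennreal ((u $ i - l $ i) * (\<Prod>j\<in>UNIV - {i}. u $ j - l $ j))"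
    by (rule ennreal_mult[symmetric]) (use lu in \<open>auto intro!: prod_nonneg\<close>)
  also have "(u $ i - l $ i) * (\<Prod>j\<in>UNIV - {i}. u $ j - l $ j) = (\<Prod>j\<in>UNIV. u $ j - l $ j)"
    by (rule prod.remove[symmetric]) auto
  finally show ?thesis .
qed

lemma sigma_finite_hyperplane_lborel: "sigma_finite_measure (hyperplane_lborel (i :: 'n::finite))"
proof
  interpret product_sigma_finite "\<lambda>_::'n. lborel :: real measure" by standard
  let ?A = "\<lambda>n::nat. {y::real^'n. \<forall>j\<in>UNIV - {i}. y $ j \<in> {- real n .. real n}}"
  have meas: "?A n \<in> sets borel" for n
  proof -
    have "closed (\<Inter>j\<in>UNIV - {i}. {y::real^'n. - real n \<le> y $ j} \<inter> {y. y $ j \<le> real n})"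
      by (intro closed_INT ballI closed_Int closed_Collect_le continuous_intros)
    also have "(\<Inter>j\<in>UNIV - {i}. {y::real^'n. - real n \<le> y $ j} \<inter> {y. y $ j \<le> real n}) = ?A n" by auto
    finally show ?thesis by (rule borel_closed)
  qed
  have fin: "emeasure (hyperplane_lborel i) (?A n) \<noteq> \<infinity>" for n
  proof -
    let ?M = "Pi\<^sub>M (UNIV - {i}) (\<lambda>_. lborel :: real measure)"
    have "emeasure (hyperplane_lborel i) (?A n) = emeasure ?M ((\<lambda>y. \<chi> j. if j = i then 0 else y j) -` ?A n \<inter>
        space ?M)"
      unfolding hyperplane_lborel_def by (rule emeasure_distr[OF measurable_hyperplane_embedding meas])
    also have "(\<lambda>y. \<chi> j. if j = i then 0 else y j) -` ?A n \<inter> space ?M = PiE (UNIV - {i})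
        (\<lambda>j. {- real n .. real n})" (is "?L = ?R")
    proof (rule set_eqI)
      fix y :: "'n \<Rightarrow> real"
      have "y \<in> ?L \<longleftrightarrow> y \<in> extensional (UNIV - {i}) \<and> (\<forall>j\<in>UNIV - {i}. (if j = i then 0 else y j) \<in>
          {- real n .. real n})"
        by (simp only: vimage_eq mem_Collect_eq Int_iff vec_lambda_beta space_PiM space_lborel space_borel
            PiE_UNIV_domain PiE_iff UNIV_I simp_thms) blast
      also have "\<dots> \<longleftrightarrow> y \<in> extensional (UNIV - {i}) \<and> (\<forall>j\<in>UNIV - {i}. y j \<in> {- real n .. real n})"
        by (intro conj_cong refl ball_cong) simp
      also have "\<dots> \<longleftrightarrow> y \<in> ?R" by (simp only: PiE_iff) blast
      finally show "y \<in> ?L \<longleftrightarrow> y \<in> ?R" .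
    qed
    also have "emeasure ?M \<dots> = (\<Prod>j\<in>UNIV - {i}. ennreal (real n - - real n))"
      by (subst emeasure_PiM) auto
    also have "\<dots> \<noteq> \<infinity>" by (subst prod_ennreal) auto
    finally show ?thesis .
  qed
  have un: "(\<Union>n. ?A n) = UNIV"
  proof (rule set_eqI, simp)
    fix y :: "real^'n"
    obtain n where "norm y \<le> real n" using real_arch_simple by blast
    then have "\<bar>y $ j\<bar> \<le> real n" for j using component_le_norm_cart[of y j] by linarith
    then show "\<exists>n. \<forall>j\<in>UNIV - {i}. - real n \<le> y $ j \<and> y $ j \<le> real n"
      by (metis abs_le_iff minus_le_iff)
  qed
  show "\<exists>A. countable A \<and> A \<subseteq> sets (hyperplane_lborel i) \<and> \<Union> A = space (hyperplane_lborel i) \<and>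
      (\<forall>a\<in>A. emeasure (hyperplane_lborel i) a \<noteq> \<infinity>)"
    using meas fin un by (intro exI[of _ "range ?A"]) auto
qed

text \<open>Fubini in direction i, in the form that fits the hyperplane measure of the area formula.\<close>
lemma lborel_eq_distr_slices:
  "lborel = distr (hyperplane_lborel i \<Otimes>\<^sub>M lborel) borel (\<lambda>(y, t). y + t *\<^sub>R axis i 1 :: real^'n)"
proof (rule lborel_eqI)
  interpret h: sigma_finite_measure "hyperplane_lborel i" by (rule sigma_finite_hyperplane_lborel)
  interpret pair_sigma_finite "hyperplane_lborel i" "lborel :: real measure" by standard
  have m: "(\<lambda>(y, t). y + t *\<^sub>R axis i 1 :: real^'n) \<in> borel_measurable (hyperplane_lborel i \<Otimes>\<^sub>M lborel)"
    by measurable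
  fix l u :: "real^'n" assume lu: "\<And>b. b \<in> Basis \<Longrightarrow> l \<bullet> b \<le> u \<bullet> b"
  have lu': "l $ j \<le> u $ j" for j using lu[of "axis j 1"] by (simp add: inner_axis)
  have "emeasure (distr (hyperplane_lborel i \<Otimes>\<^sub>M lborel) borel (\<lambda>(y, t). y + t *\<^sub>R axis i 1)) (box l u)
      = (\<integral>\<^sup>+z. indicator (box l u) z \<partial>distr (hyperplane_lborel i \<Otimes>\<^sub>M lborel) borel (\<lambda>(y, t). y + t *\<^sub>R axis i 1))"
    by simp
  also have "\<dots> = (\<integral>\<^sup>+z. indicator (box l u) (case z of (y, t) \<Rightarrow> y + t *\<^sub>R axis i 1)
      \<partial>(hyperplane_lborel i \<Otimes>\<^sub>M lborel))"
    by (rule nn_integral_distr[OF m]) simp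
  also have "\<dots> = (\<integral>\<^sup>+y. \<integral>\<^sup>+t. indicator (box l u) (y + t *\<^sub>R axis i 1) \<partial>lborel \<partial>hyperplane_lborel i)"
    by (subst lborel.nn_integral_fst[symmetric]) (auto intro!: measurable_compose[OF m])
  also have "\<dots> = ennreal (\<Prod>j\<in>UNIV. u $ j - l $ j)" by (rule emeasure_hyperplane_slice[OF lu'])
  also have "(\<Prod>j\<in>UNIV. u $ j - l $ j) = (\<Prod>b\<in>Basis. (u - l) \<bullet> b)"
    unfolding Basis_vec_def by (simp add: UNION_singleton_eq_range, subst prod.reindex)
        (auto simp: inj_on_def axis_eq_axis inner_axis)
  finally show "emeasure (distr (hyperplane_lborel i \<Otimes>\<^sub>M lborel) borel (\<lambda>(y, t). y + t *\<^sub>R axis i 1)) (box l u)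
      = (\<Prod>b\<in>Basis. (u - l) \<bullet> b)" .
qed simp

lemma integral_slices:
  fixes g :: "real^'n \<Rightarrow> real"
  assumes "integrable lborel g"
  shows "(\<integral>y. (\<integral>t. g (y + t *\<^sub>R axis i 1) \<partial>lborel) \<partial>hyperplane_lborel i) = (\<integral>x. g x \<partial>lborel)"
    "integrable (hyperplane_lborel i) (\<lambda>y. \<integral>t. g (y + t *\<^sub>R axis i 1) \<partial>lborel)"
proof -
  interpret h: sigma_finite_measure "hyperplane_lborel i" by (rule sigma_finite_hyperplane_lborel)
  interpret pair_sigma_finite "hyperplane_lborel i" "lborel :: real measure" by standard
  let ?S = "\<lambda>(y, t). y + t *\<^sub>R axis i 1 :: real^'n"
  have m: "?S \<in> borel_measurable (hyperplane_lborel i \<Otimes>\<^sub>M lborel)" by measurable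
  have gm: "g \<in> borel_measurable borel" using borel_measurable_integrable[OF assms] by simp
  have i: "integrable (hyperplane_lborel i \<Otimes>\<^sub>M lborel) (\<lambda>z. g (?S z))"
    using integrable_distr[OF m, of g] assms by (simp flip: lborel_eq_distr_slices)
  have "(\<integral>x. g x \<partial>lborel) = (\<integral>z. g (?S z) \<partial>(hyperplane_lborel i \<Otimes>\<^sub>M lborel))"
    by (subst lborel_eq_distr_slices[of i]) (rule integral_distr[OF m gm])
  with integral_fst'[OF i] integrable_fst'[OF i]
  show "(\<integral>y. (\<integral>t. g (y + t *\<^sub>R axis i 1) \<partial>lborel) \<partial>hyperplane_lborel i) = (\<integral>x. g x \<partial>lborel)"
    "integrable (hyperplane_lborel i) (\<lambda>y. \<integral>t. g (y + t *\<^sub>R axis i 1) \<partial>lborel)"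
    by simp_all
qed

section \<open>The divergence theorem below a graph\<close>

text \<open>The fundamental theorem of calculus; the sign s selects the half line to the left (s = 1) or to
  the right of c.\<close>
lemma integral_derivative_halfline:
  fixes k k' :: "real \<Rightarrow> real"
  assumes der: "\<And>t. (k has_real_derivative k' t) (at t)" and cont: "continuous_on UNIV k'"
    and z: "\<And>t. M \<le> \<bar>t\<bar> \<Longrightarrow> k t = 0" "\<And>t. M \<le> \<bar>t\<bar> \<Longrightarrow> k' t = 0" and s: "s = 1 \<or> s = -1"
  shows "(\<integral>t. indicator {t. s * (t - c) < 0} t * k' t \<partial>lborel) = s * k c"
proof -
  have [measurable]: "k' \<in> borel_measurable borel" using cont by (rule borel_measurable_continuous_onI)
  have FTC: "(\<integral>t. k' t * indicator {a..b} t \<partial>lborel) = k b - k a" if "a \<le> b" for a b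
    by (rule integral_FTC_Icc_real[OF that]) (use der cont continuous_on_eq_continuous_at[of UNIV k'] in auto)
  have ne: "AE t in lborel. t \<noteq> c" by (rule AE_lborel_singleton)
  from s show ?thesis
  proof
    assume s1: "s = 1"
    have "(\<integral>t. indicator {t. s * (t - c) < 0} t * k' t \<partial>lborel) = (\<integral>t. k' t * indicator {min (-M) c..c} t
        \<partial>lborel)"
    proof (rule integral_cong_AE)
      show "AE t in lborel. indicator {t. s * (t - c) < 0} t * k' t = k' t * indicator {min (-M) c..c} t"
        using ne by eventually_elim (use z s1 in \<open>auto simp: indicator_def min_def\<close>)
    qed (use s1 in measurable)
    then show ?thesis using FTC[of "min (-M) c" c] z(1)[of "min (-M) c"] s1 by simp
  next
    assume s1: "s = -1"
    have "(\<integral>t. indicator {t. s * (t - c) < 0} t * k' t \<partial>lborel) = (\<integral>t. k' t * indicator {c..max M c} t \<partial>lborel)"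
    proof (rule integral_cong_AE)
      show "AE t in lborel. indicator {t. s * (t - c) < 0} t * k' t = k' t * indicator {c..max M c} t"
        using ne by eventually_elim (use z s1 in \<open>auto simp: indicator_def max_def\<close>)
    qed (use s1 in measurable)
    then show ?thesis using FTC[of c "max M c"] z(1)[of "max M c"] s1 by simp
  qed
qed

lemma integral_derivative_line:
  fixes k k' :: "real \<Rightarrow> real"
  assumes der: "\<And>t. (k has_real_derivative k' t) (at t)" and cont: "continuous_on UNIV k'"
    and z: "\<And>t. M \<le> \<bar>t\<bar> \<Longrightarrow> k t = 0" "\<And>t. M \<le> \<bar>t\<bar> \<Longrightarrow> k' t = 0"
  shows "(\<integral>t. k' t \<partial>lborel) = 0"
proof -
  have "(\<integral>t. k' t \<partial>lborel) = (\<integral>t. indicator {t. 1 * (t - \<bar>M\<bar>) < 0} t * k' t \<partial>lborel)"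
    using z(2) by (intro Bochner_Integration.integral_cong) (auto simp: indicator_def)
  also have "\<dots> = 0" using integral_derivative_halfline[OF assms, where s=1 and c="\<bar>M\<bar>"] z(1)[of "\<bar>M\<bar>"] by simp
  finally show ?thesis .
qed

locale compactly_supported =
  fixes f :: "real^'n \<Rightarrow> real" and T :: "(real^'n) set"
  assumes C1: "Ck_on 1 f UNIV" and compact: "compact T" and zero: "\<And>x. x \<notin> T \<Longrightarrow> f x = 0"
begin

lemma cont: "continuous_on A f"
  using Ck_on_continuous_on[OF C1] continuous_on_subset by blast

lemma cont_pderiv: "continuous_on A (pderiv_at j f)"
  using Ck_on_pderiv_at[of 0 f UNIV j] C1 continuous_on_subset by fastforce

lemma measurable_pderiv [measurable]: "pderiv_at j f \<in> borel_measurable borel"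
  using cont_pderiv by (rule borel_measurable_continuous_onI)

lemma measurable_f [measurable]: "f \<in> borel_measurable borel"
  using cont by (rule borel_measurable_continuous_onI)

lemma pderiv_zero: "x \<notin> T \<Longrightarrow> pderiv_at j f x = 0"
  using pderiv_at_cong_open[of "- T" x f "\<lambda>_. 0" j] zero compact_imp_closed[OF compact]
  by (auto simp: pderiv_at_def frechet_derivative_const)

lemma integrable_pderiv: "A \<in> sets borel \<Longrightarrow> integrable lborel (\<lambda>x. indicator A x * pderiv_at j f x)"
proof -
  assume A: "A \<in> sets borel"
  have "integrable lborel (\<lambda>x. indicator T x *\<^sub>R pderiv_at j f x)"
    by (rule borel_integrable_compact[OF compact cont_pderiv])
  then have "integrable lborel (\<lambda>x. indicator A x *\<^sub>R (indicator T x *\<^sub>R pderiv_at j f x))"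
    by (rule integrable_mult_indicator[rotated]) (use A in simp)
  also have "(\<lambda>x. indicator A x *\<^sub>R (indicator T x *\<^sub>R pderiv_at j f x)) = (\<lambda>x. indicator A x * pderiv_at j f x)"
    using pderiv_zero by (auto simp: fun_eq_iff indicator_def)
  finally show ?thesis .
qed

lemma line_derivative:
  "((\<lambda>t. f (y + t *\<^sub>R axis i 1)) has_real_derivative pderiv_at i f (y + t *\<^sub>R axis i 1)) (at t)"
proof -
  have "((\<lambda>t. y + t *\<^sub>R axis i 1) has_derivative (\<lambda>s. s *\<^sub>R axis i 1)) (at t)"
    by (auto intro!: derivative_eq_intros)
  moreover have "(f has_derivative (\<lambda>v. grad f (y + t *\<^sub>R axis i 1) \<bullet> v)) (at (y + t *\<^sub>R axis i 1))"
    using has_derivative_grad[of 0 f UNIV] C1 by simp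
  ultimately have "((\<lambda>t. f (y + t *\<^sub>R axis i 1)) has_derivative (\<lambda>s. grad f (y + t *\<^sub>R axis i 1) \<bullet>
      (s *\<^sub>R axis i 1))) (at t)"
    by (rule has_derivative_compose)
  then show ?thesis by (rule has_real_derivativeI) (simp add: inner_axis grad_def)
qed

lemma leaves_support: obtains M where "\<And>t. M \<le> \<bar>t\<bar> \<Longrightarrow> y + t *\<^sub>R axis i 1 \<notin> T"
proof -
  obtain B where B: "\<And>x. x \<in> T \<Longrightarrow> norm x \<le> B" using compact_imp_bounded[OF compact] bounded_iff by blast
  show ?thesis
  proof (rule that[of "B + norm y + 1"])
    fix t :: real assume t: "B + norm y + 1 \<le> \<bar>t\<bar>"
    have "\<bar>t\<bar> - norm y \<le> norm (y + t *\<^sub>R axis i 1)"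
      using norm_triangle_ineq2[of "t *\<^sub>R axis i 1" "- y"] by (simp add: add.commute)
    then show "y + t *\<^sub>R axis i 1 \<notin> T" using B t by force
  qed
qed

lemma cont_pderiv_line: "continuous_on UNIV (\<lambda>t. pderiv_at i f (y + t *\<^sub>R axis j 1))"
  by (rule continuous_on_compose2[OF cont_pderiv[of UNIV]]) (auto intro!: continuous_intros)

lemma integral_pderiv_halfline:
  assumes "s = 1 \<or> s = -1"
  shows "(\<integral>t. indicator {t. s * (t - c) < 0} t * pderiv_at i f (y + t *\<^sub>R axis i 1) \<partial>lborel) = s * f
      (y + c *\<^sub>R axis i 1)"
proof -
  obtain M where M: "\<And>t. M \<le> \<bar>t\<bar> \<Longrightarrow> y + t *\<^sub>R axis i 1 \<notin> T" using leaves_support[of y i] by blast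
  show ?thesis
    by (rule integral_derivative_halfline[OF line_derivative cont_pderiv_line _ _ assms, of M])
        (use M zero pderiv_zero in auto)
qed

lemma integral_pderiv_line: "(\<integral>t. pderiv_at i f (y + t *\<^sub>R axis i 1) \<partial>lborel) = 0"
proof -
  obtain M where M: "\<And>t. M \<le> \<bar>t\<bar> \<Longrightarrow> y + t *\<^sub>R axis i 1 \<notin> T" using leaves_support[of y i] by blast
  show ?thesis
    by (rule integral_derivative_line[OF line_derivative cont_pderiv_line, of M])
        (use M zero pderiv_zero in auto)
qed

lemma integral_pderiv_invariant_set:
  assumes A: "A \<in> sets borel" and inv: "\<And>x t. x + t *\<^sub>R axis j 1 \<in> A \<longleftrightarrow> x \<in> A"
  shows "(\<integral>x. indicator A x * pderiv_at j f x \<partial>lborel) = 0"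
proof -
  have "(\<integral>t. indicator A (y + t *\<^sub>R axis j 1) * pderiv_at j f (y + t *\<^sub>R axis j 1) \<partial>lborel) = 0" for y
    using integral_pderiv_line[of j y] by (simp add: inv indicator_def)
  then show ?thesis using integral_slices(1)[OF integrable_pderiv[OF A, of j], of j] by simp
qed

lemma integral_pderiv_UNIV: "(\<integral>x. pderiv_at j f x \<partial>lborel) = 0"
  using integral_pderiv_invariant_set[of UNIV j] by simp

end

lemma borel_measurable_indicator_open_times:
  fixes h :: "'a::topological_space \<Rightarrow> real"
  assumes "open W" "continuous_on W h" shows "(\<lambda>y. indicator W y * h y) \<in> borel_measurable borel"
  using borel_measurable_continuous_on_indicator[of W h] assms by simp

text \<open>For j = i, slicing along the axis and the fundamental theorem of calculus on the half lines up to
  the graph give the claim. For the other j the function f is pulled back by the shear that flattens the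
  graph: with G(y) = f(y + \<open>\<phi>\<close>(y) e_i) one has D_j G = D_j f + (D_j \<open>\<phi>\<close>) (D_i f), evaluated at the sheared
  point, and the integral of D_j G over the half space vanishes because the half space is invariant in
  direction j. Hence the integral of D_j f is that of -(D_j \<open>\<phi>\<close>) (D_i f), which the case j = i evaluates.\<close>
lemma chart_divergence_hyperplane:
  fixes \<Omega> :: "(real^'n) set"
  assumes o\<Omega>: "open \<Omega>" and W: "open W" "smooth_on \<phi> W" and Q: "chart_neighbourhood \<Omega> i W \<phi> s Q"
    and f: "compactly_supported f T" and TQ: "T \<subseteq> Q"
  defines "C j \<equiv> (\<lambda>y. indicator W y * (s * graph_normal i \<phi> y $ j) * f (graph_point i \<phi> y))"
  shows "(\<integral>x. indicator \<Omega> x * pderiv_at j f x \<partial>lborel) = (\<integral>y. C j y \<partial>hyperplane_lborel i)"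
    and "integrable (hyperplane_lborel i) (C j)"
proof -
  interpret compactly_supported f T by (rule f)
  let ?H = "hyperplane_lborel i" and ?e = "axis i 1 :: real^'n"
  have Qd: "open Q" "s = 1 \<or> s = -1" "\<And>x. x \<in> Q \<Longrightarrow> drop_coord i x \<in> W"
    "\<And>x. x \<in> Q \<Longrightarrow> x \<in> \<Omega> \<longleftrightarrow> s * (x $ i - \<phi> (drop_coord i x)) < 0"
    using Q unfolding chart_neighbourhood_def by blast+
  have hd\<phi>: "Ck_on k \<phi> W" for k using W(2) by (simp add: smooth_on_def)
  have c\<phi>: "continuous_on W \<phi>" using Ck_on_continuous_on[OF hd\<phi>[of 0]] .
  have cp: "continuous_on W (pderiv_at j \<phi>)" for j
    using Ck_on_continuous_on[OF Ck_on_pderiv_at[OF hd\<phi>[of "Suc 0"]]] .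
  have cgn: "continuous_on W (\<lambda>y. graph_normal i \<phi> y $ j)" for j
    unfolding graph_normal_def by (cases "j = i") (auto intro!: continuous_intros cp)
  have cgp: "continuous_on W (graph_point i \<phi>)" unfolding graph_point_def[abs_def] by
      (intro continuous_intros c\<phi>)
  have Cm: "C j \<in> borel_measurable ?H" for j
  proof -
    have "continuous_on W (\<lambda>y. (s * graph_normal i \<phi> y $ j) * f (graph_point i \<phi> y))"
      by (intro continuous_intros cgn continuous_on_compose2[OF cont[of UNIV] cgp]) auto
    from borel_measurable_indicator_open_times[OF W(1) this] show ?thesis
      unfolding C_def by (simp add: mult.assoc)
  qed
  have ob: "\<Omega> \<in> sets borel" using o\<Omega> by simp
  have on_line: "y + t *\<^sub>R ?e \<in> T \<Longrightarrow> y \<in> W \<and> (y + t *\<^sub>R ?e \<in> \<Omega> \<longleftrightarrow> s * (t - \<phi> y) < 0)" if "y $ i = 0" for y t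
  proof -
    assume "y + t *\<^sub>R ?e \<in> T"
    then have q: "y + t *\<^sub>R ?e \<in> Q" using TQ by blast
    have d: "drop_coord i (y + t *\<^sub>R ?e) = y" using that by (simp add: drop_coord_add drop_coord_scaleR
        drop_coord_idem)
    show ?thesis using Qd(3)[OF q] Qd(4)[OF q] that unfolding d by simp
  qed
  have Ci_inner: "(\<integral>t. indicator \<Omega> (y + t *\<^sub>R ?e) * pderiv_at i f (y + t *\<^sub>R ?e) \<partial>lborel) = indicator W y * s *
      f (graph_point i \<phi> y)"
    if y: "y $ i = 0" for y
  proof (cases "y \<in> W")
    case True
    have "(\<integral>t. indicator \<Omega> (y + t *\<^sub>R ?e) * pderiv_at i f (y + t *\<^sub>R ?e) \<partial>lborel)
        = (\<integral>t. indicator {t. s * (t - \<phi> y) < 0} t * pderiv_at i f (y + t *\<^sub>R ?e) \<partial>lborel)"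
    proof (rule Bochner_Integration.integral_cong[OF refl])
      show "indicator \<Omega> (y + t *\<^sub>R ?e) * pderiv_at i f (y + t *\<^sub>R ?e) = indicator {t. s * (t - \<phi> y) < 0} t *
          pderiv_at i f (y + t *\<^sub>R ?e)" for t
        using on_line[OF y, of t] pderiv_zero[of "y + t *\<^sub>R ?e" i] by (cases "y + t *\<^sub>R ?e \<in> T")
            (auto simp: indicator_def)
    qed
    also have "\<dots> = s * f (graph_point i \<phi> y)" using integral_pderiv_halfline[OF Qd(2)] by
        (simp add: graph_point_def)
    finally show ?thesis using True by simp
  next
    case False
    then have "pderiv_at i f (y + t *\<^sub>R ?e) = 0" for t using on_line[OF y, of t] pderiv_zero[of "y + t *\<^sub>R ?e"
        i] by blast
    then show ?thesis using False by simp
  qed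
  let ?A = "\<lambda>j y. \<integral>t. indicator \<Omega> (y + t *\<^sub>R ?e) * pderiv_at j f (y + t *\<^sub>R ?e) \<partial>lborel"
  note A_int = integral_slices[OF integrable_pderiv[OF ob], of i]
  have Ci: "AE y in ?H. ?A i y = C i y"
    using AE_hyperplane_lborel[of i] by eventually_elim (simp add: Ci_inner C_def graph_normal_def)
  show "(\<integral>x. indicator \<Omega> x * pderiv_at j f x \<partial>lborel) = (\<integral>y. C j y \<partial>?H)" and "integrable ?H (C j)"
  proof (atomize (full), cases "j = i")
    case True
    have "(\<integral>y. ?A i y \<partial>?H) = (\<integral>y. C i y \<partial>?H)"
      by (rule integral_cong_AE) (use Cm Ci A_int(2) in auto)
    moreover have "integrable ?H (C i)"
      using integrable_cong_AE[of "?A i" ?H "C i"] Cm Ci A_int(2) by auto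
    ultimately show "(\<integral>x. indicator \<Omega> x * pderiv_at j f x \<partial>lborel) = (\<integral>y. C j y \<partial>?H) \<and> integrable ?H (C j)"
      using A_int(1) True by simp
  next
    case False
    define G where "G = (\<lambda>x. if drop_coord i x \<in> W then f (x + \<phi> (drop_coord i x) *\<^sub>R ?e) else 0)"
    define T' where "T' = (\<lambda>x. x - \<phi> (drop_coord i x) *\<^sub>R ?e) ` T"
    define M where "M = drop_coord i -` W"
    have M: "open M" unfolding M_def by (rule open_vimage[OF W(1)]) (intro continuous_intros)
    have TM: "drop_coord i x \<in> W" if "x \<in> T" for x using that TQ Qd(3) by blast
    have T': "compact T'" unfolding T'_def
      by (intro compact_continuous_image compact continuous_intros continuous_on_compose2[OF c\<phi>])
          (use TM in auto)
    have T'M: "T' \<subseteq> M" 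
    proof -
      have "drop_coord i (x - c *\<^sub>R ?e) = drop_coord i x" for x c by (auto simp: vec_eq_iff axis_def)
      then show ?thesis using TM by (auto simp: T'_def M_def)
    qed
    have G0: "G x = 0" if "x \<notin> T'" for x
    proof (rule ccontr)
      assume "G x \<noteq> 0"
      then have x: "drop_coord i x \<in> W" "x + \<phi> (drop_coord i x) *\<^sub>R ?e \<in> T" using zero by
          (auto simp: G_def split: if_splits)
      have "drop_coord i (x + \<phi> (drop_coord i x) *\<^sub>R ?e) = drop_coord i x" by
          (simp add: drop_coord_add drop_coord_scaleR)
      then have "x \<in> T'" unfolding T'_def using x(2) by
          (intro image_eqI[of _ _ "x + \<phi> (drop_coord i x) *\<^sub>R ?e"]) auto
      with that show False by simp
    qed
    have hdM: "Ck_on 1 (\<lambda>x. x + \<phi> (drop_coord i x) *\<^sub>R ?e) M"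
    proof (intro Ck_on_add Ck_on_scaleR M Ck_on_const)
      show "Ck_on 1 (\<lambda>x::real^'n. x) M" by (rule Ck_on_linear[OF bounded_linear_ident M])
      show "Ck_on 1 (\<lambda>x. \<phi> (drop_coord i x)) M"
        by (rule Ck_on_compose[OF M W(1) _ hd\<phi> Ck_on_linear[OF bounded_linear_drop_coord M]])
          (auto simp: M_def)
    qed
    have hdG: "Ck_on 1 G UNIV"
    proof -
      have "Ck_on 1 (\<lambda>x. f (x + \<phi> (drop_coord i x) *\<^sub>R ?e)) M"
        by (rule Ck_on_compose[OF M open_UNIV _ C1 hdM]) auto
      then have "Ck_on 1 G M"
        by (rule Ck_on_cong[OF M, rotated]) (auto simp: G_def M_def)
      moreover have "Ck_on 1 G (- T')"
        by (rule Ck_on_cong[OF _ _ Ck_on_const[of _ 1 0]])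
          (use G0 T' in \<open>auto intro: open_Compl compact_imp_closed\<close>)
      moreover have "M \<union> - T' = UNIV" using T'M by blast
      ultimately show ?thesis using Ck_on_Un[of M "- T'"] M T' by (metis open_Compl compact_imp_closed)
    qed
    interpret G: compactly_supported G T' by unfold_locales (use hdG T' G0 in auto)
    have dG: "pderiv_at j G x = pderiv_at j f (x + \<phi> (drop_coord i x) *\<^sub>R ?e) + pderiv_at j \<phi> (drop_coord i x)
        * pderiv_at i f (x + \<phi> (drop_coord i x) *\<^sub>R ?e)"
      if x: "x \<in> M" for x
    proof -
      let ?z = "x + \<phi> (drop_coord i x) *\<^sub>R ?e"
      have xW: "drop_coord i x \<in> W" using x by (simp add: M_def)
      have "((\<lambda>x. \<phi> (drop_coord i x)) has_derivative (\<lambda>v. grad \<phi> (drop_coord i x) \<bullet> drop_coord i v)) (at x)"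
        using has_derivative_compose[OF has_derivative_drop_coord smooth_on_has_derivative_grad[OF W(2) xW]] .
      then have "((\<lambda>x. x + \<phi> (drop_coord i x) *\<^sub>R ?e) has_derivative
          (\<lambda>v. v + (grad \<phi> (drop_coord i x) \<bullet> drop_coord i v) *\<^sub>R ?e)) (at x)"
        by (auto intro!: derivative_eq_intros)
      moreover have "(f has_derivative (\<lambda>v. grad f ?z \<bullet> v)) (at ?z)"
        using has_derivative_grad[of 0 f UNIV] C1 by simp
      ultimately have "((\<lambda>x. f (x + \<phi> (drop_coord i x) *\<^sub>R ?e)) has_derivative
          (\<lambda>v. grad f ?z \<bullet> (v + (grad \<phi> (drop_coord i x) \<bullet> drop_coord i v) *\<^sub>R ?e))) (at x)"
        by (rule has_derivative_compose)
      then have "(G has_derivative (\<lambda>v. grad f ?z \<bullet> (v + (grad \<phi> (drop_coord i x) \<bullet> drop_coord i v) *\<^sub>R ?e)))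
          (at x)"
        by (rule has_derivative_transform_within_open[OF _ M x]) (auto simp: G_def M_def)
      moreover have "drop_coord i (axis j 1) = (axis j 1 :: real^'n)" using False by
          (auto simp: vec_eq_iff axis_def)
      ultimately show ?thesis
        by (simp add: pderiv_at_eq inner_add_right inner_axis grad_def)
    qed
    let ?S = "{x::real^'n. s * x $ i < 0}"
    have oS: "open ?S" by (intro open_Collect_less continuous_intros)
    have S0: "(\<integral>x. indicator ?S x * pderiv_at j G x \<partial>lborel) = 0"
      by (rule G.integral_pderiv_invariant_set) (use oS False in \<open>auto simp: axis_def\<close>)
    note GS = integral_slices[OF G.integrable_pderiv[OF borel_open[OF oS], of j], of i]
    let ?B = "\<lambda>y. \<integral>t. indicator ?S (y + t *\<^sub>R ?e) * pderiv_at j G (y + t *\<^sub>R ?e) \<partial>lborel"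
    have B0: "(\<integral>y. ?B y \<partial>?H) = 0" using GS(1) S0 by simp
    \<comment> \<open>the substitution t \<mapsto> t + \<open>\<phi>\<close> y on each line undoes the shear\<close>
    have BA: "?B y = ?A j y - C j y" if y: "y $ i = 0" for y
    proof (cases "y \<in> W")
      case True
      have d: "drop_coord i (y + t *\<^sub>R ?e) = y" for t using y by (simp add: drop_coord_add drop_coord_scaleR
          drop_coord_idem)
      let ?h = "\<lambda>t. indicator {t. s * (t - \<phi> y) < 0} t * (pderiv_at j f (y + t *\<^sub>R ?e) + pderiv_at j \<phi> y *
          pderiv_at i f (y + t *\<^sub>R ?e))"
      have "?B y = (\<integral>t. ?h (\<phi> y + 1 * t) \<partial>lborel)"
      proof (rule Bochner_Integration.integral_cong[OF refl])
        fix t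
        have "y + t *\<^sub>R ?e \<in> M" using d True by (simp add: M_def)
        from dG[OF this] show "indicator ?S (y + t *\<^sub>R ?e) * pderiv_at j G (y + t *\<^sub>R ?e) = ?h (\<phi> y + 1 * t)"
          using y by (simp add: d indicator_def algebra_simps)
      qed
      also have "\<dots> = (\<integral>t. ?h t \<partial>lborel)"
        using lborel_integral_real_affine[of 1 ?h "\<phi> y"] by simp
      also have "\<dots> = (\<integral>t. indicator \<Omega> (y + t *\<^sub>R ?e) * pderiv_at j f (y + t *\<^sub>R ?e)
          + pderiv_at j \<phi> y * (indicator \<Omega> (y + t *\<^sub>R ?e) * pderiv_at i f (y + t *\<^sub>R ?e)) \<partial>lborel)"
      proof (rule Bochner_Integration.integral_cong[OF refl])
        show "?h t = indicator \<Omega> (y + t *\<^sub>R ?e) * pderiv_at j f (y + t *\<^sub>R ?e)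
          + pderiv_at j \<phi> y * (indicator \<Omega> (y + t *\<^sub>R ?e) * pderiv_at i f (y + t *\<^sub>R ?e))" for t
          using on_line[OF y, of t] pderiv_zero[of "y + t *\<^sub>R ?e"] by (cases "y + t *\<^sub>R ?e \<in> T")
              (auto simp: indicator_def)
      qed
      also have "\<dots> = ?A j y + pderiv_at j \<phi> y * ?A i y"
      proof -
        have "integrable lborel (\<lambda>t. indicator \<Omega> (y + t *\<^sub>R ?e) * pderiv_at l f (y + t *\<^sub>R ?e))" for l
        proof -
          obtain K where K: "\<And>t. K \<le> \<bar>t\<bar> \<Longrightarrow> y + t *\<^sub>R ?e \<notin> T" using leaves_support[of y i] by blast
          have "integrable lborel (\<lambda>t. indicator {-K..K} t *\<^sub>R pderiv_at l f (y + t *\<^sub>R ?e))"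
            by (rule borel_integrable_compact[OF compact_Icc])
                (rule continuous_on_subset[OF cont_pderiv_line], simp)
          then have "integrable lborel (\<lambda>t. indicator {t. y + t *\<^sub>R ?e \<in> \<Omega>} t *\<^sub>R
              (indicator {-K..K} t *\<^sub>R pderiv_at l f (y + t *\<^sub>R ?e)))"
            by (rule integrable_mult_indicator[rotated]) (use ob in measurable)
          also have "(\<lambda>t. indicator {t. y + t *\<^sub>R ?e \<in> \<Omega>} t *\<^sub>R (indicator {-K..K} t *\<^sub>R pderiv_at l f
              (y + t *\<^sub>R ?e)))
              = (\<lambda>t. indicator \<Omega> (y + t *\<^sub>R ?e) * pderiv_at l f (y + t *\<^sub>R ?e))"
          proof
            fix t show "indicator {t. y + t *\<^sub>R ?e \<in> \<Omega>} t *\<^sub>R (indicator {-K..K} t *\<^sub>R pderiv_at l f (y + t *\<^sub>R ?e))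
              = indicator \<Omega> (y + t *\<^sub>R ?e) * pderiv_at l f (y + t *\<^sub>R ?e)"
              using K[of t] pderiv_zero[of "y + t *\<^sub>R ?e" l]
              by (cases "K \<le> \<bar>t\<bar>") (auto simp: indicator_def abs_le_iff not_le abs_less_iff)
          qed
          finally show ?thesis .
        qed
        then show ?thesis by (subst Bochner_Integration.integral_add) auto
      qed
      also have "pderiv_at j \<phi> y * ?A i y = - C j y"
        unfolding Ci_inner[OF y] C_def using False True by (simp add: graph_normal_def)
      finally show ?thesis by simp
    next
      case not: False
      have "pderiv_at j f (y + t *\<^sub>R ?e) = 0" for t using on_line[OF y, of t] pderiv_zero[of "y + t *\<^sub>R ?e" j]
          not by blast
      moreover have "pderiv_at j G (y + t *\<^sub>R ?e) = 0" for t
      proof (rule G.pderiv_zero)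
        have "drop_coord i (y + t *\<^sub>R ?e) = y" using y by (simp add: drop_coord_add drop_coord_scaleR
            drop_coord_idem)
        then show "y + t *\<^sub>R ?e \<notin> T'" using T'M not by (auto simp: M_def)
      qed
      ultimately show ?thesis using not by (simp add: C_def)
    qed
    have CD: "AE y in ?H. ?A j y - ?B y = C j y"
      using AE_hyperplane_lborel[of i] by eventually_elim (simp add: BA)
    have i: "integrable ?H (\<lambda>y. ?A j y - ?B y)" using A_int(2) GS(2) by
        (rule Bochner_Integration.integrable_diff)
    have "(\<integral>y. ?A j y - ?B y \<partial>?H) = (\<integral>y. C j y \<partial>?H)"
      by (rule integral_cong_AE) (use Cm CD i in auto)
    moreover have "(\<integral>y. ?A j y - ?B y \<partial>?H) = (\<integral>y. ?A j y \<partial>?H)"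
      using Bochner_Integration.integral_diff[OF A_int(2) GS(2)] B0 by simp
    moreover have "integrable ?H (C j)"
      using integrable_cong_AE[of "\<lambda>y. ?A j y - ?B y" ?H "C j"] Cm CD i by auto
    ultimately show "(\<integral>x. indicator \<Omega> x * pderiv_at j f x \<partial>lborel) = (\<integral>y. C j y \<partial>?H) \<and> integrable ?H (C j)"
      using A_int(1) by simp
  qed
qed

section \<open>The normal field and the measures of graphs\<close>

lemma bounded_smooth_domainD:
  assumes "bounded_smooth_domain \<Omega>"
  shows "open \<Omega>" "connected \<Omega>" "\<Omega> \<noteq> {}" "bounded \<Omega>" "compact (frontier \<Omega>)" "compact (closure \<Omega>)"
    "p \<in> frontier \<Omega> \<Longrightarrow> \<exists>V \<rho>. local_defining_function \<Omega> p V \<rho>"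
  using assms unfolding bounded_smooth_domain_def by (auto intro: compact_frontier_bounded)

lemma normal_extension_at:
  assumes \<Omega>: "bounded_smooth_domain \<Omega>" and p: "p \<in> frontier \<Omega>"
  obtains V N where "open V" "p \<in> V" "\<And>k. Ck_on k N V"
    "\<And>x. x \<in> V \<Longrightarrow> norm (N x) = 1" "\<And>x. x \<in> V \<inter> frontier \<Omega> \<Longrightarrow> outer_unit_normal \<Omega> x = N x"
    "\<exists>\<rho>. local_defining_function \<Omega> p V \<rho> \<and> (\<forall>x. N x = sgn (grad \<rho> x))"
proof -
  note d = bounded_smooth_domainD[OF \<Omega>]
  obtain V \<rho> where ldf: "local_defining_function \<Omega> p V \<rho>" using d(7)[OF p] by blast
  note V = local_defining_functionD[OF ldf]
  have hdg: "Ck_on k (grad \<rho>) V" for k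
    using Ck_on_grad[OF V(1)] V(3) unfolding smooth_on_def by blast
  have hdn: "Ck_on k (\<lambda>x. sgn (grad \<rho> x)) V" for k
  proof -
    have "Ck_on k (\<lambda>x. inverse (sqrt (grad \<rho> x \<bullet> grad \<rho> x)) *\<^sub>R grad \<rho> x) V"
    proof (intro Ck_on_scaleR V hdg)
      show "Ck_on k (\<lambda>x. inverse (sqrt (grad \<rho> x \<bullet> grad \<rho> x))) V"
        by (rule Ck_on_inverse[OF V(1) Ck_on_sqrt[OF V(1) Ck_on_inner[OF V(1) hdg hdg]]])
          (use V(4) in auto)
    qed
    then show ?thesis by (simp add: sgn_div_norm norm_eq_sqrt_inner)
  qed
  show thesis
    by (rule that[of V "\<lambda>x. sgn (grad \<rho> x)"])
      (use V hdn ldf outer_unit_normal_eq[OF local_defining_function_moved[OF ldf] d(1)] in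
          \<open>auto simp: norm_sgn\<close>)
qed

lemma norm_outer_unit_normal: "bounded_smooth_domain \<Omega> \<Longrightarrow> p \<in> frontier \<Omega> \<Longrightarrow> norm (outer_unit_normal \<Omega> p) = 1"
  by (metis IntI normal_extension_at)

lemma continuous_on_outer_unit_normal:
  assumes \<Omega>: "bounded_smooth_domain \<Omega>" shows "continuous_on (frontier \<Omega>) (outer_unit_normal \<Omega>)"
  unfolding continuous_on_eq_continuous_within
proof
  fix p assume p: "p \<in> frontier \<Omega>"
  obtain V N where V: "open V" "p \<in> V" "\<And>k. Ck_on k N V"
    "\<And>x. x \<in> V \<inter> frontier \<Omega> \<Longrightarrow> outer_unit_normal \<Omega> x = N x"
    by (rule normal_extension_at[OF \<Omega> p]) blast
  have "continuous_on (frontier \<Omega> \<inter> V) N"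
    by (rule continuous_on_subset[OF Ck_on_continuous_on[OF V(3)[of 0]]]) simp
  then have "continuous_on (frontier \<Omega> \<inter> V) (outer_unit_normal \<Omega>)"
    by (rule continuous_on_eq) (use V(4) in auto)
  then have "continuous (at p within frontier \<Omega> \<inter> V) (outer_unit_normal \<Omega>)"
    using p V(2) by (simp add: continuous_on_eq_continuous_within)
  moreover have "at p within frontier \<Omega> \<inter> V = at p within frontier \<Omega>"
    by (rule at_within_nhd[OF V(2,1)]) auto
  ultimately show "continuous (at p within frontier \<Omega>) (outer_unit_normal \<Omega>)" by simp
qed

text \<open>The indicator makes this measurable on the whole space; off the boundary the normal has no
  meaning.\<close>
definition frontier_normal :: "(real^'n) set \<Rightarrow> 'n \<Rightarrow> real^'n \<Rightarrow> real"
  where "frontier_normal \<Omega> j x = indicator (frontier \<Omega>) x * outer_unit_normal \<Omega> x $ j"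

lemma measurable_frontier_normal:
  assumes "bounded_smooth_domain \<Omega>" shows "frontier_normal \<Omega> j \<in> borel_measurable borel"
proof -
  have "continuous_on (frontier \<Omega>) (\<lambda>x. outer_unit_normal \<Omega> x $ j)"
    by (intro continuous_intros continuous_on_outer_unit_normal assms)
  from borel_measurable_continuous_on_indicator[OF _ this] show ?thesis
    unfolding frontier_normal_def by simp
qed

text \<open>The measure given by the area formula of the graph. The value 0 of the parametrisation outside W
  is immaterial because the density vanishes there.\<close>
definition chart_measure :: "'n \<Rightarrow> (real^'n) set \<Rightarrow> (real^'n \<Rightarrow> real) \<Rightarrow> (real^'n) measure"
  where "chart_measure i W \<phi> =
    distr (density (hyperplane_lborel i) (\<lambda>y. ennreal (indicator W y * norm (graph_normal i \<phi> y)))) borel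
      (\<lambda>y. if y \<in> W then graph_point i \<phi> y else 0)"

lemma sets_chart_measure [simp, measurable_cong]: "sets (chart_measure i W \<phi>) = sets borel"
  and space_chart_measure [simp]: "space (chart_measure i W \<phi>) = UNIV"
  by (simp_all add: chart_measure_def)

context
  fixes i :: "'n::finite" and W :: "(real^'n) set" and \<phi> :: "real^'n \<Rightarrow> real"
  assumes W: "open W" "smooth_on \<phi> W"
begin

lemma measurable_chart_density: "(\<lambda>y. indicator W y * norm (graph_normal i \<phi> y)) \<in> borel_measurable borel"
proof (rule borel_measurable_indicator_open_times[OF W(1)])
  have hd\<phi>: "Ck_on k \<phi> W" for k using W(2) by (simp add: smooth_on_def)
  have "continuous_on W (pderiv_at j \<phi>)" for j
    using Ck_on_continuous_on[OF Ck_on_pderiv_at[OF hd\<phi>[of "Suc 0"]]] .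
  then show "continuous_on W (\<lambda>y. norm (graph_normal i \<phi> y))"
    unfolding norm_graph_normal by (intro continuous_intros)
qed

lemma measurable_chart_map: "(\<lambda>y. if y \<in> W then graph_point i \<phi> y else 0) \<in> borel_measurable borel"
proof -
  have "continuous_on W \<phi>" using W(2) Ck_on_continuous_on unfolding smooth_on_def by blast
  then have "continuous_on W (graph_point i \<phi>)" unfolding graph_point_def[abs_def] by (intro continuous_intros)
  from borel_measurable_continuous_on_if[OF borel_open[OF W(1)] this, of "\<lambda>_. 0"] show ?thesis by simp
qed

lemma emeasure_chart_measure:
  assumes E: "E \<in> sets borel"
  shows "emeasure (chart_measure i W \<phi>) E =
    (\<integral>\<^sup>+ y. indicator {y\<in>W. graph_point i \<phi> y \<in> E} y * ennreal (norm (graph_normal i \<phi> y)) \<partial>hyperplane_lborel i)"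
proof -
  let ?m = "\<lambda>y. if y \<in> W then graph_point i \<phi> y else 0" and ?H = "hyperplane_lborel i"
  let ?D = "density ?H (\<lambda>y. ennreal (indicator W y * norm (graph_normal i \<phi> y)))"
  have m: "?m \<in> borel_measurable ?D" using measurable_chart_map by simp
  have me: "?m -` E \<in> sets borel" using measurable_sets[OF measurable_chart_map E] by simp
  have d: "(\<lambda>y. ennreal (indicator W y * norm (graph_normal i \<phi> y))) \<in> borel_measurable ?H"
    using measurable_chart_density by measurable
  have "emeasure (chart_measure i W \<phi>) E = emeasure ?D (?m -` E)"
    unfolding chart_measure_def by (subst emeasure_distr[OF m E]) simp
  also have "\<dots> = (\<integral>\<^sup>+y. ennreal (indicator W y * norm (graph_normal i \<phi> y)) * indicator (?m -` E) y \<partial>?H)"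
    by (rule emeasure_density[OF d]) (use me in simp)
  also have "\<dots> = (\<integral>\<^sup>+ y. indicator {y\<in>W. graph_point i \<phi> y \<in> E} y * ennreal (norm (graph_normal i \<phi> y)) \<partial>?H)"
    by (intro nn_integral_cong) (auto simp: indicator_def)
  finally show ?thesis .
qed

lemma integral_chart_measure:
  fixes F :: "real^'n \<Rightarrow> real"
  assumes F: "F \<in> borel_measurable borel"
  shows "(\<integral>x. F x \<partial>chart_measure i W \<phi>) = (\<integral>y. indicator W y * norm (graph_normal i \<phi> y) * F
      (graph_point i \<phi> y) \<partial>hyperplane_lborel i)"
    "integrable (chart_measure i W \<phi>) F \<longleftrightarrow> integrable (hyperplane_lborel i)
        (\<lambda>y. indicator W y * norm (graph_normal i \<phi> y) * F (graph_point i \<phi> y))"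
proof -
  let ?m = "\<lambda>y. if y \<in> W then graph_point i \<phi> y else 0" and ?H = "hyperplane_lborel i"
  let ?D = "density ?H (\<lambda>y. ennreal (indicator W y * norm (graph_normal i \<phi> y)))"
  have m: "?m \<in> borel_measurable ?D" using measurable_chart_map by simp
  have Fm: "(\<lambda>y. F (?m y)) \<in> borel_measurable ?H" using measurable_compose[OF measurable_chart_map F] by simp
  have d: "(\<lambda>y. indicator W y * norm (graph_normal i \<phi> y)) \<in> borel_measurable ?H"
    using measurable_chart_density by simp
  have nn: "AE y in ?H. 0 \<le> indicator W y * norm (graph_normal i \<phi> y)" by simp
  have eq: "(\<lambda>y. (indicator W y * norm (graph_normal i \<phi> y)) *\<^sub>R F (?m y)) =
      (\<lambda>y. indicator W y * norm (graph_normal i \<phi> y) * F (graph_point i \<phi> y))"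
    by (auto simp: indicator_def)
  have "(\<integral>x. F x \<partial>chart_measure i W \<phi>) = (\<integral>y. F (?m y) \<partial>?D)"
    unfolding chart_measure_def by (rule integral_distr[OF m F])
  also have "\<dots> = (\<integral>y. (indicator W y * norm (graph_normal i \<phi> y)) *\<^sub>R F (?m y) \<partial>?H)"
    by (rule integral_density[OF Fm d nn])
  finally show "(\<integral>x. F x \<partial>chart_measure i W \<phi>) = (\<integral>y. indicator W y * norm (graph_normal i \<phi> y) * F
      (graph_point i \<phi> y) \<partial>?H)"
    unfolding eq .
  have "integrable (chart_measure i W \<phi>) F \<longleftrightarrow> integrable ?D (\<lambda>y. F (?m y))"
    unfolding chart_measure_def by (rule integrable_distr_eq[OF m F])
  also have "\<dots> \<longleftrightarrow> integrable ?H (\<lambda>y. (indicator W y * norm (graph_normal i \<phi> y)) *\<^sub>R F (?m y))"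
    by (rule integrable_density[OF Fm d nn])
  finally show "integrable (chart_measure i W \<phi>) F \<longleftrightarrow> integrable ?H
      (\<lambda>y. indicator W y * norm (graph_normal i \<phi> y) * F (graph_point i \<phi> y))"
    unfolding eq .
qed

end

lemma frontier_chartD: "frontier_chart \<Omega> i W \<phi> \<Longrightarrow> open W" "frontier_chart \<Omega> i W \<phi> \<Longrightarrow> smooth_on \<phi> W"
  "frontier_chart \<Omega> i W \<phi> \<Longrightarrow> y \<in> W \<Longrightarrow> y $ i = 0 \<Longrightarrow> graph_point i \<phi> y \<in> frontier \<Omega>"
  by (auto simp: frontier_chart_def)

lemma chart_measure_null:
  assumes ch: "frontier_chart \<Omega> i W \<phi>" shows "AE x in chart_measure i W \<phi>. x \<in> frontier \<Omega>"
proof -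
  note W = frontier_chartD(1,2)[OF ch]
  have "emeasure (chart_measure i W \<phi>) (- frontier \<Omega>) =
      (\<integral>\<^sup>+ y. indicator {y\<in>W. graph_point i \<phi> y \<in> - frontier \<Omega>} y * ennreal (norm (graph_normal i \<phi> y))
          \<partial>hyperplane_lborel i)"
    by (rule emeasure_chart_measure[OF W]) simp
  also have "\<dots> = (\<integral>\<^sup>+ y. 0 \<partial>hyperplane_lborel i)"
    by (rule nn_integral_cong_AE)
      (use AE_hyperplane_lborel[of i] in eventually_elim, use frontier_chartD(3)[OF ch] in
          \<open>auto simp: indicator_def\<close>)
  finally have "emeasure (chart_measure i W \<phi>) (- frontier \<Omega>) = 0" by simp
  then show ?thesis by (intro AE_I[of _ _ "- frontier \<Omega>"]) auto
qed

text \<open>The length of the unnormalised normal cancels against the density of the area formula.\<close>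
lemma chart_divergence:
  fixes \<Omega> :: "(real^'n) set"
  assumes \<Omega>: "bounded_smooth_domain \<Omega>" and ch: "frontier_chart \<Omega> i W \<phi>" and Q: "chart_neighbourhood \<Omega> i W \<phi> s Q"
    and f: "compactly_supported f T" and TQ: "T \<subseteq> Q"
  shows "(\<integral>x. indicator \<Omega> x * pderiv_at j f x \<partial>lborel) = (\<integral>x. f x * frontier_normal \<Omega> j x \<partial>chart_measure i W \<phi>)"
    "integrable (chart_measure i W \<phi>) (\<lambda>x. f x * frontier_normal \<Omega> j x)"
proof -
  note W = frontier_chartD(1,2)[OF ch]
  interpret compactly_supported f T by (rule f)
  let ?C = "\<lambda>y. indicator W y * (s * graph_normal i \<phi> y $ j) * f (graph_point i \<phi> y)"
  let ?D = "\<lambda>y. indicator W y * norm (graph_normal i \<phi> y) * (f (graph_point i \<phi> y) * frontier_normal \<Omega> j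
      (graph_point i \<phi> y))"
  let ?H = "hyperplane_lborel i"
  have m: "(\<lambda>x. f x * frontier_normal \<Omega> j x) \<in> borel_measurable borel"
    using measurable_frontier_normal[OF \<Omega>, of j] by measurable
  note C = chart_divergence_hyperplane[OF bounded_smooth_domainD(1)[OF \<Omega>] W Q f TQ, of j]
  have CD: "AE y in ?H. ?C y = ?D y" using AE_hyperplane_lborel[of i]
  proof eventually_elim
    fix y :: "real^'n" assume y: "y $ i = 0"
    show "?C y = ?D y"
    proof (cases "y \<in> W \<and> graph_point i \<phi> y \<in> T")
      case False then show ?thesis using zero by (auto simp: indicator_def)
    next
      case True
      then have fr: "graph_point i \<phi> y \<in> Q \<inter> frontier \<Omega>" using TQ frontier_chartD(3)[OF ch _ y] by blast
      then have "outer_unit_normal \<Omega> (graph_point i \<phi> y) = s *\<^sub>R sgn (graph_normal i \<phi> y)"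
        using Q drop_coord_graph_point[OF y, of \<phi>] unfolding chart_neighbourhood_def by metis
      then show ?thesis using fr True by (simp add: frontier_normal_def sgn_div_norm)
    qed
  qed
  have Cm: "?C \<in> borel_measurable ?H" using C(2) by (rule borel_measurable_integrable)
  have Dm: "?D \<in> borel_measurable ?H"
  proof -
    have "(\<lambda>y. (indicator W y * norm (graph_normal i \<phi> y)) * (\<lambda>x. f x * frontier_normal \<Omega> j x)
        (if y \<in> W then graph_point i \<phi> y else 0)) \<in> borel_measurable borel"
      by (rule borel_measurable_times[OF measurable_chart_density[OF W]
          measurable_compose[OF measurable_chart_map[OF W] m]])
    also have "(\<lambda>y. (indicator W y * norm (graph_normal i \<phi> y)) * (\<lambda>x. f x * frontier_normal \<Omega> j x)
        (if y \<in> W then graph_point i \<phi> y else 0)) = ?D"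
      by (auto simp: fun_eq_iff indicator_def)
    finally show ?thesis by simp
  qed
  show "integrable (chart_measure i W \<phi>) (\<lambda>x. f x * frontier_normal \<Omega> j x)"
    unfolding integral_chart_measure(2)[OF W m] using integrable_cong_AE[OF Cm Dm CD] C(2) by blast
  show "(\<integral>x. indicator \<Omega> x * pderiv_at j f x \<partial>lborel) = (\<integral>x. f x * frontier_normal \<Omega> j x \<partial>chart_measure i W \<phi>)"
    unfolding integral_chart_measure(1)[OF W m] using integral_cong_AE[OF Cm Dm CD] C(1) by simp
qed

lemma sum_normal_components:
  assumes "bounded_smooth_domain \<Omega>" "\<And>x. x \<in> V \<inter> frontier \<Omega> \<Longrightarrow> outer_unit_normal \<Omega> x = N x" "x \<in> V"
  shows "(\<Sum>j\<in>UNIV. N x $ j * frontier_normal \<Omega> j x) = indicator (frontier \<Omega>) x"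
proof (cases "x \<in> frontier \<Omega>")
  case True
  then have "N x \<bullet> N x = 1" using assms norm_outer_unit_normal by (metis IntI norm_eq_1)
  then show ?thesis using True assms(2,3) by (simp add: frontier_normal_def inner_vec_def)
qed (simp add: frontier_normal_def)

text \<open>Add up the divergence theorems for the components of f N: the sum of N_j \<open>\<nu>\<close>_j is 1 on the
  boundary. The right hand side is a volume integral in which the chart no longer occurs.\<close>
lemma chart_test_integral:
  fixes \<Omega> :: "(real^'n) set"
  assumes \<Omega>: "bounded_smooth_domain \<Omega>" and ch: "frontier_chart \<Omega> i W \<phi>" and Q: "chart_neighbourhood \<Omega> i W \<phi> s Q"
    and V: "open V" "Ck_on 1 N V" "\<And>x. x \<in> V \<inter> frontier \<Omega> \<Longrightarrow> outer_unit_normal \<Omega> x = N x"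
    and f: "compactly_supported f T" and T: "T \<subseteq> Q" "T \<subseteq> V" and f0: "\<And>x. 0 \<le> f x"
  shows "(\<integral>\<^sup>+x. ennreal (f x) \<partial>chart_measure i W \<phi>) =
      ennreal (\<Sum>j\<in>UNIV. \<integral>x. indicator \<Omega> x * pderiv_at j (\<lambda>x. f x * N x $ j) x \<partial>lborel)"
proof -
  interpret compactly_supported f T by (rule f)
  let ?M = "chart_measure i W \<phi>"
  have cs: "compactly_supported (\<lambda>x. f x * N x $ j) T" for j
  proof unfold_locales
    have "Ck_on 1 (\<lambda>x. f x *\<^sub>R (N x $ j)) UNIV"
      by (rule Ck_on_zero_extension[OF V(1) compact_imp_closed[OF compact] T(2) C1 zero
            Ck_on_vec_nth[OF V(1,2)]])
    then show "Ck_on 1 (\<lambda>x. f x * N x $ j) UNIV" by simp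
  qed (use compact zero in auto)
  note D = chart_divergence[OF \<Omega> ch Q cs T(1)]
  \<comment> \<open>off the boundary both sides vanish, on it the sum is |N|^2 = 1\<close>
  have eq: "(\<Sum>j\<in>UNIV. f x * N x $ j * frontier_normal \<Omega> j x) = f x * indicator (frontier \<Omega>) x" for x
  proof (cases "x \<in> T")
    case True
    then show ?thesis using sum_normal_components[OF \<Omega> V(3), where x=x] T(2)
      by (auto simp: mult.assoc simp flip: sum_distrib_left)
  qed (simp add: zero)
  have int: "integrable ?M (\<lambda>x. f x * indicator (frontier \<Omega>) x)"
  proof -
    have "integrable ?M (\<lambda>x. \<Sum>j\<in>UNIV. f x * N x $ j * frontier_normal \<Omega> j x)"
      by (rule Bochner_Integration.integrable_sum) (rule D(2))
    then show ?thesis by (simp only: eq)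
  qed
  have "(\<Sum>j\<in>UNIV. \<integral>x. indicator \<Omega> x * pderiv_at j (\<lambda>x. f x * N x $ j) x \<partial>lborel)
     = (\<Sum>j\<in>UNIV. \<integral>x. f x * N x $ j * frontier_normal \<Omega> j x \<partial>?M)" by (simp add: D(1))
  also have "\<dots> = (\<integral>x. f x * indicator (frontier \<Omega>) x \<partial>?M)"
    by (subst Bochner_Integration.integral_sum[symmetric]) (simp_all only: D(2) eq)
  also have "ennreal \<dots> = (\<integral>\<^sup>+x. ennreal (f x * indicator (frontier \<Omega>) x) \<partial>?M)"
    by (rule nn_integral_eq_integral[symmetric, OF int]) (use f0 in auto)
  also have "\<dots> = (\<integral>\<^sup>+x. ennreal (f x) \<partial>?M)"
    by (rule nn_integral_cong_AE) (use chart_measure_null[OF ch] in eventually_elim, auto)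
  finally show ?thesis by simp
qed

text \<open>By Lindelof countably many of the given neighbourhoods suffice, and they can be made disjoint.\<close>
lemma measures_agree_locally:
  fixes M N :: "'a::second_countable_topology measure"
  assumes M: "sets M = sets borel" and N: "sets N = sets borel" and E: "E \<in> sets borel"
    and loc: "\<And>p. p \<in> E \<Longrightarrow> \<exists>U. open U \<and> p \<in> U \<and> (\<forall>B\<in>sets borel. B \<subseteq> U \<longrightarrow> emeasure M B = emeasure N B)"
  shows "emeasure M E = emeasure N E"
proof -
  define \<F> where "\<F> = {U. open U \<and> (\<forall>B\<in>sets borel. B \<subseteq> U \<longrightarrow> emeasure M B = emeasure N B)}"
  obtain \<F>' where F': "\<F>' \<subseteq> \<F>" "countable \<F>'" "\<Union>\<F>' = \<Union>\<F>" by (rule Lindelof[of \<F>]) (auto simp: \<F>_def)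
  have sub: "E \<subseteq> \<Union>\<F>'" unfolding F'(3) \<F>_def using loc by blast
  show ?thesis
  proof (cases "\<F>' = {}")
    case True then show ?thesis using sub by simp
  next
    case False
    define U where "U = from_nat_into \<F>'"
    have U: "U n \<in> \<F>" for n unfolding U_def using F'(1) from_nat_into[OF False] by blast
    have un: "(\<Union>n. U n) = \<Union>\<F>'" unfolding U_def using range_from_nat_into[OF False F'(2)] by simp
    define D where "D = (\<lambda>n. E \<inter> disjointed U n)"
    have dis: "disjoint_family D" unfolding D_def using disjoint_family_disjointed[of U] by
        (auto simp: disjoint_family_on_def)
    have Dm: "D n \<in> sets borel" for n
    proof -
      have "range (disjointed U) \<subseteq> sets borel"
        by (rule sets.range_disjointed_sets) (use U in \<open>auto simp: \<F>_def\<close>)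
      then show ?thesis unfolding D_def using E by auto
    qed
    have UD: "(\<Union>n. D n) = E" unfolding D_def using sub un UN_disjointed_eq[of U] by auto
    have "emeasure M (D n) = emeasure N (D n)" for n
      using U[of n] Dm[of n] disjointed_subset[of U n] unfolding \<F>_def D_def by blast
    then have "(\<Sum>n. emeasure M (D n)) = (\<Sum>n. emeasure N (D n))" by simp
    moreover have "(\<Sum>n. emeasure K (D n)) = emeasure K E" if "sets K = sets borel" for K :: "'a measure"
      using suminf_emeasure[of D K] dis Dm that UD by auto
    ultimately show ?thesis using M N by simp
  qed
qed

text \<open>Near a common point both measures integrate test functions to the same volume integral. This takes
  the place of a change of variables between the two charts.\<close>
lemma chart_measures_agree:
  fixes \<Omega> :: "(real^'n) set"
  assumes \<Omega>: "bounded_smooth_domain \<Omega>" and ch1: "frontier_chart \<Omega> i W \<phi>" and ch2: "frontier_chart \<Omega> i' W' \<phi>'"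
    and E: "E \<in> sets borel" "E \<subseteq> graph_point i \<phi> ` {y\<in>W. y $ i = 0}" "E \<subseteq> graph_point i' \<phi>' `
        {y\<in>W'. y $ i' = 0}"
  shows "emeasure (chart_measure i W \<phi>) E = emeasure (chart_measure i' W' \<phi>') E"
proof (rule measures_agree_locally[OF sets_chart_measure sets_chart_measure E(1)])
  fix p assume p: "p \<in> E"
  then obtain y y' where y: "y \<in> W" "y $ i = 0" "p = graph_point i \<phi> y" and y': "y' \<in> W'" "y' $ i' = 0"
      "p = graph_point i' \<phi>' y'"
    using E by blast
  have pf: "p \<in> frontier \<Omega>" using frontier_chartD(3)[OF ch1 y(1,2)] y(3) by simp
  obtain V N where V: "open V" "p \<in> V" "\<And>k. Ck_on k N V"
    "\<And>x. x \<in> V \<inter> frontier \<Omega> \<Longrightarrow> outer_unit_normal \<Omega> x = N x"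
    by (rule normal_extension_at[OF \<Omega> pf]) blast
  obtain s Q where Q: "chart_neighbourhood \<Omega> i W \<phi> s Q" "p \<in> Q" "Q \<subseteq> V"
    using chart_neighbourhood_exists[OF \<Omega> ch1 y(1,2) V(1)] V(2) y(3) by metis
  have oQ: "open Q" using Q(1) by (simp add: chart_neighbourhood_def)
  obtain s' Q' where Q': "chart_neighbourhood \<Omega> i' W' \<phi>' s' Q'" "p \<in> Q'" "Q' \<subseteq> Q"
    using chart_neighbourhood_exists[OF \<Omega> ch2 y'(1,2) oQ] Q(2) y'(3) by metis
  have oQ': "open Q'" using Q'(1) by (simp add: chart_neighbourhood_def)
  obtain a b where ab: "p \<in> box a b" "cbox a b \<subseteq> Q'" using box_neighbourhood[OF oQ' Q'(2)] .
  have sub: "cbox a b \<subseteq> Q" "cbox a b \<subseteq> V" using ab Q Q' by auto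
  show "\<exists>U. open U \<and> p \<in> U \<and> (\<forall>B\<in>sets borel. B \<subseteq> U \<longrightarrow> emeasure (chart_measure i W \<phi>) B = emeasure
      (chart_measure i' W' \<phi>') B)"
  proof (intro exI[of _ "box a b"] conjI ballI impI open_box ab(1))
    fix B assume B: "B \<in> sets borel" "B \<subseteq> box a b"
    show "emeasure (chart_measure i W \<phi>) B = emeasure (chart_measure i' W' \<phi>') B"
    proof (rule measures_agree_on_box[OF sets_chart_measure sets_chart_measure _ B])
      fix f :: "real^'n \<Rightarrow> real"
      assume f: "Ck_on 1 f UNIV" "\<And>x. 0 \<le> f x" "\<And>x. x \<notin> box a b \<Longrightarrow> f x = 0"
      have cs: "compactly_supported f (cbox a b)"
      proof unfold_locales
        show "f x = 0" if "x \<notin> cbox a b" for x using f(3)[of x] that box_subset_cbox[of a b] by blast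
      qed (use f in auto)
      show "(\<integral>\<^sup>+x. ennreal (f x) \<partial>chart_measure i W \<phi>) = (\<integral>\<^sup>+x. ennreal (f x) \<partial>chart_measure i' W' \<phi>') \<and>
          (\<integral>\<^sup>+x. ennreal (f x) \<partial>chart_measure i W \<phi>) < \<infinity>"
        using chart_test_integral[OF \<Omega> ch1 Q(1) V(1,3,4) cs sub f(2)] chart_test_integral[OF \<Omega> ch2 Q'(1)
            V(1,3,4) cs ab(2) sub(2) f(2)]
        by simp
    qed
  qed
qed

section \<open>The surface measure\<close>

lemma emeasure_chart_measure':
  fixes \<Omega> :: "(real^'n) set"
  assumes "frontier_chart \<Omega> i W \<phi>" "E \<in> sets borel"
  shows "emeasure (chart_measure i W \<phi>) E = (\<integral>\<^sup>+ y. indicator {y\<in>W. graph_point i \<phi> y \<in> E} y *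
                    ennreal (sqrt (1 + (\<Sum>j\<in>UNIV - {i}. (pderiv_at j \<phi> y)\<^sup>2))) \<partial>hyperplane_lborel i)"
  using emeasure_chart_measure[OF frontier_chartD(1,2)[OF assms(1)] assms(2)] by (simp only: norm_graph_normal)

lemma is_surface_measure_iff:
  fixes \<Omega> :: "(real^'n) set"
  shows "is_surface_measure (frontier \<Omega>) \<sigma> \<longleftrightarrow> sets \<sigma> = sets borel \<and> emeasure \<sigma> (- frontier \<Omega>) = 0 \<and>
    (\<forall>i W \<phi>. frontier_chart \<Omega> i W \<phi> \<longrightarrow>
      (\<forall>E\<in>sets borel. E \<subseteq> graph_point i \<phi> ` {y\<in>W. y $ i = 0} \<longrightarrow> emeasure \<sigma> E = emeasure (chart_measure i W \<phi>)
          E))"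
  unfolding is_surface_measure_def frontier_chart_def[symmetric]
  by (simp add: emeasure_chart_measure' cong: conj_cong imp_cong)

text \<open>The charts come from compactness of the boundary; their domains of use D are made disjoint so that
  measures can be added.\<close>
lemma finite_atlas:
  fixes \<Omega> :: "(real^'n) set"
  assumes \<Omega>: "bounded_smooth_domain \<Omega>"
  obtains m :: nat and \<mu> :: "nat \<Rightarrow> (real^'n) measure" and D :: "nat \<Rightarrow> (real^'n) set"
  where "disjoint_family_on D {..<m}" "\<And>k. k < m \<Longrightarrow> D k \<in> sets borel" "(\<Union>k<m. D k) = frontier \<Omega>"
    "\<And>k. k < m \<Longrightarrow> \<exists>i W \<phi>. frontier_chart \<Omega> i W \<phi> \<and> \<mu> k = chart_measure i W \<phi> \<and> D k \<subseteq> graph_point i \<phi> `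
        {y\<in>W. y $ i = 0}"
proof -
  define R where "R = (\<lambda>p \<mu> Q. open Q \<and> p \<in> Q \<and> (\<exists>i W \<phi>. frontier_chart \<Omega> i W \<phi> \<and> \<mu> = chart_measure i W \<phi> \<and>
      Q \<inter> frontier \<Omega> \<subseteq> graph_point i \<phi> ` {y\<in>W. y $ i = 0}))"
  have "\<exists>\<mu> Q. R p \<mu> Q" if p: "p \<in> frontier \<Omega>" for p
  proof -
    obtain i W \<phi> y where ch: "frontier_chart \<Omega> i W \<phi>" and y: "y \<in> W" "y $ i = 0" "p = graph_point i \<phi> y"
      using frontier_chart_at[OF \<Omega> p] by (metis (mono_tags, lifting) imageE mem_Collect_eq)
    obtain s Q where Q: "chart_neighbourhood \<Omega> i W \<phi> s Q" "p \<in> Q"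
      using chart_neighbourhood_exists[OF \<Omega> ch y(1,2) open_UNIV] y(3) by (metis UNIV_I)
    have "x \<in> graph_point i \<phi> ` {y\<in>W. y $ i = 0}" if "x \<in> Q \<inter> frontier \<Omega>" for x
    proof -
      have "x = graph_point i \<phi> (drop_coord i x)" "drop_coord i x \<in> W"
        using Q(1) that unfolding chart_neighbourhood_def by blast+
      then show ?thesis by (intro image_eqI[of _ _ "drop_coord i x"]) auto
    qed
    moreover have "open Q" using Q(1) by (simp add: chart_neighbourhood_def)
    ultimately show ?thesis using Q(2) ch unfolding R_def by (intro exI[of _ "chart_measure i W \<phi>"]
        exI[of _ Q]) blast
  qed
  then obtain \<mu> Q where R: "\<And>p. p \<in> frontier \<Omega> \<Longrightarrow> R p (\<mu> p) (Q p)" by metis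
  note \<mu>Q = R[unfolded R_def]
  obtain C where C: "C \<subseteq> frontier \<Omega>" "finite C" "frontier \<Omega> \<subseteq> (\<Union>c\<in>C. Q c)"
  proof (rule compactE_image[OF bounded_smooth_domainD(5)[OF \<Omega>], of "frontier \<Omega>" Q])
    show "open (Q c)" if "c \<in> frontier \<Omega>" for c using \<mu>Q[OF that] by blast
    show "frontier \<Omega> \<subseteq> (\<Union>c\<in>frontier \<Omega>. Q c)" using \<mu>Q by blast
  qed
  obtain xs where xs: "set xs = C" using finite_list[OF C(2)] by blast
  define A where "A = (\<lambda>k. if k < length xs then Q (xs ! k) \<inter> frontier \<Omega> else {})"
  have Ak: "xs ! k \<in> frontier \<Omega>" if "k < length xs" for k using that xs C(1) nth_mem by blast
  have UA: "(\<Union>k. A k) = frontier \<Omega>"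
  proof
    show "frontier \<Omega> \<subseteq> (\<Union>k. A k)"
    proof
      fix x assume x: "x \<in> frontier \<Omega>"
      then obtain c where "c \<in> C" "x \<in> Q c" using C(3) by blast
      then obtain k where "k < length xs" "xs ! k = c" using xs by (metis in_set_conv_nth)
      then show "x \<in> (\<Union>k. A k)" using x \<open>x \<in> Q c\<close> by (auto simp: A_def)
    qed
  qed (auto simp: A_def split: if_splits)
  have Am: "range A \<subseteq> sets borel" using \<mu>Q Ak by (auto simp: A_def intro!: sets.Int)
  have dk: "disjointed A k \<subseteq> A k" for k by (rule disjointed_subset)
  show thesis
  proof (rule that[of "disjointed A" "length xs" "\<lambda>k. \<mu> (xs ! k)"])
    show "disjoint_family_on (disjointed A) {..<length xs}"
      by (rule disjoint_family_on_mono[OF subset_UNIV disjoint_family_disjointed])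
    show "disjointed A k \<in> sets borel" for k using sets.range_disjointed_sets[OF Am] by auto
    show "(\<Union>k<length xs. disjointed A k) = frontier \<Omega>"
    proof -
      have "disjointed A k = {}" if "\<not> k < length xs" for k using dk[of k] that by (simp add: A_def)
      then have "(\<Union>k<length xs. disjointed A k) = (\<Union>k. disjointed A k)" by blast
      then show ?thesis using UA UN_disjointed_eq[of A] by simp
    qed
    fix k assume k: "k < length xs"
    have "disjointed A k \<subseteq> Q (xs ! k) \<inter> frontier \<Omega>" using dk[of k] k by (simp add: A_def)
    then show "\<exists>i W \<phi>. frontier_chart \<Omega> i W \<phi> \<and> \<mu> (xs ! k) = chart_measure i W \<phi> \<and> disjointed A k \<subseteq>
        graph_point i \<phi> ` {y\<in>W. y $ i = 0}"
      using \<mu>Q[OF Ak[OF k]] by blast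
  qed
qed

text \<open>Existence: add up the chart measures over a finite disjointified atlas; agreement of chart
  measures on overlaps makes the sum correct on every chart. Uniqueness: on each piece of the atlas a
  surface measure is prescribed.\<close>
lemma is_surface_measure_surface_measure:
  fixes \<Omega> :: "(real^'n) set"
  assumes \<Omega>: "bounded_smooth_domain \<Omega>"
  shows "is_surface_measure (frontier \<Omega>) (surface_measure (frontier \<Omega>))"
proof -
  obtain m :: nat and \<mu> D where D: "disjoint_family_on D {..<m}" "\<And>k. k < m \<Longrightarrow> D k \<in> sets borel" "(\<Union>k<m. D k) =
      frontier \<Omega>"
    and \<mu>: "\<And>k. k < m \<Longrightarrow> \<exists>i W \<phi>. frontier_chart \<Omega> i W \<phi> \<and> \<mu> k = chart_measure i W \<phi> \<and> D k \<subseteq> graph_point i \<phi> `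
        {y\<in>W. y $ i = 0}"
    by (rule finite_atlas[OF \<Omega>]) blast
  have \<mu>s: "sets (\<mu> k) = sets borel" if "k < m" for k using \<mu>[OF that] by auto
  have split: "emeasure K E = (\<Sum>k<m. emeasure K (E \<inter> D k))" if K: "sets K = sets borel" "E \<in> sets borel"
      "E \<subseteq> frontier \<Omega>" for K E
  proof -
    have "E = (\<Union>k<m. E \<inter> D k)" using that(3) D(3) by blast
    moreover have "(\<Sum>k<m. emeasure K (E \<inter> D k)) = emeasure K (\<Union>k<m. E \<inter> D k)"
    proof (rule sum_emeasure)
      show "disjoint_family_on (\<lambda>k. E \<inter> D k) {..<m}" using D(1) unfolding disjoint_family_on_def by blast
    qed (use K D in auto)
    ultimately show ?thesis by simp
  qed
  define \<sigma>f where "\<sigma>f = (\<lambda>E. \<Sum>k<m. emeasure (\<mu> k) (E \<inter> D k))"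
  define \<sigma> where "\<sigma> = measure_of UNIV (sets borel) \<sigma>f"
  have sa: "sigma_algebra UNIV (sets (borel :: (real^'n) measure))"
    using sets.sigma_algebra_axioms[of "borel :: (real^'n) measure"] by simp
  have \<sigma>s: "sets \<sigma> = sets borel" unfolding \<sigma>_def
    using sigma_algebra.sets_measure_of_eq[OF sa] by simp
  have em: "emeasure \<sigma> E = \<sigma>f E" if E: "E \<in> sets borel" for E
    unfolding \<sigma>_def
  proof (rule emeasure_measure_of_sigma[OF sa _ _ E])
    show "positive (sets borel) \<sigma>f" by (simp add: positive_def \<sigma>f_def)
    show "countably_additive (sets borel) \<sigma>f"
    proof (rule countably_additiveI)
      fix F :: "nat \<Rightarrow> (real^'n) set"
      assume F: "range F \<subseteq> sets borel" "disjoint_family F"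
      have "(\<Sum>i. emeasure (\<mu> k) (F i \<inter> D k)) = emeasure (\<mu> k) ((\<Union>i. F i) \<inter> D k)" if k: "k < m" for k
      proof -
        have "(\<Sum>i. emeasure (\<mu> k) (F i \<inter> D k)) = emeasure (\<mu> k) (\<Union>i. F i \<inter> D k)"
          by (rule suminf_emeasure) (use F D(2)[OF k] \<mu>s[OF k] in \<open>auto simp: disjoint_family_on_def\<close>)
        then show ?thesis by simp
      qed
      then show "(\<Sum>i. \<sigma>f (F i)) = \<sigma>f (\<Union> (range F))"
        unfolding \<sigma>f_def by (subst suminf_sum) (auto intro: summableI)
    qed
  qed
  have "is_surface_measure (frontier \<Omega>) \<sigma>"
    unfolding is_surface_measure_iff
  proof (intro conjI allI impI ballI \<sigma>s)
    have "- frontier \<Omega> \<inter> D k = {}" if "k < m" for k using D(3) that by blast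
    then show "emeasure \<sigma> (- frontier \<Omega>) = 0" by (subst em) (auto simp: \<sigma>f_def)
    fix i W \<phi> E assume ch: "frontier_chart \<Omega> i W \<phi>" and E: "E \<in> sets borel" "E \<subseteq> graph_point i \<phi> `
        {y\<in>W. y $ i = 0}"
    have Ef: "E \<subseteq> frontier \<Omega>" using E(2) ch by (auto simp: frontier_chart_def)
    have "emeasure (\<mu> k) (E \<inter> D k) = emeasure (chart_measure i W \<phi>) (E \<inter> D k)" if k: "k < m" for k
    proof -
      obtain i' W' \<phi>' where "frontier_chart \<Omega> i' W' \<phi>'" "\<mu> k = chart_measure i' W' \<phi>'" "D k \<subseteq> graph_point i'
          \<phi>' ` {y\<in>W'. y $ i' = 0}"
        using \<mu>[OF k] by blast
      then show ?thesis using chart_measures_agree[OF \<Omega> _ ch, of i' W' \<phi>' "E \<inter> D k"] E D(2)[OF k] by auto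
    qed
    then show "emeasure \<sigma> E = emeasure (chart_measure i W \<phi>) E"
      using split[OF sets_chart_measure[of i W \<phi>] E(1) Ef] em[OF E(1)] unfolding \<sigma>f_def by simp
  qed
  moreover have "\<tau> = \<sigma>" if "is_surface_measure (frontier \<Omega>) \<tau>" for \<tau>
  proof (rule measure_eqI)
    have \<tau>: "sets \<tau> = sets borel" "emeasure \<tau> (- frontier \<Omega>) = 0"
      "\<And>i W \<phi> E. \<lbrakk>frontier_chart \<Omega> i W \<phi>; E \<in> sets borel; E \<subseteq> graph_point i \<phi> ` {y\<in>W. y $ i = 0}\<rbrakk> \<Longrightarrow> emeasure \<tau>
          E = emeasure (chart_measure i W \<phi>) E"
      using that unfolding is_surface_measure_iff by blast+
    show "sets \<tau> = sets \<sigma>" using \<tau>(1) \<sigma>s by simp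
    fix E assume "E \<in> sets \<tau>"
    then have E: "E \<in> sets borel" using \<tau>(1) by simp
    have "emeasure \<tau> (E - frontier \<Omega>) \<le> emeasure \<tau> (- frontier \<Omega>)" by (rule emeasure_mono) (use \<tau>(1) in auto)
    then have "emeasure \<tau> (E - frontier \<Omega>) = 0" using \<tau>(2) by simp
    moreover have "emeasure \<tau> E = emeasure \<tau> (E \<inter> frontier \<Omega>) + emeasure \<tau> (E - frontier \<Omega>)"
      by (subst plus_emeasure) (use E \<tau>(1) in \<open>auto simp: Int_Diff_Un\<close>)
    moreover have "emeasure \<tau> (E \<inter> frontier \<Omega>) = (\<Sum>k<m. emeasure \<tau> (E \<inter> frontier \<Omega> \<inter> D k))"
      by (rule split) (use \<tau> E in auto)
    moreover have "emeasure \<tau> (E \<inter> frontier \<Omega> \<inter> D k) = emeasure (\<mu> k) (E \<inter> D k)" if k: "k < m" for k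
    proof -
      have "E \<inter> frontier \<Omega> \<inter> D k = E \<inter> D k" using D(3) k by blast
      moreover obtain i' W' \<phi>' where "frontier_chart \<Omega> i' W' \<phi>'" "\<mu> k = chart_measure i' W' \<phi>'"
          "D k \<subseteq> graph_point i' \<phi>' ` {y\<in>W'. y $ i' = 0}"
        using \<mu>[OF k] by blast
      ultimately show ?thesis using \<tau>(3)[of i' W' \<phi>' "E \<inter> D k"] E D(2)[OF k] by auto
    qed
    ultimately show "emeasure \<tau> E = emeasure \<sigma> E" by (simp add: em[OF E] \<sigma>f_def)
  qed
  ultimately show ?thesis unfolding surface_measure_def by (rule theI)
qed

abbreviation \<S> :: "(real^'n) set \<Rightarrow> (real^'n) measure"
  where "\<S> \<Omega> \<equiv> surface_measure (frontier \<Omega>)"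

context
  fixes \<Omega> :: "(real^'n) set"
  assumes \<Omega>: "bounded_smooth_domain \<Omega>"
begin

lemma sets_surface_measure: "sets (\<S> \<Omega>) = sets borel"
  and surface_measure_null: "emeasure (\<S> \<Omega>) (- frontier \<Omega>) = 0"
  and surface_measure_chart: "\<lbrakk>frontier_chart \<Omega> i W \<phi>; E \<in> sets borel; E \<subseteq> graph_point i \<phi> ` {y\<in>W. y $ i = 0}\<rbrakk>
    \<Longrightarrow> emeasure (\<S> \<Omega>) E = emeasure (chart_measure i W \<phi>) E"
  using is_surface_measure_surface_measure[OF \<Omega>] unfolding is_surface_measure_iff by blast+

lemma space_surface_measure: "space (\<S> \<Omega>) = UNIV"
  using sets_eq_imp_space_eq[OF sets_surface_measure] by simp

lemma integral_surface_measure_chart: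
  fixes F :: "real^'n \<Rightarrow> real"
  assumes ch: "frontier_chart \<Omega> i W \<phi>" and A: "A \<in> sets borel" "A \<subseteq> graph_point i \<phi> ` {y\<in>W. y $ i = 0}"
    and F: "F \<in> borel_measurable borel" "\<And>x. x \<notin> A \<Longrightarrow> F x = 0"
  shows "(\<integral>x. F x \<partial>(\<S> \<Omega>)) = (\<integral>x. F x \<partial>chart_measure i W \<phi>)"
    "integrable (\<S> \<Omega>) F \<longleftrightarrow> integrable (chart_measure i W \<phi>) F"
proof -
  let ?I = "indicator A :: real^'n \<Rightarrow> real"
  have "density (\<S> \<Omega>) (\<lambda>x. ennreal (?I x)) = density (chart_measure i W \<phi>) (\<lambda>x. ennreal (?I x))"
  proof (rule measure_eqI)
    fix E assume "E \<in> sets (density (\<S> \<Omega>) (\<lambda>x. ennreal (?I x)))"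
    then have E: "E \<in> sets borel" by (simp add: sets_surface_measure)
    have "emeasure (density K (\<lambda>x. ennreal (?I x))) E = emeasure K (E \<inter> A)" if K: "sets K = sets borel" for K
    proof -
      have "emeasure (density K (\<lambda>x. ennreal (?I x))) E = (\<integral>\<^sup>+x. ennreal (?I x) * indicator E x \<partial>K)"
        by (rule emeasure_density) (use E A K in auto)
      also have "\<dots> = (\<integral>\<^sup>+x. indicator (E \<inter> A) x \<partial>K)" by (intro nn_integral_cong) (auto simp: indicator_def)
      also have "\<dots> = emeasure K (E \<inter> A)" using E A K by simp
      finally show ?thesis .
    qed
    moreover have "emeasure (\<S> \<Omega>) (E \<inter> A) = emeasure (chart_measure i W \<phi>) (E \<inter> A)"
      by (rule surface_measure_chart[OF ch]) (use E A in auto)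
    ultimately show "emeasure (density (\<S> \<Omega>) (\<lambda>x. ennreal (?I x))) E = emeasure (density (chart_measure i W \<phi>)
        (\<lambda>x. ennreal (?I x))) E"
      using sets_surface_measure by simp
  qed (simp add: sets_surface_measure)
  moreover have "(\<integral>x. F x \<partial>density K (\<lambda>x. ennreal (?I x))) = (\<integral>x. F x \<partial>K)"
    "integrable (density K (\<lambda>x. ennreal (?I x))) F \<longleftrightarrow> integrable K F" if K: "sets K = sets borel" for K
  proof -
    have Fm: "F \<in> borel_measurable K" "?I \<in> borel_measurable K"
      using F(1) A(1) measurable_cong_sets[OF K refl, of borel] K by (simp_all add: borel_measurable_indicator)
    have eq: "(\<lambda>x. ?I x *\<^sub>R F x) = F" using F(2) by (auto simp: indicator_def fun_eq_iff)
    show "(\<integral>x. F x \<partial>density K (\<lambda>x. ennreal (?I x))) = (\<integral>x. F x \<partial>K)"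
      by (subst integral_density[OF Fm]) (simp_all add: eq eq[unfolded real_scaleR_def])
    show "integrable (density K (\<lambda>x. ennreal (?I x))) F \<longleftrightarrow> integrable K F"
      by (subst integrable_density[OF Fm]) (simp_all add: eq eq[unfolded real_scaleR_def])
  qed
  ultimately show "(\<integral>x. F x \<partial>(\<S> \<Omega>)) = (\<integral>x. F x \<partial>chart_measure i W \<phi>)"
    "integrable (\<S> \<Omega>) F \<longleftrightarrow> integrable (chart_measure i W \<phi>) F"
    using sets_surface_measure sets_chart_measure by metis+
qed

lemma local_divergence:
  assumes p: "p \<in> frontier \<Omega>" and U: "open U" "p \<in> U"
  obtains Q where "open Q" "p \<in> Q" "Q \<subseteq> U"
    "\<And>f T j. \<lbrakk>compactly_supported f T; T \<subseteq> Q\<rbrakk> \<Longrightarrow> integrable (\<S> \<Omega>) (\<lambda>x. f x * frontier_normal \<Omega> j x) \<and>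
      (\<integral>x. indicator \<Omega> x * pderiv_at j f x \<partial>lborel) = (\<integral>x. f x * frontier_normal \<Omega> j x \<partial>(\<S> \<Omega>))"
proof -
  obtain i W \<phi> y where ch: "frontier_chart \<Omega> i W \<phi>" and y: "y \<in> W" "y $ i = 0" "p = graph_point i \<phi> y"
    using frontier_chart_at[OF \<Omega> p] by (metis (mono_tags, lifting) imageE mem_Collect_eq)
  obtain s Q where Q: "chart_neighbourhood \<Omega> i W \<phi> s Q" "p \<in> Q" "Q \<subseteq> U"
    using chart_neighbourhood_exists[OF \<Omega> ch y(1,2) U(1)] y(3) U(2) by metis
  have oQ: "open Q" using Q(1) by (simp add: chart_neighbourhood_def)
  have graph: "Q \<inter> frontier \<Omega> \<subseteq> graph_point i \<phi> ` {y\<in>W. y $ i = 0}"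
  proof
    fix x assume x: "x \<in> Q \<inter> frontier \<Omega>"
    then have "x = graph_point i \<phi> (drop_coord i x)" "drop_coord i x \<in> W"
      using Q(1) unfolding chart_neighbourhood_def by blast+
    then show "x \<in> graph_point i \<phi> ` {y\<in>W. y $ i = 0}" by (intro image_eqI[of _ _ "drop_coord i x"]) auto
  qed
  show thesis
  proof (rule that[OF oQ Q(2,3)])
    fix f T j assume f: "compactly_supported f T" and T: "T \<subseteq> Q"
    interpret compactly_supported f T by (rule f)
    have m: "(\<lambda>x. f x * frontier_normal \<Omega> j x) \<in> borel_measurable borel"
      using measurable_frontier_normal[OF \<Omega>, of j] by measurable
    have A: "Q \<inter> frontier \<Omega> \<in> sets borel" using oQ by (intro sets.Int) auto
    have z: "f x * frontier_normal \<Omega> j x = 0" if "x \<notin> Q \<inter> frontier \<Omega>" for x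
      using that zero T by (auto simp: frontier_normal_def)
    show "integrable (\<S> \<Omega>) (\<lambda>x. f x * frontier_normal \<Omega> j x) \<and>
      (\<integral>x. indicator \<Omega> x * pderiv_at j f x \<partial>lborel) = (\<integral>x. f x * frontier_normal \<Omega> j x \<partial>(\<S> \<Omega>))"
      using integral_surface_measure_chart[OF ch A graph m z] chart_divergence[OF \<Omega> ch Q(1) f T, of j] by simp
  qed
qed

end

text \<open>With s = max 0 (1 - t/m), the function (1 - s^(k+1)) / t equals 1/t for t \<open>\<ge>\<close> m, and for t < m it
  is a geometric sum in 1 - t/m, hence a polynomial. It thus continues 1/t across 0.\<close>
section \<open>Partitions of unity\<close>

lemma smooth_reciprocal_cutoff:
  fixes m :: real assumes m: "m > 0"
  obtains q :: "real \<Rightarrow> real" where "Ck_on k q UNIV" "\<And>t. t \<ge> m \<Longrightarrow> t * q t = 1"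
proof -
  define r where "r = (\<lambda>t. max 0 (1 - t / m))"
  define q where "q = (\<lambda>t. if t < m then (\<Sum>l<Suc k. (1 - t / m) ^ l) / m else 1 / t)"
  have lin: "Ck_on k (\<lambda>t. 1 - t / m) U" if "open U" for U
    using that bounded_linear_ident m
    by (intro Ck_on_diff Ck_on_const Ck_on_divide Ck_on_linear) auto
  have lin': "Ck_on k (\<lambda>t::real. t) U" if "open U" for U
    using that bounded_linear_ident by (intro Ck_on_linear) auto
  have eq: "q t = (1 - r t ^ Suc k) / t" if "t > 0" for t
  proof (cases "t < m")
    case True
    have "(1 - (1 - t/m)) * (\<Sum>l<Suc k. (1 - t / m) ^ l) = 1 - (1 - t / m) ^ Suc k"
      by (rule one_diff_power_eq[symmetric])
    then have "t / m * (\<Sum>l<Suc k. (1 - t / m) ^ l) = 1 - (1 - t / m) ^ Suc k" by simp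
    moreover have "r t = 1 - t / m" using True m by (simp add: r_def field_simps)
    ultimately have "(1 - r t ^ Suc k) / t = (t / m * (\<Sum>l<Suc k. (1 - t / m) ^ l)) / t" by (simp only:)
    also have "\<dots> = (\<Sum>l<Suc k. (1 - t / m) ^ l) / m" using that by (simp del: sum.lessThan_Suc)
    finally show ?thesis using True by (simp add: q_def)
  next
    case False
    then have "r t = 0" using m by (simp add: r_def field_simps)
    then show ?thesis using False by (simp add: q_def)
  qed
  have "Ck_on k q {..<m}"
  proof (rule Ck_on_cong[of _ "\<lambda>t. (\<Sum>l<Suc k. (1 - t / m) ^ l) / m"])
    show "Ck_on k (\<lambda>t. (\<Sum>l<Suc k. (1 - t / m) ^ l) / m) {..<m}"
      by (intro Ck_on_divide Ck_on_sum Ck_on_power lin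
          Ck_on_const) (use m in auto)
  qed (auto simp: q_def)
  moreover have "Ck_on k q {0<..}"
  proof (rule Ck_on_cong[of _ "\<lambda>t. (1 - r t ^ Suc k) / t"])
    have "Ck_on k (\<lambda>t. r t ^ Suc k) {0<..}"
      unfolding r_def
      by (rule Ck_on_compose[OF _ open_UNIV _ Ck_on_pos_part_power lin]) auto
    then show "Ck_on k (\<lambda>t. (1 - r t ^ Suc k) / t) {0<..}"
      by (intro Ck_on_divide Ck_on_diff lin' Ck_on_const) auto
  qed (auto simp: eq)
  moreover have "{..<m} \<union> {0<..} = (UNIV :: real set)" using m by auto
  ultimately have "Ck_on k q UNIV"
    using Ck_on_Un[of "{..<m}" "{0<..}" k q] by simp
  moreover have "t * q t = 1" if "t \<ge> m" for t using that m by (simp add: q_def)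
  ultimately show ?thesis using that by blast
qed

text \<open>Bumps divided by their sum, except that the division uses a reciprocal regularised where the sum
  is small, so that the quotients remain differentiable at the edges of the supports.\<close>
lemma partition_of_unity:
  fixes K :: "(real^'n) set"
  assumes K: "compact K" and G: "\<And>p. p \<in> K \<Longrightarrow> open (G p) \<and> p \<in> G p"
  obtains C and \<eta> and T where "finite C" "C \<subseteq> K" "\<And>c. c \<in> C \<Longrightarrow> Ck_on k (\<eta> c) UNIV"
    "\<And>c. c \<in> C \<Longrightarrow> compact (T c)" "\<And>c. c \<in> C \<Longrightarrow> T c \<subseteq> G c" "\<And>c x. c \<in> C \<Longrightarrow> x \<notin> T c \<Longrightarrow> \<eta> c x = (0::real)"
    "\<And>x. x \<in> K \<Longrightarrow> (\<Sum>c\<in>C. \<eta> c x) = 1"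
proof -
  have "\<forall>p\<in>K. \<exists>ab. p \<in> box (fst ab) (snd ab) \<and> cbox (fst ab) (snd ab) \<subseteq> G p"
    using box_neighbourhood G by (metis fst_conv snd_conv)
  then obtain ab where ab: "\<And>p. p \<in> K \<Longrightarrow> p \<in> box (fst (ab p)) (snd (ab p)) \<and> cbox (fst (ab p)) (snd (ab p)) \<subseteq> G
      p"
    by metis
  define B where "B = (\<lambda>p. box (fst (ab p)) (snd (ab p)))"
  obtain C where C: "C \<subseteq> K" "finite C" "K \<subseteq> (\<Union>c\<in>C. B c)"
    by (rule compactE_image[OF K, of K B]) (use ab in \<open>auto simp: B_def open_box\<close>)
  define \<theta> where "\<theta> = (\<lambda>p. bump k (fst (ab p)) (snd (ab p)))"
  define \<Theta> where "\<Theta> = (\<lambda>x. \<Sum>c\<in>C. \<theta> c x)"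
  have h\<theta>: "Ck_on k (\<theta> c) UNIV" for c unfolding \<theta>_def by (rule Ck_on_bump)
  have h\<Theta>: "Ck_on k \<Theta> UNIV" unfolding \<Theta>_def by (intro Ck_on_sum h\<theta>) auto
  have pos: "\<Theta> x > 0" if x: "x \<in> K" for x
  proof -
    obtain c where c: "c \<in> C" "x \<in> B c" using C(3) x by blast
    have "\<theta> c x > 0" using c(2) unfolding \<theta>_def B_def by (simp add: bump_pos_iff)
    then show ?thesis unfolding \<Theta>_def using c(1) C(2) bump_nonneg
      by (intro sum_pos2[of C c]) (auto simp: \<theta>_def)
  qed
  obtain m where m: "m > 0" "\<And>x. x \<in> K \<Longrightarrow> \<Theta> x \<ge> m"
  proof (cases "K = {}")
    case True then show ?thesis using that[of 1] by auto
  next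
    case False
    obtain x where "x \<in> K" "\<forall>y\<in>K. \<Theta> x \<le> \<Theta> y"
      using continuous_attains_inf[OF K False, of \<Theta>] continuous_on_subset[OF Ck_on_continuous_on[OF h\<Theta>]] by
          blast
    then show ?thesis using that[of "\<Theta> x"] pos by blast
  qed
  obtain q where q: "Ck_on k q UNIV" "\<And>t. t \<ge> m \<Longrightarrow> t * q t = 1"
    using smooth_reciprocal_cutoff[OF m(1)] by metis
  show thesis
  proof (rule that[of C "\<lambda>c x. \<theta> c x * q (\<Theta> x)" "\<lambda>p. cbox (fst (ab p)) (snd (ab p))"])
    show "Ck_on k (\<lambda>x. \<theta> c x * q (\<Theta> x)) UNIV" for c
      by (intro Ck_on_mult h\<theta>) (auto intro: Ck_on_compose[OF _ _ _ q(1) h\<Theta>])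
    show "\<theta> c x * q (\<Theta> x) = 0" if "x \<notin> cbox (fst (ab c)) (snd (ab c))" for c x
    proof -
      have "x \<notin> box (fst (ab c)) (snd (ab c))" using that box_subset_cbox by blast
      then show ?thesis by (simp add: \<theta>_def bump_eq_0)
    qed
    show "(\<Sum>c\<in>C. \<theta> c x * q (\<Theta> x)) = 1" if "x \<in> K" for x
      using q(2)[OF m(2)[OF that]] by (simp add: \<Theta>_def sum_distrib_right)
  qed (use C ab in auto)
qed

section \<open>The divergence theorem\<close>

lemma pderiv_at_sum:
  assumes "finite I" "\<And>i. i \<in> I \<Longrightarrow> f i differentiable (at x)"
  shows "pderiv_at j (\<lambda>x. \<Sum>i\<in>I. f i x) x = (\<Sum>i\<in>I. pderiv_at j (f i) x)"
proof -
  have "((\<lambda>x. \<Sum>i\<in>I. f i x) has_derivative (\<lambda>v. \<Sum>i\<in>I. frechet_derivative (f i) (at x) v)) (at x)"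
    by (rule has_derivative_sum) (use assms(2) frechet_derivative_works in blast)
  then show ?thesis by (simp add: pderiv_at_eq) (simp add: pderiv_at_def)
qed

lemma frontier_subset_closure: "frontier S \<subseteq> closure S" by (auto simp: frontier_def)

context
  fixes \<Omega> :: "(real^'n) set"
  assumes \<Omega>: "bounded_smooth_domain \<Omega>"
begin

text \<open>Cover the closure by chart neighbourhoods and \<open>\<Omega>\<close> itself. A piece of f supported in \<open>\<Omega>\<close>
  contributes zero on both sides, a piece supported in a chart neighbourhood satisfies the local theorem.\<close>
lemma divergence_theorem_component:
  assumes U: "open U" "closure \<Omega> \<subseteq> U" and f: "Ck_on 1 f U"
  shows "integrable (\<S> \<Omega>) (\<lambda>x. f x * frontier_normal \<Omega> j x)"
    "(\<integral>x. indicator \<Omega> x * pderiv_at j f x \<partial>lborel) = (\<integral>x. f x * frontier_normal \<Omega> j x \<partial>(\<S> \<Omega>))"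
    "integrable lborel (\<lambda>x. indicator \<Omega> x * pderiv_at j f x)"
proof -
  note d = bounded_smooth_domainD[OF \<Omega>]
  have ob: "\<Omega> \<in> sets borel" using d(1) by simp
  define P where "P = (\<lambda>Q. \<forall>f T. compactly_supported f T \<longrightarrow> T \<subseteq> Q \<longrightarrow>
    integrable (\<S> \<Omega>) (\<lambda>x. f x * frontier_normal \<Omega> j x) \<and>
      (\<integral>x. indicator \<Omega> x * pderiv_at j f x \<partial>lborel) = (\<integral>x. f x * frontier_normal \<Omega> j x \<partial>(\<S> \<Omega>)))"
  have "\<exists>Q. open Q \<and> p \<in> Q \<and> Q \<subseteq> U \<and> P Q" if p: "p \<in> closure \<Omega>" for p
  proof (cases "p \<in> frontier \<Omega>")
    case True
    have pU: "p \<in> U" using p U(2) by blast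
    obtain Q where "open Q" "p \<in> Q" "Q \<subseteq> U"
      "\<And>f T j. \<lbrakk>compactly_supported f T; T \<subseteq> Q\<rbrakk> \<Longrightarrow> integrable (\<S> \<Omega>) (\<lambda>x. f x * frontier_normal \<Omega> j x) \<and>
      (\<integral>x. indicator \<Omega> x * pderiv_at j f x \<partial>lborel) = (\<integral>x. f x * frontier_normal \<Omega> j x \<partial>(\<S> \<Omega>))"
      by (rule local_divergence[OF \<Omega> True U(1) pU]) blast
    then show ?thesis unfolding P_def by blast
  next
    case False
    then have p\<Omega>: "p \<in> \<Omega>" using p d(1) by (simp add: frontier_def interior_open)
    have "P \<Omega>" unfolding P_def
    proof (intro allI impI)
      fix f and T :: "(real^'n) set" assume f: "compactly_supported f T" and T: "T \<subseteq> \<Omega>"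
      interpret compactly_supported f T by (rule f)
      have z1: "f x * frontier_normal \<Omega> j x = 0" for x j
        using zero[of x] T d(1) by (auto simp: frontier_normal_def frontier_def interior_open indicator_def)
      have z2: "indicator \<Omega> x * pderiv_at j f x = pderiv_at j f x" for x j
        using pderiv_zero[of x] T by (auto simp: indicator_def)
      show "integrable (\<S> \<Omega>) (\<lambda>x. f x * frontier_normal \<Omega> j x) \<and>
        (\<integral>x. indicator \<Omega> x * pderiv_at j f x \<partial>lborel) = (\<integral>x. f x * frontier_normal \<Omega> j x \<partial>(\<S> \<Omega>))"
        unfolding z1 z2 by (simp add: integral_pderiv_UNIV)
    qed
    moreover have "\<Omega> \<subseteq> U" using U(2) closure_subset by blast
    ultimately show ?thesis using p\<Omega> d(1) by blast
  qed
  then obtain Q where Q: "\<And>p. p \<in> closure \<Omega> \<Longrightarrow> open (Q p) \<and> p \<in> Q p \<and> Q p \<subseteq> U \<and> P (Q p)" by metis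
  obtain C \<eta> T where C: "finite C" "C \<subseteq> closure \<Omega>" and \<eta>: "\<And>c. c \<in> C \<Longrightarrow> Ck_on 1 (\<eta> c) UNIV"
    and T: "\<And>c. c \<in> C \<Longrightarrow> compact (T c)" "\<And>c. c \<in> C \<Longrightarrow> T c \<subseteq> Q c" and \<eta>0: "\<And>c x. c \<in> C \<Longrightarrow> x \<notin> T c \<Longrightarrow> \<eta> c x =
        (0::real)"
    and \<eta>1: "\<And>x. x \<in> closure \<Omega> \<Longrightarrow> (\<Sum>c\<in>C. \<eta> c x) = 1"
    by (rule partition_of_unity[OF d(6), of Q 1]) (use Q in blast)+
  let ?g = "\<lambda>c x. \<eta> c x * f x"
  have cs: "compactly_supported (?g c) (T c)" if c: "c \<in> C" for c
  proof unfold_locales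
    have "T c \<subseteq> U" using T(2)[OF c] Q C(2) c by blast
    from Ck_on_zero_extension[OF U(1) compact_imp_closed[OF T(1)[OF c]] this \<eta>[OF c] \<eta>0[OF c] f]
    show "Ck_on 1 (?g c) UNIV" by simp
  qed (use T \<eta>0 c in auto)
  have Pc: "integrable (\<S> \<Omega>) (\<lambda>x. ?g c x * frontier_normal \<Omega> j x)"
      "(\<integral>x. indicator \<Omega> x * pderiv_at j (?g c) x \<partial>lborel) = (\<integral>x. ?g c x * frontier_normal \<Omega> j x \<partial>(\<S> \<Omega>))" if c:
          "c \<in> C" for c
    using Q[of c] C(2) c cs[OF c] T(2)[OF c] unfolding P_def by blast+
  have sumf: "(\<Sum>c\<in>C. ?g c x) = f x" if "x \<in> closure \<Omega>" for x
    using \<eta>1[OF that] by (simp flip: sum_distrib_right)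
  have fr: "f x * frontier_normal \<Omega> j x = (\<Sum>c\<in>C. ?g c x * frontier_normal \<Omega> j x)" for x
  proof (cases "x \<in> frontier \<Omega>")
    case True
    then have "x \<in> closure \<Omega>" using frontier_subset_closure by blast
    then show ?thesis using sumf[of x] by (simp flip: sum_distrib_right)
  qed (simp add: frontier_normal_def)
  have pd: "indicator \<Omega> x * pderiv_at j f x = (\<Sum>c\<in>C. indicator \<Omega> x * pderiv_at j (?g c) x)" for x
  proof (cases "x \<in> \<Omega>")
    case True
    have "pderiv_at j f x = pderiv_at j (\<lambda>x. \<Sum>c\<in>C. ?g c x) x"
      by (rule pderiv_at_cong_open[OF d(1) True]) (use sumf closure_subset in fastforce)
    also have "\<dots> = (\<Sum>c\<in>C. pderiv_at j (?g c) x)"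
    proof (rule pderiv_at_sum[OF C(1)])
      fix c assume "c \<in> C"
      then interpret compactly_supported "?g c" "T c" by (rule cs)
      show "?g c differentiable (at x)" using C1 by (simp add: higher_differentiable_on.simps)
    qed
    finally show ?thesis by (simp add: sum_distrib_left)
  qed simp
  have ic: "integrable lborel (\<lambda>x. indicator \<Omega> x * pderiv_at j (?g c) x)" if "c \<in> C" for c
    using compactly_supported.integrable_pderiv[OF cs[OF that] ob] .
  show "integrable (\<S> \<Omega>) (\<lambda>x. f x * frontier_normal \<Omega> j x)" unfolding fr
    by (rule Bochner_Integration.integrable_sum) (rule Pc(1))
  show "integrable lborel (\<lambda>x. indicator \<Omega> x * pderiv_at j f x)" unfolding pd
    by (rule Bochner_Integration.integrable_sum) (rule ic)
  show "(\<integral>x. indicator \<Omega> x * pderiv_at j f x \<partial>lborel) = (\<integral>x. f x * frontier_normal \<Omega> j x \<partial>(\<S> \<Omega>))"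
    unfolding fr pd by (simp add: Bochner_Integration.integral_sum ic Pc)
qed

lemma normal_extension:
  obtains Z :: "real^'n \<Rightarrow> real^'n" where "Ck_on k Z UNIV" "\<And>x. x \<in> frontier \<Omega> \<Longrightarrow> Z x = outer_unit_normal \<Omega> x"
proof -
  have "\<exists>V N. open V \<and> p \<in> V \<and> Ck_on k N V \<and> (\<forall>x\<in>V \<inter> frontier \<Omega>. outer_unit_normal \<Omega> x = N x)"
    if "p \<in> frontier \<Omega>" for p
    by (rule normal_extension_at[OF \<Omega> that]) blast
  then obtain V N where VN: "\<And>p. p \<in> frontier \<Omega> \<Longrightarrow> open (V p) \<and> p \<in> V p \<and> Ck_on k (N p) (V p) \<and>
      (\<forall>x\<in>V p \<inter> frontier \<Omega>. outer_unit_normal \<Omega> x = N p x)"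
    by metis
  obtain C \<eta> T where C: "finite C" "C \<subseteq> frontier \<Omega>" and \<eta>: "\<And>c. c \<in> C \<Longrightarrow> Ck_on k (\<eta> c) UNIV"
    and T: "\<And>c. c \<in> C \<Longrightarrow> compact (T c)" "\<And>c. c \<in> C \<Longrightarrow> T c \<subseteq> V c" and \<eta>0: "\<And>c x. c \<in> C \<Longrightarrow> x \<notin> T c \<Longrightarrow> \<eta> c x =
        (0::real)"
    and \<eta>1: "\<And>x. x \<in> frontier \<Omega> \<Longrightarrow> (\<Sum>c\<in>C. \<eta> c x) = 1"
    by (rule partition_of_unity[OF bounded_smooth_domainD(5)[OF \<Omega>], of V k]) (use VN in blast)+
  show thesis
  proof (rule that[of "\<lambda>x. \<Sum>c\<in>C. \<eta> c x *\<^sub>R N c x"])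
    show "Ck_on k (\<lambda>x. \<Sum>c\<in>C. \<eta> c x *\<^sub>R N c x) UNIV"
    proof (rule Ck_on_sum[OF open_UNIV])
      fix c assume c: "c \<in> C"
      then have "open (V c)" "Ck_on k (N c) (V c)" using VN C(2) by blast+
      then show "Ck_on k (\<lambda>x. \<eta> c x *\<^sub>R N c x) UNIV"
        using Ck_on_zero_extension[OF _ compact_imp_closed[OF T(1)[OF c]] T(2)[OF c] \<eta>[OF c] \<eta>0[OF c]] by blast
    qed
    fix x assume x: "x \<in> frontier \<Omega>"
    have "\<eta> c x *\<^sub>R N c x = \<eta> c x *\<^sub>R outer_unit_normal \<Omega> x" if c: "c \<in> C" for c
    proof (cases "x \<in> T c")
      case True
      have "c \<in> frontier \<Omega>" "x \<in> V c \<inter> frontier \<Omega>" using C(2) c T(2)[OF c] x True by blast+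
      then have "outer_unit_normal \<Omega> x = N c x" using VN by blast
      then show ?thesis by simp
    qed (simp add: \<eta>0 c)
    then have "(\<Sum>c\<in>C. \<eta> c x *\<^sub>R N c x) = (\<Sum>c\<in>C. \<eta> c x *\<^sub>R outer_unit_normal \<Omega> x)" by (rule sum.cong[OF refl])
    then show "(\<Sum>c\<in>C. \<eta> c x *\<^sub>R N c x) = outer_unit_normal \<Omega> x" using \<eta>1[OF x] by (simp flip: scaleR_sum_left)
  qed
qed

text \<open>The divergence theorem for an extension of the normal includes that the indicator of the boundary
  is integrable.\<close>
lemma finite_surface_measure: "finite_measure (\<S> \<Omega>)"
proof -
  obtain Z :: "real^'n \<Rightarrow> real^'n" where Z: "Ck_on 1 Z UNIV" "\<And>x. x \<in> frontier \<Omega> \<Longrightarrow> Z x = outer_unit_normal \<Omega> x"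
    by (rule normal_extension[where k=1]) blast
  have "integrable (\<S> \<Omega>) (\<lambda>x. \<Sum>j\<in>UNIV. Z x $ j * frontier_normal \<Omega> j x)"
    by (intro Bochner_Integration.integrable_sum divergence_theorem_component(1)[OF open_UNIV subset_UNIV]
        Ck_on_vec_nth Z(1) open_UNIV)
  moreover have "(\<Sum>j\<in>UNIV. Z x $ j * frontier_normal \<Omega> j x) = indicator (frontier \<Omega>) x" for x
    by (rule sum_normal_components[OF \<Omega>, of UNIV]) (use Z(2) in auto)
  ultimately have "integrable (\<S> \<Omega>) (indicator (frontier \<Omega>) :: _ \<Rightarrow> real)" by simp
  then have "emeasure (\<S> \<Omega>) (frontier \<Omega>) < \<infinity>"
    by (simp add: integrable_indicator_iff space_surface_measure[OF \<Omega>])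
  moreover have "emeasure (\<S> \<Omega>) UNIV = emeasure (\<S> \<Omega>) (frontier \<Omega>) + emeasure (\<S> \<Omega>) (- frontier \<Omega>)"
    by (subst plus_emeasure) (auto simp: sets_surface_measure[OF \<Omega>])
  ultimately show ?thesis using surface_measure_null[OF \<Omega>] by (intro finite_measureI)
      (simp add: space_surface_measure[OF \<Omega>])
qed

lemma set_integrable_frontier:
  fixes g :: "real^'n \<Rightarrow> real"
  assumes "continuous_on (frontier \<Omega>) g" shows "set_integrable (\<S> \<Omega>) (frontier \<Omega>) g"
proof -
  interpret finite_measure "\<S> \<Omega>" by (rule finite_surface_measure)
  obtain B where B: "\<And>x. x \<in> frontier \<Omega> \<Longrightarrow> norm (g x) \<le> B"
    using compact_imp_bounded[OF compact_continuous_image[OF assms bounded_smooth_domainD(5)[OF \<Omega>]]] by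
        (auto simp: bounded_iff)
  have "(\<lambda>x. indicator (frontier \<Omega>) x *\<^sub>R g x) \<in> borel_measurable (\<S> \<Omega>)"
    using borel_measurable_continuous_on_indicator[OF _ assms]
        measurable_cong_sets[OF sets_surface_measure[OF \<Omega>] refl] by auto
  then show ?thesis unfolding set_integrable_def
    by (rule integrable_const_bound[where B="\<bar>B\<bar>", rotated]) (use B in \<open>force simp: indicator_def\<close>)
qed

lemma set_integrable_domain:
  fixes g :: "real^'n \<Rightarrow> real"
  assumes "continuous_on (closure \<Omega>) g" shows "set_integrable lborel \<Omega> g"
proof -
  have "integrable lborel (\<lambda>x. indicator (closure \<Omega>) x *\<^sub>R g x)"
    by (rule borel_integrable_compact[OF bounded_smooth_domainD(6)[OF \<Omega>] assms])
  then have "set_integrable lborel (closure \<Omega>) g" by (simp add: set_integrable_def)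
  then show ?thesis by (rule set_integrable_subset) (use bounded_smooth_domainD(1)[OF \<Omega>] closure_subset in auto)
qed

lemma divergence_theorem:
  assumes U: "open U" "closure \<Omega> \<subseteq> U" and F: "Ck_on 1 F U"
  shows "(LINT x:\<Omega>|lborel. divergence F x) = (LINT x:frontier \<Omega>|(\<S> \<Omega>). F x \<bullet> outer_unit_normal \<Omega> x)"
proof -
  have Fj: "Ck_on 1 (\<lambda>x. F x $ j) U" for j by (rule Ck_on_vec_nth[OF U(1) F])
  note D = divergence_theorem_component[OF U Fj]
  have "(LINT x:\<Omega>|lborel. divergence F x) = (\<integral>x. (\<Sum>j\<in>UNIV. indicator \<Omega> x * pderiv_at j (\<lambda>x. F x $ j) x)
      \<partial>lborel)"
    unfolding set_lebesgue_integral_def divergence_def by (simp add: sum_distrib_left)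
  also have "\<dots> = (\<Sum>j\<in>UNIV. \<integral>x. indicator \<Omega> x * pderiv_at j (\<lambda>x. F x $ j) x \<partial>lborel)"
    by (rule Bochner_Integration.integral_sum) (rule D(3))
  also have "\<dots> = (\<Sum>j\<in>UNIV. \<integral>x. F x $ j * frontier_normal \<Omega> j x \<partial>(\<S> \<Omega>))" by (simp only: D(2))
  also have "\<dots> = (\<integral>x. (\<Sum>j\<in>UNIV. F x $ j * frontier_normal \<Omega> j x) \<partial>(\<S> \<Omega>))"
    by (rule Bochner_Integration.integral_sum[symmetric]) (rule D(1))
  also have "\<dots> = (LINT x:frontier \<Omega>|(\<S> \<Omega>). F x \<bullet> outer_unit_normal \<Omega> x)"
    unfolding set_lebesgue_integral_def frontier_normal_def inner_vec_def
    by (simp add: sum_distrib_left mult_ac)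
  finally show ?thesis .
qed

end

section \<open>Principal curvatures\<close>

text \<open>A maximiser of the Rayleigh quotient: with l its value, perturbing x by t y with y orthogonal to x
  gives 2 t (y \<open>\<bullet>\<close> A x) \<open>\<le>\<close> C t^2 for all t, so A x is orthogonal to all such y.\<close>
lemma symmetric_eigenvector:
  fixes A :: "'a::euclidean_space \<Rightarrow> 'a"
  assumes lin: "linear A" and T: "subspace T" "dim T \<noteq> 0" and inv: "\<And>x. x \<in> T \<Longrightarrow> A x \<in> T"
    and sym: "\<And>x y. x \<in> T \<Longrightarrow> y \<in> T \<Longrightarrow> A x \<bullet> y = x \<bullet> A y"
  obtains x l where "x \<in> T" "norm x = 1" "A x = l *\<^sub>R x"
proof -
  let ?S = "T \<inter> sphere 0 1"
  have "T \<noteq> {0}" "T \<noteq> {}" using T by auto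
  then obtain z where z: "z \<in> T" "z \<noteq> 0" by blast
  have "sgn z \<in> ?S" using z subspace_mul[OF T(1) z(1)] by (simp add: sgn_div_norm)
  then have ne: "?S \<noteq> {}" by blast
  have comp: "compact ?S" using closed_subspace[OF T(1)] by (intro closed_Int_compact) auto
  have "continuous_on ?S (\<lambda>x. x \<bullet> A x)"
    by (intro continuous_intros linear_continuous_on linear_conv_bounded_linear[THEN iffD1] lin)
  then obtain x where x: "x \<in> ?S" and max: "\<And>y. y \<in> ?S \<Longrightarrow> y \<bullet> A y \<le> x \<bullet> A x"
    using continuous_attains_sup[OF comp ne] by blast
  define l where "l = x \<bullet> A x"
  have xT: "x \<in> T" and x1: "x \<bullet> x = 1" using x by (auto simp: norm_eq_1)
  have le: "y \<bullet> A y \<le> l * (y \<bullet> y)" if y: "y \<in> T" for y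
  proof (cases "y = 0")
    case True then show ?thesis by (simp add: linear_0[OF lin])
  next
    case False
    then have "sgn y \<in> ?S" using subspace_mul[OF T(1) y] by (simp add: sgn_div_norm)
    from max[OF this] have "sgn y \<bullet> A (sgn y) \<le> l" by (simp add: l_def)
    then have "(y \<bullet> A y) / (norm y * norm y) \<le> l" by (simp add: sgn_div_norm linear_scale[OF lin]
        divide_inverse mult_ac)
    then show ?thesis using False by (simp add: divide_le_eq dot_square_norm power2_eq_square)
  qed
  have orth: "y \<bullet> A x = 0" if y: "y \<in> T" "y \<bullet> x = 0" for y
  proof (rule ccontr)
    assume ne: "y \<bullet> A x \<noteq> 0"
    define c where "c = l * (y \<bullet> y) - y \<bullet> A y"
    have c: "2 * t * (y \<bullet> A x) \<le> t\<^sup>2 * c" for t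
    proof -
      have "x + t *\<^sub>R y \<in> T" using xT y T(1) by (intro subspace_add subspace_mul)
      from le[OF this] show ?thesis using sym[OF xT y(1)] x1 y(2)
        by (simp add: linear_add[OF lin] linear_scale[OF lin] inner_add inner_commute c_def l_def
            power2_eq_square algebra_simps)
    qed
    \<comment> \<open>a step small enough for the linear term to dominate the quadratic one\<close>
    define t where "t = (y \<bullet> A x) / (\<bar>c\<bar> + 1)"
    have "t\<^sup>2 * c \<le> t\<^sup>2 * (\<bar>c\<bar> + 1)" by (intro mult_left_mono) auto
    also have "\<dots> = t * (y \<bullet> A x)" by (simp add: t_def power2_eq_square)
    finally have "2 * t * (y \<bullet> A x) \<le> t * (y \<bullet> A x)" using c[of t] by linarith
    moreover have "t * (y \<bullet> A x) > 0" using ne by (simp add: t_def add_nonneg_pos flip: power2_eq_square)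
    ultimately show False by linarith
  qed
  have "A x - l *\<^sub>R x \<in> T" using inv[OF xT] xT T(1) by (intro subspace_diff subspace_mul)
  moreover have ox: "(A x - l *\<^sub>R x) \<bullet> x = 0" using x1 by (simp add: inner_diff l_def inner_commute)
  ultimately have "(A x - l *\<^sub>R x) \<bullet> A x = 0" using orth by blast
  then have "(A x - l *\<^sub>R x) \<bullet> (A x - l *\<^sub>R x) = 0" using ox by (simp add: inner_diff_right)
  then have "A x = l *\<^sub>R x" by simp
  then show ?thesis using that[of x l] x xT by auto
qed

lemma symmetric_eigenbasis:
  fixes A :: "'a::euclidean_space \<Rightarrow> 'a"
  assumes lin: "linear A"
  shows "\<lbrakk>subspace T; \<And>x. x \<in> T \<Longrightarrow> A x \<in> T; \<And>x y. x \<in> T \<Longrightarrow> y \<in> T \<Longrightarrow> A x \<bullet> y = x \<bullet> A y\<rbrakk>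
    \<Longrightarrow> \<exists>B \<kappa>. pairwise orthogonal B \<and> (\<forall>b\<in>B. norm b = 1) \<and> span B = T \<and> (\<forall>b\<in>B. A b = \<kappa> b *\<^sub>R b)"
proof (induction "dim T" arbitrary: T)
  case 0
  then have "T = {0}" using subspace_0 dim_eq_0 by (metis subset_singletonD empty_iff)
  then show ?case by (intro exI[of _ "{}"]) auto
next
  case (Suc d)
  obtain x l where x: "x \<in> T" "norm x = 1" "A x = l *\<^sub>R x"
    using symmetric_eigenvector[OF lin Suc.prems(1) _ Suc.prems(2,3)] Suc.hyps(2) by (metis nat.simps(3))
  have x1: "x \<bullet> x = 1" using x(2) norm_eq_1 by blast
  define T' where "T' = {y\<in>T. orthogonal x y}"
  have sT': "subspace T'" unfolding T'_def using subspace_inter[OF Suc.prems(1)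
      subspace_orthogonal_to_vector[of x]]
    by (simp add: Int_def)
  have span_ins: "span (insert x T') = T"
  proof
    show "span (insert x T') \<subseteq> T" using x(1) Suc.prems(1) by (intro span_minimal) (auto simp: T'_def)
    show "T \<subseteq> span (insert x T')"
    proof
      fix y assume y: "y \<in> T"
      have "y - (y \<bullet> x) *\<^sub>R x \<in> T'" unfolding T'_def orthogonal_def
        using y x(1) x1 Suc.prems(1) by (auto simp: inner_diff inner_commute subspace_diff subspace_mul)
      then have "(y - (y \<bullet> x) *\<^sub>R x) + (y \<bullet> x) *\<^sub>R x \<in> span (insert x T')"
        by (intro span_add span_mul span_base) auto
      then show "y \<in> span (insert x T')" by simp
    qed
  qed
  have spT: "span T' = T'" using sT' span_eq_iff by blast
  have "x \<notin> span T'" unfolding spT using x1 by (simp add: T'_def orthogonal_def)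
  then have "dim T = Suc (dim T')" using dim_insert[of x T'] span_ins by (metis One_nat_def add.commute
      dim_span plus_1_eq_Suc)
  then have "d = dim T'" using Suc.hyps(2) by simp
  moreover have "A y \<in> T'" if "y \<in> T'" for y
    using that Suc.prems(2)[of y] Suc.prems(3)[of x y] x by (auto simp: T'_def orthogonal_def)
  ultimately obtain B \<kappa> where B: "pairwise orthogonal B" "\<forall>b\<in>B. norm b = 1" "span B = T'" "\<forall>b\<in>B. A b = \<kappa> b *\<^sub>R b"
    using Suc.hyps(1)[of T'] sT' Suc.prems(3) unfolding T'_def by (metis (no_types, lifting) mem_Collect_eq)
  have BT: "b \<in> B \<Longrightarrow> orthogonal x b" for b using B(3) span_base unfolding T'_def by blast
  then have xB: "x \<notin> B" using x1 by (auto simp: orthogonal_def)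
  show ?case
  proof (intro exI[of _ "insert x B"] exI[of _ "\<kappa>(x := l)"] conjI)
    show "pairwise orthogonal (insert x B)" using B(1) BT by (auto simp: pairwise_insert orthogonal_commute)
    have "span (insert x B) = span (insert x T')" by (simp only: span_insert B(3) spT)
    then show "span (insert x B) = T" using span_ins by simp
  qed (use x B xB in auto)
qed

text \<open>For a unit vector \<open>\<nu>\<close> this is the trace of L compressed to the hyperplane orthogonal to \<open>\<nu>\<close>.
  Applied to the derivative of a vector field it is the tangential divergence.\<close>
definition tangential_trace :: "real^'n \<Rightarrow> (real^'n \<Rightarrow> real^'n) \<Rightarrow> real"
  where "tangential_trace \<nu> L = (\<Sum>i\<in>UNIV. L (axis i 1) $ i) - L \<nu> \<bullet> \<nu>"

lemma linear_component_expansion: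
  fixes L :: "real^'n \<Rightarrow> real^'m"
  assumes "linear L" shows "L v = (\<Sum>i\<in>UNIV. (v $ i) *\<^sub>R L (axis i 1))"
proof -
  have "(\<Sum>j\<in>UNIV. (v $ j) *\<^sub>R axis j 1) = v" using basis_expansion[of v] by (simp add: scalar_mult_eq_scaleR)
  then show ?thesis using linear_sum[OF assms, of "\<lambda>j. (v $ j) *\<^sub>R axis j 1" UNIV] linear_scale[OF assms] by simp
qed

text \<open>The difference of the two maps has rank one, w \<open>\<mapsto>\<close> (w \<open>\<bullet>\<close> \<open>\<nu>\<close>) q, and its trace q \<open>\<bullet>\<close> \<open>\<nu>\<close> is
  exactly what is subtracted in the definition.\<close>
lemma tangential_trace_cong:
  assumes L: "linear L" "linear L'" and \<nu>: "norm \<nu> = 1" and eq: "\<And>v. v \<bullet> \<nu> = 0 \<Longrightarrow> L v = L' v"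
  shows "tangential_trace \<nu> L = tangential_trace \<nu> L'"
proof -
  have \<nu>1: "\<nu> \<bullet> \<nu> = 1" using \<nu> norm_eq_1 by blast
  have "L w - L' w = (w \<bullet> \<nu>) *\<^sub>R (L \<nu> - L' \<nu>)" for w
  proof -
    have "L (w - (w \<bullet> \<nu>) *\<^sub>R \<nu>) = L' (w - (w \<bullet> \<nu>) *\<^sub>R \<nu>)" by (rule eq) (simp add: inner_diff \<nu>1)
    then show ?thesis by (simp add: linear_diff[OF L(1)] linear_diff[OF L(2)] linear_scale[OF L(1)]
        linear_scale[OF L(2)] algebra_simps)
  qed
  note d = this
  have "(\<Sum>i\<in>UNIV. L (axis i 1) $ i) - (\<Sum>i\<in>UNIV. L' (axis i 1) $ i) = (\<Sum>i\<in>UNIV. (L (axis i 1) - L' (axis i 1))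
      $ i)"
    by (simp add: sum_subtractf)
  also have "\<dots> = (\<Sum>i\<in>UNIV. \<nu> $ i * (L \<nu> - L' \<nu>) $ i)" 
  proof (intro sum.cong refl)
    fix i show "(L (axis i 1) - L' (axis i 1)) $ i = \<nu> $ i * (L \<nu> - L' \<nu>) $ i"
      unfolding d[of "axis i 1"] by (simp add: inner_axis')
  qed
  also have "\<dots> = L \<nu> \<bullet> \<nu> - L' \<nu> \<bullet> \<nu>" by (simp add: inner_vec_def algebra_simps sum_subtractf)
  finally show ?thesis by (simp add: tangential_trace_def)
qed

lemma orthonormal_hyperplane_basis:
  fixes \<nu> :: "real^'n"
  assumes \<nu>: "norm \<nu> = 1" and B: "pairwise orthogonal B" "\<forall>b\<in>B. norm b = 1" "span B = {v. v \<bullet> \<nu> = 0}"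
  shows "finite B" "card B = CARD('n) - 1" "linear L \<Longrightarrow> tangential_trace \<nu> L = (\<Sum>b\<in>B. L b \<bullet> b)"
proof -
  show fin: "finite B" using pairwise_orthogonal_imp_finite[OF B(1)] .
  have "0 \<notin> B" using B(2) by force
  then have ind: "independent B" using pairwise_orthogonal_independent[OF B(1)] by blast
  have "\<nu> \<noteq> 0" using \<nu> by auto
  then have "dim (span B) = CARD('n) - 1" unfolding B(3) using dim_hyperplane[of \<nu>] by (simp add: inner_commute)
  then show "card B = CARD('n) - 1" using dim_eq_card_independent[OF ind] by simp
  assume L: "linear L"
  have \<nu>1: "\<nu> \<bullet> \<nu> = 1" using \<nu> norm_eq_1 by blast
  have B\<nu>: "b \<bullet> \<nu> = 0" if "b \<in> B" for b using B(3) span_base[OF that] by auto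
  then have nB: "\<nu> \<notin> B" using \<nu>1 by force
  let ?B = "insert \<nu> B"
  have po: "pairwise orthogonal ?B" using B(1) B\<nu> by (auto simp: pairwise_insert orthogonal_def inner_commute)
  have sp: "x \<in> span ?B" for x
  proof -
    have "x - (x \<bullet> \<nu>) *\<^sub>R \<nu> \<in> span B" unfolding B(3) by (simp add: inner_diff \<nu>1)
    then have "x - (x \<bullet> \<nu>) *\<^sub>R \<nu> \<in> span ?B" using span_mono[of B ?B] by blast
    from span_add[OF this span_mul[OF span_base[of \<nu>], of _ "x \<bullet> \<nu>"]]
    have "(x - (x \<bullet> \<nu>) *\<^sub>R \<nu>) + (x \<bullet> \<nu>) *\<^sub>R \<nu> \<in> span ?B" by blast
    then show ?thesis by simp
  qed
  have expand: "(\<Sum>b\<in>?B. (x \<bullet> b) *\<^sub>R b) = x" for x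
    by (rule orthonormal_basis_expand[OF po _ sp]) (use B(2) \<nu> fin in auto)
  have "(\<Sum>i\<in>UNIV. L (axis i 1) $ i) = (\<Sum>i\<in>UNIV. L (\<Sum>b\<in>?B. (axis i 1 \<bullet> b) *\<^sub>R b) $ i)" by (simp only: expand)
  also have "\<dots> = (\<Sum>i\<in>UNIV. \<Sum>b\<in>?B. b $ i * L b $ i)"
    by (simp add: linear_sum[OF L] linear_scale[OF L] inner_axis' fin nB linear_add[OF L])
  also have "\<dots> = (\<Sum>b\<in>?B. L b \<bullet> b)" by (subst sum.swap) (simp add: inner_vec_def mult.commute)
  also have "\<dots> = L \<nu> \<bullet> \<nu> + (\<Sum>b\<in>B. L b \<bullet> b)" using fin nB by simp
  finally show "tangential_trace \<nu> L = (\<Sum>b\<in>B. L b \<bullet> b)" by (simp add: tangential_trace_def)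
qed

text \<open>With r = |D\<open>\<rho>\<close>| the gradient is r N, so the Hessian of \<open>\<rho>\<close> is r DN plus a map with values normal
  to the boundary. Hence DN is symmetric on tangent vectors, and it maps into the tangent space since N
  has unit length.\<close>
lemma principal_frame_exists:
  fixes \<Omega> :: "(real^'n) set"
  assumes \<Omega>: "bounded_smooth_domain \<Omega>" and p: "p \<in> frontier \<Omega>"
  obtains B \<kappa> where "principal_frame \<Omega> p B \<kappa>"
proof -
  let ?\<nu> = "outer_unit_normal \<Omega> p"
  obtain V N where V: "open V" "p \<in> V" "\<And>k. Ck_on k N V"
    "\<And>x. x \<in> V \<Longrightarrow> norm (N x) = 1" "\<And>x. x \<in> V \<inter> frontier \<Omega> \<Longrightarrow> outer_unit_normal \<Omega> x = N x"
    and ex: "\<exists>\<rho>. local_defining_function \<Omega> p V \<rho> \<and> (\<forall>x. N x = sgn (grad \<rho> x))"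
    by (rule normal_extension_at[OF \<Omega> p]) blast
  obtain \<rho> where ldf: "local_defining_function \<Omega> p V \<rho>" and N: "\<And>x. N x = sgn (grad \<rho> x)" using ex by blast
  have sm: "smooth_on \<rho> V" and g0: "\<And>x. x \<in> V \<Longrightarrow> grad \<rho> x \<noteq> 0" using local_defining_functionD[OF ldf] by blast+
  have hd\<rho>: "Ck_on k \<rho> V" for k using sm by (simp add: smooth_on_def)
  have hdg: "Ck_on k (grad \<rho>) V" for k by (rule Ck_on_grad[OF V(1) hd\<rho>])
  have \<nu>: "?\<nu> = N p" using V(2,5) p by blast
  define A where "A = frechet_derivative N (at p)"
  define G where "G = frechet_derivative (grad \<rho>) (at p)"
  have dN: "(N has_derivative A) (at p)" unfolding A_def
    using Ck_on_has_derivative[OF V(3)[of "Suc 0"] V(2)] .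
  have dG: "(grad \<rho> has_derivative G) (at p)" unfolding G_def
    using Ck_on_has_derivative[OF hdg[of "Suc 0"] V(2)] .
  have lA: "linear A" using dN has_derivative_linear by blast
  have AN: "A v \<bullet> N p = 0" for v
  proof -
    have "((\<lambda>x. N x \<bullet> N x) has_derivative (\<lambda>v. N p \<bullet> A v + A v \<bullet> N p)) (at p)"
      by (rule has_derivative_inner[OF dN dN])
    moreover have "((\<lambda>x. N x \<bullet> N x) has_derivative (\<lambda>v. 0)) (at p)"
      by (rule has_derivative_transform_within_open[OF has_derivative_const[of 1] V(1,2)])
          (use V(4) in \<open>simp add: norm_eq_1\<close>)
    ultimately have "(\<lambda>v. N p \<bullet> A v + A v \<bullet> N p) = (\<lambda>v. 0)" by (rule has_derivative_unique)
    from fun_cong[OF this, of v] show ?thesis by (simp add: inner_commute)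
  qed
  \<comment> \<open>the norm of the gradient, written as an inner product so that it is visibly differentiable\<close>
  define r where "r = (\<lambda>x. grad \<rho> x \<bullet> N x)"
  have r: "r x = norm (grad \<rho> x)" if "x \<in> V" for x
    using g0[OF that] by (simp add: r_def N sgn_div_norm dot_square_norm power2_eq_square)
  have gr: "grad \<rho> x = r x *\<^sub>R N x" if "x \<in> V" for x
    using g0[OF that] by (simp add: r[OF that] N sgn_div_norm)
  obtain r' where dr: "(r has_derivative r') (at p)"
    using has_derivative_inner[OF dG dN] unfolding r_def by blast
  have "(grad \<rho> has_derivative (\<lambda>v. r p *\<^sub>R A v + r' v *\<^sub>R N p)) (at p)"
    by (rule has_derivative_transform_within_open[OF has_derivative_scaleR[OF dr dN] V(1,2)]) (use gr in auto)
  from fun_cong[OF has_derivative_unique[OF dG this]]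
  have GA: "G v = r p *\<^sub>R A v + r' v *\<^sub>R N p" for v .
  have Gsym: "G v \<bullet> w = G w \<bullet> v" for v w
  proof -
    have fd: "frechet_derivative (\<lambda>y. frechet_derivative \<rho> (at y) w) (at p) v = G v \<bullet> w" for v w
    proof -
      have "((\<lambda>y. grad \<rho> y \<bullet> w) has_derivative (\<lambda>v. G v \<bullet> w)) (at p)"
        by (rule bounded_linear.has_derivative[OF bounded_linear_inner_left dG])
      then have "((\<lambda>y. frechet_derivative \<rho> (at y) w) has_derivative (\<lambda>v. G v \<bullet> w)) (at p)"
        by (rule has_derivative_transform_within_open[OF _ V(1,2)])
          (use frechet_derivative_at[OF smooth_on_has_derivative_grad[OF sm]] in metis)
      then show ?thesis using frechet_derivative_at by metis
    qed
    show ?thesis using mixed_derivatives_commute[OF V(1,2) hd\<rho>, of v w] by (simp add: fd)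
  qed
  have sym: "A x \<bullet> y = x \<bullet> A y" if "x \<bullet> N p = 0" "y \<bullet> N p = 0" for x y
  proof -
    have "r p * (A x \<bullet> y) = r p * (A y \<bullet> x)"
    proof -
      have "G x \<bullet> y = r p * (A x \<bullet> y)" "G y \<bullet> x = r p * (A y \<bullet> x)"
        using that by (simp_all add: GA inner_add_left inner_commute[of "N p"])
      then show ?thesis using Gsym[of x y] by metis
    qed
    moreover have "r p \<noteq> 0" using r[OF V(2)] g0[OF V(2)] by simp
    ultimately show ?thesis by (simp add: inner_commute)
  qed
  have "\<exists>B \<kappa>. pairwise orthogonal B \<and> (\<forall>b\<in>B. norm b = 1) \<and> span B = {v. v \<bullet> N p = 0} \<and> (\<forall>b\<in>B. A b = \<kappa> b *\<^sub>R b)"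
  proof (rule symmetric_eigenbasis[OF lA])
    show "subspace {v. v \<bullet> N p = 0}" using subspace_hyperplane[of "N p"] by (simp add: inner_commute)
  qed (use AN sym in auto)
  moreover have "(outer_unit_normal \<Omega> has_derivative A) (at p within frontier \<Omega>)"
  proof -
    have "(outer_unit_normal \<Omega> has_derivative A) (at p within frontier \<Omega> \<inter> V)"
      by (rule has_derivative_transform[OF _ _ has_derivative_at_withinI[OF dN]]) (use V p in auto)
    moreover have "at p within frontier \<Omega> \<inter> V = at p within frontier \<Omega>"
      by (rule at_within_nhd[OF V(2,1)]) auto
    ultimately show ?thesis by simp
  qed
  ultimately show ?thesis using that unfolding principal_frame_def \<nu> by blast
qed

text \<open>The differential of the normal along the boundary and that of any extension Z agree on tangent
  vectors, so for every principal frame the sum of the curvatures is the trace of DZ over the tangent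
  space.\<close>
lemma mean_curvature_eq:
  fixes \<Omega> :: "(real^'n) set"
  assumes \<Omega>: "bounded_smooth_domain \<Omega>" and p: "p \<in> frontier \<Omega>"
    and Z: "(Z has_derivative L) (at p)" and eq: "\<And>x. x \<in> frontier \<Omega> \<Longrightarrow> Z x = outer_unit_normal \<Omega> x"
  shows "mean_curvature \<Omega> p = tangential_trace (outer_unit_normal \<Omega> p) L / (real CARD('n) - 1)"
proof -
  let ?\<nu> = "outer_unit_normal \<Omega> p"
  have \<nu>: "norm ?\<nu> = 1" by (rule norm_outer_unit_normal[OF \<Omega> p])
  have lL: "linear L" using Z has_derivative_linear by blast
  have key: "(\<Sum>b\<in>B. \<kappa> b) / real (card B) = tangential_trace ?\<nu> L / (real CARD('n) - 1)"
    if pf: "principal_frame \<Omega> p B \<kappa>" for B \<kappa>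
  proof -
    have B: "pairwise orthogonal B" "\<forall>b\<in>B. norm b = 1" "span B = {v. v \<bullet> ?\<nu> = 0}"
      using pf by (auto simp: principal_frame_def)
    obtain L' where L': "(outer_unit_normal \<Omega> has_derivative L') (at p within frontier \<Omega>)" "\<And>b. b \<in> B \<Longrightarrow> L' b =
        \<kappa> b *\<^sub>R b"
      using pf by (auto simp: principal_frame_def)
    note ob = orthonormal_hyperplane_basis[OF \<nu> B]
    have d: "((\<lambda>x. outer_unit_normal \<Omega> x - Z x) has_derivative (\<lambda>v. L' v - L v)) (at p within frontier \<Omega>)"
      by (rule has_derivative_diff[OF L'(1) has_derivative_at_withinI[OF Z]])
    have "L' v - L v = 0" if "v \<bullet> ?\<nu> = 0" for v
      by (rule derivative_along_frontier_zero[OF \<Omega> p d open_UNIV UNIV_I _ that, of 0]) (use eq in auto)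
    moreover have "b \<bullet> ?\<nu> = 0" if "b \<in> B" for b using B(3) span_base[OF that] by auto
    ultimately have "L b = \<kappa> b *\<^sub>R b" if "b \<in> B" for b using L'(2)[OF that] that by force
    then have "(\<Sum>b\<in>B. L b \<bullet> b) = (\<Sum>b\<in>B. \<kappa> b)"
      by (intro sum.cong refl) (use B(2) in \<open>simp add: norm_eq_1\<close>)
    moreover have "real (card B) = real CARD('n) - 1" using ob(2) by (simp add: of_nat_diff Suc_leI)
    ultimately show ?thesis using ob(3)[OF lL] by simp
  qed
  obtain B \<kappa> where "principal_frame \<Omega> p B \<kappa>" by (rule principal_frame_exists[OF \<Omega> p])
  then show ?thesis unfolding mean_curvature_def using key by (intro the_equality) (metis, metis)
qed

text \<open>The field X - (X \<open>\<bullet>\<close> Z) Z vanishes on the boundary, so X has the same tangential divergence as (X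
  \<open>\<bullet>\<close> Z) Z; there the term with the derivative of the coefficient is normal and drops out.\<close>
lemma tangential_trace_normal_field:
  fixes \<Omega> :: "(real^'n) set"
  assumes n: "CARD('n) \<ge> 2" and \<Omega>: "bounded_smooth_domain \<Omega>" and p: "p \<in> frontier \<Omega>"
    and Z: "(Z has_derivative L) (at p)" "\<And>x. x \<in> frontier \<Omega> \<Longrightarrow> Z x = outer_unit_normal \<Omega> x"
    and X: "(X has_derivative M) (at p)" "\<And>x. x \<in> frontier \<Omega> \<Longrightarrow> X x = (X x \<bullet> outer_unit_normal \<Omega> x) *\<^sub>R
        outer_unit_normal \<Omega> x"
  shows "tangential_trace (outer_unit_normal \<Omega> p) M = (X p \<bullet> outer_unit_normal \<Omega> p) *
      ((real CARD('n) - 1) * mean_curvature \<Omega> p)"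
proof -
  let ?\<nu> = "outer_unit_normal \<Omega> p"
  have \<nu>: "norm ?\<nu> = 1" by (rule norm_outer_unit_normal[OF \<Omega> p])
  have \<nu>1: "?\<nu> \<bullet> ?\<nu> = 1" using \<nu> norm_eq_1 by blast
  have Zp: "Z p = ?\<nu>" using Z(2)[OF p] .
  let ?v' = "\<lambda>h. X p \<bullet> L h + M h \<bullet> Z p"
  let ?M' = "\<lambda>h. (X p \<bullet> Z p) *\<^sub>R L h + ?v' h *\<^sub>R Z p"
  have v: "((\<lambda>x. X x \<bullet> Z x) has_derivative ?v') (at p)" by (rule has_derivative_inner[OF X(1) Z(1)])
  have vZ: "((\<lambda>x. (X x \<bullet> Z x) *\<^sub>R Z x) has_derivative ?M') (at p)" by (rule has_derivative_scaleR[OF v Z(1)])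
  have d: "((\<lambda>x. X x - (X x \<bullet> Z x) *\<^sub>R Z x) has_derivative (\<lambda>h. M h - ?M' h)) (at p within frontier \<Omega>)"
    by (rule has_derivative_at_withinI[OF has_derivative_diff[OF X(1) vZ]])
  have lM: "linear M" "linear ?M'" using X(1) vZ has_derivative_linear by blast+
  have z: "X x - (X x \<bullet> Z x) *\<^sub>R Z x = 0" if "x \<in> frontier \<Omega> \<inter> UNIV" for x using X(2)[of x] Z(2)[of x] that by
      simp
  have "M v - ?M' v = 0" if "v \<bullet> ?\<nu> = 0" for v
    by (rule derivative_along_frontier_zero[OF \<Omega> p d open_UNIV UNIV_I z that])
  then have "tangential_trace ?\<nu> M = tangential_trace ?\<nu> ?M'"
    by (intro tangential_trace_cong[OF lM \<nu>]) simp
  also have "\<dots> = (X p \<bullet> ?\<nu>) * tangential_trace ?\<nu> L"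
  proof -
    have lv: "linear ?v'" using v has_derivative_linear by blast
    have "(\<Sum>i\<in>UNIV. ?v' (axis i 1) * ?\<nu> $ i) = ?v' ?\<nu>"
    proof -
      have "?v' ?\<nu> = ?v' (\<Sum>i\<in>UNIV. (?\<nu> $ i) *\<^sub>R axis i 1)"
        using basis_expansion[of ?\<nu>] by (simp add: scalar_mult_eq_scaleR)
      also have "\<dots> = (\<Sum>i\<in>UNIV. ?\<nu> $ i * ?v' (axis i 1))"
        by (simp only: linear_sum[OF lv] linear_scale[OF lv] real_scaleR_def)
      finally show ?thesis by (simp only: mult.commute)
    qed
    then show ?thesis unfolding tangential_trace_def Zp
      by (simp add: sum.distrib sum_distrib_left[symmetric] sum_distrib_right[symmetric] inner_add_left \<nu>1
          algebra_simps)
  qed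
  also have "tangential_trace ?\<nu> L = (real CARD('n) - 1) * mean_curvature \<Omega> p"
    using mean_curvature_eq[OF \<Omega> p Z] n by (simp add: field_simps)
  finally show ?thesis .
qed

lemma continuous_on_mean_curvature:
  fixes \<Omega> :: "(real^'n) set"
  assumes \<Omega>: "bounded_smooth_domain \<Omega>" shows "continuous_on (frontier \<Omega>) (mean_curvature \<Omega>)"
proof -
  obtain Z :: "real^'n \<Rightarrow> real^'n" where Z: "Ck_on 1 Z UNIV" "\<And>x. x \<in> frontier \<Omega> \<Longrightarrow> Z x = outer_unit_normal \<Omega> x"
    by (rule normal_extension[OF \<Omega>, where k=1]) blast
  let ?L = "\<lambda>x. frechet_derivative Z (at x)"
  have dZ: "(Z has_derivative ?L x) (at x)" for x
    using Ck_on_has_derivative[of 0 Z UNIV x] Z(1) by simp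
  have c: "continuous_on UNIV (\<lambda>x. ?L x v)" for v
    using Ck_on_frechet[of 0 Z UNIV v] Z(1) by (simp add: higher_differentiable_on.simps)
  have c': "continuous_on S (\<lambda>x. ?L x v)" for S v using c continuous_on_subset by blast
  have "continuous_on (frontier \<Omega>) (\<lambda>x. ?L x (Z x))"
  proof -
    have "?L x (Z x) = (\<Sum>i\<in>UNIV. (Z x $ i) *\<^sub>R ?L x (axis i 1))" for x
      by (rule linear_component_expansion) (use dZ has_derivative_linear in blast)
    moreover have "continuous_on (frontier \<Omega>) (\<lambda>x. \<Sum>i\<in>UNIV. (Z x $ i) *\<^sub>R ?L x (axis i 1))"
      using continuous_on_subset[OF Ck_on_continuous_on[OF Z(1)]] by (intro continuous_intros c') auto
    ultimately show ?thesis by simp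
  qed
  then have "continuous_on (frontier \<Omega>) (\<lambda>x. ((\<Sum>i\<in>UNIV. ?L x (axis i 1) $ i) - ?L x (Z x) \<bullet> Z x) /
      (real CARD('n) - 1))"
    unfolding divide_inverse
    using continuous_on_subset[OF Ck_on_continuous_on[OF Z(1)]] by (intro continuous_intros c') auto
  then show ?thesis
    by (rule continuous_on_eq) (simp add: mean_curvature_eq[OF \<Omega> _ dZ Z(2)] Z(2) tangential_trace_def)
qed

section \<open>Symmetric functions of the eigenvalues\<close>

text \<open>The matrix z I - A over the polynomials in z.\<close>
definition char_poly_matrix :: "complex^'n^'n \<Rightarrow> complex poly^'n^'n"
  where "char_poly_matrix A = (\<chi> i j. if i = j then [:- A $ i $ j, 1:] else [:- A $ i $ j:])"

lemma poly_det_char_poly_matrix: "poly (det (char_poly_matrix A)) z = det (mat z - A)"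
  unfolding det_def poly_sum poly_mult poly_prod char_poly_matrix_def mat_def
  by (intro sum.cong refl arg_cong2[where f="(*)"] prod.cong) auto

text \<open>Every permutation other than the identity picks a constant entry in some row and so contributes
  lower degree only.\<close>
lemma char_poly_monic:
  fixes A :: "complex^'n^'n"
  shows "degree (det (char_poly_matrix A)) = CARD('n)" "lead_coeff (det (char_poly_matrix A)) = 1"
proof -
  let ?M = "char_poly_matrix A" and ?P = "{p. p permutes (UNIV :: 'n set)}"
  let ?t = "\<lambda>p. of_int (sign p) * (\<Prod>i\<in>UNIV. ?M $ i $ p i)"
  have fin: "finite ?P" by (simp add: finite_permutations)
  have idP: "id \<in> ?P" by (simp add: permutes_id)
  have deq: "det ?M = (\<Sum>p\<in>?P - {id}. ?t p) + ?t id"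
    unfolding det_def by (subst sum.remove[OF fin idP]) (rule add.commute)
  have "degree (?t p) < CARD('n)" if p: "p \<in> ?P - {id}" for p
  proof -
    obtain i where i: "i \<noteq> p i" using p by (force simp: fun_eq_iff)
    have "degree (?t p) \<le> degree (of_int (sign p) :: complex poly) + degree (\<Prod>i\<in>UNIV. ?M $ i $ p i)"
      by (rule degree_mult_le)
    also have "degree (of_int (sign p) :: complex poly) = 0" by (metis degree_of_int)
    also have "degree (\<Prod>i\<in>UNIV. ?M $ i $ p i) \<le> (\<Sum>i\<in>UNIV. degree (?M $ i $ p i))"
      using degree_prod_sum_le[of UNIV "\<lambda>i. ?M $ i $ p i"] by (simp add: comp_def)
    also have "\<dots> < (\<Sum>i\<in>(UNIV :: 'n set). 1)"
      by (rule sum_strict_mono_ex1) (use i in \<open>auto simp: char_poly_matrix_def intro!: exI[of _ i]\<close>)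
    finally show ?thesis by simp
  qed
  then have less: "degree (\<Sum>p\<in>?P - {id}. ?t p) < CARD('n)" by (intro degree_sum_less) auto
  have t: "?t id = (\<Prod>i\<in>UNIV. [:- A $ i $ i, 1:])" by (simp add: char_poly_matrix_def sign_id)
  have d: "degree (?t id) = CARD('n)" unfolding t by (subst degree_prod_eq_sum_degree) auto
  have l: "lead_coeff (?t id) = 1" unfolding t by (simp add: lead_coeff_prod)
  have "degree (det ?M) = degree (?t id)"
    unfolding deq by (rule degree_add_eq_right) (use less d in simp)
  then show "degree (det ?M) = CARD('n)" using d by simp
  have "lead_coeff (det ?M) = lead_coeff (?t id)"
    unfolding deq by (rule lead_coeff_add_le) (use less d in simp)
  then show "lead_coeff (det ?M) = 1" using l by simp
qed

lemma eigenvalue_family_exists: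
  fixes A :: "real^'n^'n" shows "\<exists>lam. eigenvalue_family A lam"
proof -
  let ?A = "\<chi> i j. complex_of_real (A $ i $ j)"
  let ?p = "det (char_poly_matrix ?A)"
  have "?p \<noteq> 0" using char_poly_monic(2)[of ?A] by auto
  then obtain R where R: "size R = degree ?p" "?p = smult (lead_coeff ?p) (\<Prod>x\<in>#R. [:- x, 1:])"
    using alg_closed_imp_factorization by blast
  obtain xs where xs: "mset xs = R" using ex_mset by blast
  have len: "length xs = CARD('n)" using R(1) xs char_poly_monic(1)[of ?A] by (metis size_mset)
  obtain h where h: "bij_betw h (UNIV :: 'n set) {..<length xs}"
    using finite_same_card_bij[OF finite finite_lessThan] len by (metis card_lessThan)
  have "?p = (\<Prod>x\<in>#R. [:- x, 1:])" using R(2) char_poly_monic(2)[of ?A] by simp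
  also have "\<dots> = prod_list (map (\<lambda>x. [:- x, 1:]) xs)"
    unfolding xs[symmetric] by (simp add: prod_mset_prod_list flip: mset_map)
  also have "\<dots> = (\<Prod>k<length xs. [:- (xs ! k), 1:])" by (simp add: prod.list_conv_set_nth lessThan_atLeast0)
  also have "\<dots> = (\<Prod>i\<in>UNIV. [:- (xs ! h i), 1:])" by (rule prod.reindex_bij_betw[OF h, symmetric])
  finally have p: "?p = (\<Prod>i\<in>UNIV. [:- (xs ! h i), 1:])" .
  have "eigenvalue_family A (\<lambda>i. xs ! h i)"
    unfolding eigenvalue_family_def poly_det_char_poly_matrix[symmetric] p by (simp add: poly_prod)
  then show ?thesis by blast
qed

text \<open>The reversed characteristic polynomial: its expansion at t = 0 gives access to the elementary
  symmetric functions.\<close>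
lemma det_reciprocal:
  fixes A :: "complex^'n^'n" and lam :: "'n \<Rightarrow> complex"
  assumes "\<And>z. det (mat z - A) = (\<Prod>i\<in>UNIV. z - lam i)"
  shows "det (mat 1 - (\<chi> i j. t * A $ i $ j)) = (\<Prod>i\<in>UNIV. 1 - t * lam i)"
proof (cases "t = 0")
  case True
  have "mat 1 - (\<chi> i j. t * A $ i $ j) = mat 1" using True by (simp add: vec_eq_iff)
  then show ?thesis using True by simp
next
  case False
  have "det (mat 1 - (\<chi> i j. t * A $ i $ j)) = det (\<chi> i. t *s ((mat (1/t) - A) $ i))"
    by (rule arg_cong[of _ _ det]) (use False in \<open>auto simp: vec_eq_iff mat_def right_diff_distrib\<close>)
  also have "\<dots> = (\<Prod>i\<in>(UNIV::'n set). t) * det (\<chi> i. (mat (1/t) - A) $ i)" by (rule det_rows_mul)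
  also have "(\<chi> i. (mat (1/t) - A) $ i) = mat (1/t) - A" by (simp add: vec_eq_iff)
  also have "det \<dots> = (\<Prod>i\<in>UNIV. 1/t - lam i)" by (rule assms)
  also have "(\<Prod>i\<in>(UNIV::'n set). t) * \<dots> = (\<Prod>i\<in>UNIV. t * (1/t - lam i))" by (simp add: prod.distrib)
  also have "\<dots> = (\<Prod>i\<in>UNIV. 1 - t * lam i)" using False by (simp add: right_diff_distrib)
  finally show ?thesis .
qed

text \<open>Jacobi's formula at the identity. A permutation other than the identity moves at least two
  indices, so its product vanishes to second order at t = 0.\<close>
lemma det_derivative_at_identity:
  fixes B :: "complex^'n^'n"
  shows "((\<lambda>t. det (mat 1 - (\<chi> i j. t * B $ i $ j))) has_field_derivative - (\<Sum>i\<in>UNIV. B $ i $ i)) (at 0)"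
proof -
  let ?P = "{p. p permutes (UNIV :: 'n set)}"
  define m where "m = (\<lambda>i j t. (if i = j then 1 else 0) - t * B $ i $ j)"
  have m: "(m i j has_field_derivative - B $ i $ j) (at 0)" for i j
    unfolding m_def by (auto intro!: derivative_eq_intros)
  define d where "d = (\<lambda>p. of_int (sign p) * (\<Sum>i\<in>UNIV. - B $ i $ p i * (\<Prod>k\<in>UNIV - {i}. m k (p k) 0)))"
  have "((\<lambda>t. \<Sum>p\<in>?P. of_int (sign p) * (\<Prod>i\<in>UNIV. m i (p i) t)) has_field_derivative (\<Sum>p\<in>?P. d p)) (at 0)"
    unfolding d_def by (intro DERIV_sum DERIV_cmult has_field_derivative_prod m)
  moreover have "d p = 0" if p: "p \<in> ?P - {id}" for p
  proof -
    obtain a where a: "p a \<noteq> a" using p by (auto simp: fun_eq_iff)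
    have pa: "p (p a) \<noteq> p a" using a p permutes_inj[of p UNIV] by (auto dest: injD)
    have "(\<Prod>k\<in>UNIV - {i}. m k (p k) 0) = 0" for i
    proof (cases "i = a")
      case True then show ?thesis using pa a by (intro prod_zero bexI[of _ "p a"]) (auto simp: m_def)
    next
      case False then show ?thesis using a by (intro prod_zero bexI[of _ a]) (auto simp: m_def)
    qed
    then show ?thesis by (simp only: d_def mult_zero_right sum.neutral_const)
  qed
  then have "(\<Sum>p\<in>?P. d p) = (\<Sum>p\<in>{id}. d p)"
    by (intro sum.mono_neutral_right) (auto simp: finite_permutations permutes_id)
  moreover have "d id = - (\<Sum>i\<in>UNIV. B $ i $ i)" by (simp add: d_def m_def sign_id sum_negf)
  moreover have "det (mat 1 - (\<chi> i j. t * B $ i $ j)) = (\<Sum>p\<in>?P. of_int (sign p) * (\<Prod>i\<in>UNIV. m i (p i) t))" for t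
    unfolding det_def m_def mat_def by (intro sum.cong refl arg_cong2[where f="(*)"] prod.cong) auto
  ultimately show ?thesis by simp
qed

lemma trace_eq_sum:
  fixes B :: "complex^'n^'n" and \<mu> :: "'n \<Rightarrow> complex"
  assumes "\<And>t. det (mat 1 - (\<chi> i j. t * B $ i $ j)) = (\<Prod>i\<in>UNIV. 1 - t * \<mu> i)"
  shows "(\<Sum>i\<in>UNIV. B $ i $ i) = (\<Sum>i\<in>UNIV. \<mu> i)"
proof -
  have "((\<lambda>t. \<Prod>i\<in>UNIV. 1 - t * \<mu> i) has_field_derivative (\<Sum>i\<in>UNIV. - \<mu> i * (\<Prod>k\<in>UNIV - {i}. 1 - 0 * \<mu> k)))
      (at 0)"
    by (intro has_field_derivative_prod) (auto intro!: derivative_eq_intros)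
  moreover have "((\<lambda>t. \<Prod>i\<in>UNIV. 1 - t * \<mu> i) has_field_derivative - (\<Sum>i\<in>UNIV. B $ i $ i)) (at 0)"
    using det_derivative_at_identity[of B] unfolding assms .
  ultimately have "(\<Sum>i\<in>UNIV. - \<mu> i * (\<Prod>k\<in>UNIV - {i}. 1 - 0 * \<mu> k)) = - (\<Sum>i\<in>UNIV. B $ i $ i)" by
      (rule DERIV_unique)
  then show ?thesis by (simp add: sum_negf)
qed

text \<open>Factor I - t^2 A^2 = (I - t A) (I + t A): the determinant of I - s A^2 is the product of the 1 - s
  \<open>\<lambda>\<close>_i^2, so the trace formula applies to A^2.\<close>
lemma trace_square_eq_sum:
  fixes A :: "complex^'n^'n" and lam :: "'n \<Rightarrow> complex"
  assumes A: "\<And>t. det (mat 1 - (\<chi> i j. t * A $ i $ j)) = (\<Prod>i\<in>UNIV. 1 - t * lam i)"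
  shows "(\<Sum>i\<in>UNIV. (A ** A) $ i $ i) = (\<Sum>i\<in>UNIV. (lam i)\<^sup>2)"
proof (rule trace_eq_sum)
  fix s :: complex
  \<comment> \<open>every complex s is a square\<close>
  define t where "t = csqrt s"
  have s: "s = t\<^sup>2" by (simp add: t_def)
  let ?T = "\<lambda>t. (\<chi> i j. t * A $ i $ j)"
  have "(mat 1 - ?T t) ** (mat 1 - ?T (- t)) = mat 1 - (\<chi> i j. s * (A ** A) $ i $ j)"
  proof (intro vec_eq_iff[THEN iffD2] allI)
    fix i j
    have "((mat 1 - ?T t) ** (mat 1 - ?T (- t))) $ i $ j
      = (\<Sum>k\<in>UNIV. ((if i = k then 1 else 0) - t * A $ i $ k) * ((if k = j then 1 else 0) + t * A $ k $ j))"
      by (simp add: matrix_matrix_mult_def mat_def)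
    also have "\<dots> = (\<Sum>k\<in>UNIV. (if i = k then (if i = j then 1 else 0) + t * A $ i $ j else 0)
        - (if k = j then t * A $ i $ j else 0) - t\<^sup>2 * (A $ i $ k * A $ k $ j))"
      by (intro sum.cong refl) (auto simp: algebra_simps power2_eq_square)
    also have "\<dots> = (if i = j then 1 else 0) - t\<^sup>2 * (\<Sum>k\<in>UNIV. A $ i $ k * A $ k $ j)"
      by (simp add: sum_subtractf sum_distrib_left)
    finally show "((mat 1 - ?T t) ** (mat 1 - ?T (- t))) $ i $ j = (mat 1 - (\<chi> i j. s * (A ** A) $ i $ j)) $ i
        $ j"
      by (simp add: matrix_matrix_mult_def mat_def s)
  qed
  then have "det (mat 1 - (\<chi> i j. s * (A ** A) $ i $ j)) = det (mat 1 - ?T t) * det (mat 1 - ?T (- t))"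
    by (metis det_mul)
  also have "\<dots> = (\<Prod>i\<in>UNIV. (1 - t * lam i) * (1 - (- t) * lam i))" unfolding A by (rule prod.distrib[symmetric])
  also have "\<dots> = (\<Prod>i\<in>UNIV. 1 - s * (lam i)\<^sup>2)"
    by (intro prod.cong refl) (simp add: s algebra_simps power2_eq_square)
  finally show "det (mat 1 - (\<chi> i j. s * (A ** A) $ i $ j)) = (\<Prod>i\<in>UNIV. 1 - s * (lam i)\<^sup>2)" .
qed

text \<open>Newton's identity 2 e_2 = p_1^2 - p_2.\<close>
lemma sum_over_pairs:
  fixes f :: "'a \<Rightarrow> 'b::comm_ring_1"
  shows "finite X \<Longrightarrow> 2 * (\<Sum>I | I \<subseteq> X \<and> card I = 2. \<Prod>i\<in>I. f i) = (\<Sum>x\<in>X. f x)\<^sup>2 - (\<Sum>x\<in>X. (f x)\<^sup>2)"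
proof (induction X rule: finite_induct)
  case empty
  have "{I. I \<subseteq> {} \<and> card I = 2} = ({} :: 'a set set)" by auto
  then show ?case by (simp only: sum.empty) simp
next
  case (insert x X)
  let ?P = "{I. I \<subseteq> X \<and> card I = 2}"
  have eq: "{I. I \<subseteq> insert x X \<and> card I = 2} = ?P \<union> (\<lambda>y. {x, y}) ` X" (is "?L = ?R")
  proof
    show "?L \<subseteq> ?R"
    proof
      fix I assume I: "I \<in> ?L"
      show "I \<in> ?R"
      proof (cases "x \<in> I")
        case False then show ?thesis using I by auto
      next
        case True
        then obtain y where "I = {x, y}" "y \<noteq> x" using I by (auto simp: card_2_iff)
        then show ?thesis using I by auto
      qed
    qed
    show "?R \<subseteq> ?L" using insert.hyps by (auto simp: card_2_iff)
  qed
  have "(\<Sum>I\<in>?L. \<Prod>i\<in>I. f i) = (\<Sum>I\<in>?P. \<Prod>i\<in>I. f i) + (\<Sum>I\<in>(\<lambda>y. {x, y}) ` X. \<Prod>i\<in>I. f i)"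
    unfolding eq by (rule sum.union_disjoint) (use insert.hyps in auto)
  also have "(\<Sum>I\<in>(\<lambda>y. {x, y}) ` X. \<Prod>i\<in>I. f i) = (\<Sum>y\<in>X. f x * f y)"
  proof -
    have "prod f {x, y} = f x * f y" if "y \<in> X" for y using that insert.hyps(2) by (subst prod.insert) auto
    then show ?thesis using insert.hyps by (subst sum.reindex) (auto simp: inj_on_def doubleton_eq_iff)
  qed
  finally show ?case using insert by (simp add: algebra_simps power2_eq_square sum_distrib_left[symmetric]
      sum_distrib_right[symmetric])
qed

text \<open>The chosen family of eigenvalues enters only through its power sums, which are traces.\<close>
lemma S_fun_eq:
  fixes u :: "real^'n \<Rightarrow> real"
  defines "A x \<equiv> shape_operator u x"
  shows "S_fun 1 u x = (\<Sum>i\<in>UNIV. A x $ i $ i)"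
    "2 * S_fun 2 u x = (\<Sum>i\<in>UNIV. A x $ i $ i)\<^sup>2 - (\<Sum>i\<in>UNIV. \<Sum>j\<in>UNIV. A x $ i $ j * A x $ j $ i)"
proof -
  define lam where "lam = (SOME lam. eigenvalue_family (A x) lam)"
  let ?C = "(\<chi> i j. complex_of_real (A x $ i $ j)) :: complex^'n^'n"
  have "eigenvalue_family (A x) lam" unfolding lam_def using eigenvalue_family_exists by (rule someI_ex)
  then have "det (mat z - ?C) = (\<Prod>i\<in>UNIV. z - lam i)" for z by (simp add: eigenvalue_family_def)
  note r = det_reciprocal[OF this]
  have tr: "(\<Sum>i\<in>UNIV. lam i) = complex_of_real (\<Sum>i\<in>UNIV. A x $ i $ i)"
    using trace_eq_sum[OF r] by simp
  have tr2: "(\<Sum>i\<in>UNIV. (lam i)\<^sup>2) = complex_of_real (\<Sum>i\<in>UNIV. \<Sum>j\<in>UNIV. A x $ i $ j * A x $ j $ i)"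
    using trace_square_eq_sum[OF r] by (simp add: matrix_matrix_mult_def)
  have S: "S_fun k u x = Re (esym k lam)" for k by (simp add: S_fun_def lam_def A_def)
  have "{I :: 'n set. card I = 1} = (\<lambda>i. {i}) ` UNIV" by (auto simp: card_1_singleton_iff)
  then have "esym 1 lam = (\<Sum>i\<in>UNIV. lam i)" unfolding esym_def by (simp add: sum.reindex inj_on_def)
  then show "S_fun 1 u x = (\<Sum>i\<in>UNIV. A x $ i $ i)" using S[of 1] tr by simp
  have "2 * esym 2 lam = (\<Sum>i\<in>UNIV. lam i)\<^sup>2 - (\<Sum>i\<in>UNIV. (lam i)\<^sup>2)"
    using sum_over_pairs[of UNIV lam] by (simp add: esym_def)
  then have "2 * esym 2 lam = complex_of_real ((\<Sum>i\<in>UNIV. A x $ i $ i)\<^sup>2 - (\<Sum>i\<in>UNIV. \<Sum>j\<in>UNIV. A x $ i $ j * A x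
      $ j $ i))"
    unfolding tr tr2 by simp
  then have "Re (2 * esym 2 lam) = (\<Sum>i\<in>UNIV. A x $ i $ i)\<^sup>2 - (\<Sum>i\<in>UNIV. \<Sum>j\<in>UNIV. A x $ i $ j * A x $ j $ i)"
    by (simp only: Re_complex_of_real)
  then show "2 * S_fun 2 u x = (\<Sum>i\<in>UNIV. A x $ i $ i)\<^sup>2 - (\<Sum>i\<in>UNIV. \<Sum>j\<in>UNIV. A x $ i $ j * A x $ j $ i)"
    using S[of 2] by simp
qed

text \<open>B = K P with P = a I + b p p^T, for which tr (B^2) = a^2 |K|^2 + 2 a b |K p|^2 + b^2 (p \<open>\<bullet>\<close> K
  p)^2. The matrix B need not be symmetric, so the sign of this trace is not automatic.\<close>
lemma trace_square_symmetric_times_positive: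
  fixes K :: "'n::finite \<Rightarrow> 'n \<Rightarrow> real" and p :: "'n \<Rightarrow> real" and a b :: real
  assumes a: "a > 0" and b: "b \<ge> 0" and sym: "\<And>i j. K i j = K j i"
  defines "q \<equiv> (\<lambda>i. \<Sum>k\<in>UNIV. K i k * p k)"
  defines "B \<equiv> (\<lambda>i j. a * K i j + b * q i * p j)"
  shows "0 \<le> (\<Sum>i\<in>UNIV. \<Sum>j\<in>UNIV. B i j * B j i)"
    "(\<Sum>i\<in>UNIV. \<Sum>j\<in>UNIV. B i j * B j i) = 0 \<Longrightarrow> B i j = 0"
proof -
  have "(\<Sum>i\<in>UNIV. \<Sum>j\<in>UNIV. B i j * B j i) = (\<Sum>i\<in>UNIV. \<Sum>j\<in>UNIV. a\<^sup>2 * (K i j)\<^sup>2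
      + a * b * (q j * (K j i * p i)) + a * b * (q i * (K i j * p j)) + b\<^sup>2 * ((p i * q i) * (p j * q j)))"
    by (intro sum.cong refl) (simp add: B_def sym[of _ "_"] algebra_simps power2_eq_square)
  also have "\<dots> = a\<^sup>2 * (\<Sum>i\<in>UNIV. \<Sum>j\<in>UNIV. (K i j)\<^sup>2) + a * b * (\<Sum>i\<in>UNIV. \<Sum>j\<in>UNIV. q j * (K j i * p i))
      + a * b * (\<Sum>i\<in>UNIV. \<Sum>j\<in>UNIV. q i * (K i j * p j)) + b\<^sup>2 * (\<Sum>i\<in>UNIV. \<Sum>j\<in>UNIV. (p i * q i) * (p j * q j))"
    by (simp only: sum.distrib sum_distrib_left)
  also have "(\<Sum>i\<in>UNIV. \<Sum>j\<in>UNIV. q j * (K j i * p i)) = (\<Sum>i\<in>UNIV. (q i)\<^sup>2)"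
    by (subst sum.swap) (simp add: q_def power2_eq_square sum_distrib_left[symmetric])
  also have "(\<Sum>i\<in>UNIV. \<Sum>j\<in>UNIV. q i * (K i j * p j)) = (\<Sum>i\<in>UNIV. (q i)\<^sup>2)"
    by (simp add: q_def power2_eq_square sum_distrib_left[symmetric])
  also have "(\<Sum>i\<in>UNIV. \<Sum>j\<in>UNIV. (p i * q i) * (p j * q j)) = (\<Sum>i\<in>UNIV. p i * q i)\<^sup>2"
    by (simp add: power2_eq_square sum_product)
  finally have eq: "(\<Sum>i\<in>UNIV. \<Sum>j\<in>UNIV. B i j * B j i) = a\<^sup>2 * (\<Sum>i\<in>UNIV. \<Sum>j\<in>UNIV. (K i j)\<^sup>2)
    + (2 * a * b * (\<Sum>i\<in>UNIV. (q i)\<^sup>2) + b\<^sup>2 * (\<Sum>i\<in>UNIV. p i * q i)\<^sup>2)" by simp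
  have n1: "0 \<le> (\<Sum>i\<in>UNIV. \<Sum>j\<in>UNIV. (K i j)\<^sup>2)" by (intro sum_nonneg) auto
  have n2: "0 \<le> 2 * a * b * (\<Sum>i\<in>UNIV. (q i)\<^sup>2) + b\<^sup>2 * (\<Sum>i\<in>UNIV. p i * q i)\<^sup>2"
    using a b by (intro add_nonneg_nonneg mult_nonneg_nonneg sum_nonneg) auto
  show "0 \<le> (\<Sum>i\<in>UNIV. \<Sum>j\<in>UNIV. B i j * B j i)" unfolding eq
    by (rule add_nonneg_nonneg[OF mult_nonneg_nonneg[OF zero_le_power2 n1] n2])
  assume "(\<Sum>i\<in>UNIV. \<Sum>j\<in>UNIV. B i j * B j i) = 0"
  then have "a\<^sup>2 * (\<Sum>i\<in>UNIV. \<Sum>j\<in>UNIV. (K i j)\<^sup>2) = 0"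
    using eq n2 mult_nonneg_nonneg[OF zero_le_power2[of a] n1] by linarith
  then have "(\<Sum>i\<in>UNIV. \<Sum>j\<in>UNIV. (K i j)\<^sup>2) = 0" using a by simp
  then have "\<forall>i. (\<Sum>j\<in>UNIV. (K i j)\<^sup>2) = 0" by (subst (asm) sum_nonneg_eq_0_iff) (auto intro: sum_nonneg)
  then have "\<forall>i j. K i j = 0" by (simp add: sum_nonneg_eq_0_iff)
  then show "B i j = 0" by (simp add: B_def q_def)
qed

section \<open>A divergence identity and the Minkowski formula\<close>

lemma pderiv_at_diff: "f differentiable (at x) \<Longrightarrow> g differentiable (at x) \<Longrightarrow>
    pderiv_at i (\<lambda>x. f x - g x) x = pderiv_at i f x - pderiv_at i g x"
  by (subst pderiv_at_eq[OF has_derivative_diff]) (auto simp: frechet_derivative_works pderiv_at_def)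

lemma pderiv_at_mult: "f differentiable (at x) \<Longrightarrow> g differentiable (at x) \<Longrightarrow>
    pderiv_at i (\<lambda>x. f x * g x) x = f x * pderiv_at i g x + pderiv_at i f x * g x"
  by (subst pderiv_at_eq[OF has_derivative_mult]) (auto simp: frechet_derivative_works pderiv_at_def)

lemma Ck_on_differentiable:
  "Ck_on (Suc k) f U \<Longrightarrow> x \<in> U \<Longrightarrow> f differentiable (at x)"
  by (simp add: higher_differentiable_on.simps)

lemma frechet_derivative_component:
  fixes Z :: "real^'n \<Rightarrow> real^'m"
  assumes "Z differentiable (at x)"
  shows "frechet_derivative Z (at x) v $ i = (\<Sum>j\<in>UNIV. v $ j * pderiv_at j (\<lambda>y. Z y $ i) x)"
proof -
  have "((\<lambda>y. Z y $ i) has_derivative (\<lambda>v. frechet_derivative Z (at x) v $ i)) (at x)"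
    by (rule bounded_linear.has_derivative[OF bounded_linear_vec_nth]) (use assms frechet_derivative_works in
        blast)
  from has_derivative_pderivs[OF this] show ?thesis .
qed

lemma divergence_eq_trace:
  assumes "Z differentiable (at x)"
  shows "divergence Z x = (\<Sum>i\<in>UNIV. frechet_derivative Z (at x) (axis i 1) $ i)"
  unfolding divergence_def
proof (intro sum.cong refl)
  fix i
  have "((\<lambda>y. Z y $ i) has_derivative (\<lambda>v. frechet_derivative Z (at x) v $ i)) (at x)"
    by (rule bounded_linear.has_derivative[OF bounded_linear_vec_nth]) (use assms frechet_derivative_works in
        blast)
  then show "pderiv_at i (\<lambda>y. Z y $ i) x = frechet_derivative Z (at x) (axis i 1) $ i" by (rule pderiv_at_eq)
qed

lemma Ck_on_divergence:
  "open U \<Longrightarrow> Ck_on (Suc k) Z U \<Longrightarrow> Ck_on k (divergence Z) U"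
  unfolding divergence_def[abs_def]
  by (intro Ck_on_sum Ck_on_pderiv_at Ck_on_vec_nth)

text \<open>The field (div Z) Y - (Y . D) Z.\<close>
definition flux :: "(real^'n \<Rightarrow> real^'n) \<Rightarrow> (real^'n \<Rightarrow> real^'n) \<Rightarrow> real^'n \<Rightarrow> real^'n"
  where "flux Y Z x = divergence Z x *\<^sub>R Y x - (\<chi> i. \<Sum>j\<in>UNIV. Y x $ j * pderiv_at j (\<lambda>y. Z y $ i) x)"

context
  fixes Y Z :: "real^'n \<Rightarrow> real^'n" and U :: "(real^'n) set"
  assumes U: "open U" and Y: "Ck_on 1 Y U" and Z: "Ck_on 2 Z U"
begin

lemma Ck_on_flux: "Ck_on 1 (flux Y Z) U"
proof -
  have Z': "Ck_on (Suc 1) Z U" using Z by (simp add: numeral_2_eq_2)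
  have "Ck_on 1 (\<lambda>x. \<chi> i. \<Sum>j\<in>UNIV. Y x $ j * pderiv_at j (\<lambda>y. Z y $ i) x) U"
    by (intro Ck_on_vec_lambda Ck_on_sum Ck_on_mult
        Ck_on_vec_nth Ck_on_pderiv_at U Y Z')
  then show ?thesis unfolding flux_def[abs_def]
    by (intro Ck_on_diff Ck_on_scaleR Ck_on_divergence U Y Z')
qed

text \<open>The terms with second derivatives of Z are Y \<open>\<bullet>\<close> D(div Z) and its negative, by commutation. For Y
  = Z = X the result is twice the second symmetric function of DX; with Y the position vector and Z an
  extension of the normal it is a multiple of div Z, which leads to the Minkowski formula.\<close>
lemma divergence_flux:
  assumes x: "x \<in> U"
  shows "divergence (flux Y Z) x = divergence Y x * divergence Z x
    - (\<Sum>i\<in>UNIV. \<Sum>j\<in>UNIV. pderiv_at i (\<lambda>y. Y y $ j) x * pderiv_at j (\<lambda>y. Z y $ i) x)"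
proof -
  define D where "D = (\<lambda>i j. pderiv_at i (pderiv_at j (\<lambda>y. Z y $ i)) x)"
  define E where "E = (\<lambda>i j k. pderiv_at i (pderiv_at j (\<lambda>y. Z y $ k)) x)"
  have Z2: "Ck_on 2 (\<lambda>y. Z y $ i) U" for i by (rule Ck_on_vec_nth[OF U Z])
  have dY: "(\<lambda>y. Y y $ i) differentiable (at x)" for i
    using Ck_on_differentiable[of 0 "\<lambda>y. Y y $ i" U x] Ck_on_vec_nth[OF U Y, of i] x by simp
  have pZ: "Ck_on 1 (pderiv_at j (\<lambda>y. Z y $ i)) U" for i j
    using Ck_on_pderiv_at[of 1 "\<lambda>y. Z y $ i" U j] Z2[of i] by (simp add: numeral_2_eq_2)
  have dpZ: "pderiv_at j (\<lambda>y. Z y $ i) differentiable (at x)" for i j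
    using Ck_on_differentiable[of 0 _ U x] pZ[of j i] x by simp
  have ddiv: "divergence Z differentiable (at x)"
    using Ck_on_differentiable[of 0 "divergence Z" U x] Ck_on_divergence[OF U, of 1 Z] Z x
    by (simp add: numeral_2_eq_2)
  have pdiv: "pderiv_at i (divergence Z) x = (\<Sum>j\<in>UNIV. E i j j)" for i
    unfolding divergence_def[abs_def] E_def by (rule pderiv_at_sum) (use dpZ in auto)
  have comp: "pderiv_at i (\<lambda>y. flux Y Z y $ i) x = divergence Z x * pderiv_at i (\<lambda>y. Y y $ i) x +
      (\<Sum>j\<in>UNIV. E i j j) * Y x $ i
     - (\<Sum>j\<in>UNIV. Y x $ j * E i j i + pderiv_at i (\<lambda>y. Y y $ j) x * pderiv_at j (\<lambda>y. Z y $ i) x)" for i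
  proof -
    have s: "pderiv_at i (\<lambda>y. \<Sum>j\<in>UNIV. Y y $ j * pderiv_at j (\<lambda>y. Z y $ i) y) x
       = (\<Sum>j\<in>UNIV. Y x $ j * E i j i + pderiv_at i (\<lambda>y. Y y $ j) x * pderiv_at j (\<lambda>y. Z y $ i) x)"
      by (subst pderiv_at_sum) (auto intro!: sum.cong simp: pderiv_at_mult dY dpZ E_def differentiable_mult)
    have ds: "(\<lambda>y. \<Sum>j\<in>UNIV. Y y $ j * pderiv_at j (\<lambda>y. Z y $ i) y) differentiable (at x)"
      by (intro differentiable_sum ballI differentiable_mult dY dpZ) auto
    have "pderiv_at i (\<lambda>y. flux Y Z y $ i) x = pderiv_at i (\<lambda>y. divergence Z y * Y y $ i -
        (\<Sum>j\<in>UNIV. Y y $ j * pderiv_at j (\<lambda>y. Z y $ i) y)) x"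
      by (simp add: flux_def)
    also have "\<dots> = pderiv_at i (\<lambda>y. divergence Z y * Y y $ i) x - pderiv_at i
        (\<lambda>y. \<Sum>j\<in>UNIV. Y y $ j * pderiv_at j (\<lambda>y. Z y $ i) y) x"
      by (rule pderiv_at_diff[OF differentiable_mult[OF ddiv dY] ds])
    finally show ?thesis by (simp add: s pderiv_at_mult[OF ddiv dY] pdiv)
  qed
  have comm: "E i j k = E j i k" for i j k unfolding E_def by (rule pderiv_at_commute[OF U x Z2])
  have "(\<Sum>i\<in>UNIV. \<Sum>j\<in>UNIV. Y x $ j * E i j i) = (\<Sum>j\<in>UNIV. \<Sum>i\<in>UNIV. Y x $ j * E j i i)"
    by (subst sum.swap) (simp add: comm)
  then have "(\<Sum>i\<in>UNIV. \<Sum>j\<in>UNIV. Y x $ j * E i j i) = (\<Sum>i\<in>UNIV. (\<Sum>j\<in>UNIV. E i j j) * Y x $ i)"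
    by (simp add: sum_distrib_left mult.commute)
  moreover have "divergence (flux Y Z) x = divergence Z x * divergence Y x + (\<Sum>i\<in>UNIV. (\<Sum>j\<in>UNIV. E i j j) * Y
      x $ i)
    - ((\<Sum>i\<in>UNIV. \<Sum>j\<in>UNIV. Y x $ j * E i j i) + (\<Sum>i\<in>UNIV. \<Sum>j\<in>UNIV. pderiv_at i (\<lambda>y. Y y $ j) x * pderiv_at j
        (\<lambda>y. Z y $ i) x))"
    unfolding divergence_def[of "flux Y Z"] comp by (simp add: sum.distrib sum_subtractf sum_distrib_left
        divergence_def[of Y])
  ultimately show ?thesis by (simp add: mult.commute)
qed

lemma flux_normal:
  assumes x: "x \<in> U"
  shows "flux Y Z x \<bullet> \<nu> = divergence Z x * (Y x \<bullet> \<nu>) - frechet_derivative Z (at x) (Y x) \<bullet> \<nu>"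
proof -
  have "Z differentiable (at x)" using Ck_on_differentiable[of 1 Z U x] Z x by (simp add: numeral_2_eq_2)
  then have "(\<chi> i. \<Sum>j\<in>UNIV. Y x $ j * pderiv_at j (\<lambda>y. Z y $ i) x) = frechet_derivative Z (at x) (Y x)"
    by (simp add: vec_eq_iff frechet_derivative_component)
  then show ?thesis by (simp add: flux_def inner_diff_left)
qed

end

lemma divergence_position: "divergence (\<lambda>x. x - a) x = real CARD('n)" for x a :: "real^'n"
proof -
  have "pderiv_at i (\<lambda>y::real^'n. (y - a) $ j) x = (if i = j then 1 else 0)" for i j
  proof -
    have "((\<lambda>y::real^'n. (y - a) $ j) has_derivative (\<lambda>v. v $ j)) (at x)"
      by (auto intro!: derivative_eq_intros bounded_linear.has_derivative[OF bounded_linear_vec_nth])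
    from pderiv_at_eq[OF this, of i] show ?thesis by (auto simp: axis_def)
  qed
  then show ?thesis unfolding divergence_def by simp
qed

lemma Ck_on_position: "open U \<Longrightarrow> Ck_on k (\<lambda>x. x - a) U"
  by (intro Ck_on_diff Ck_on_const Ck_on_linear[OF bounded_linear_ident])

lemma domain_sets: "bounded_smooth_domain \<Omega> \<Longrightarrow> \<Omega> \<in> sets lborel" "bounded_smooth_domain \<Omega> \<Longrightarrow> frontier \<Omega> \<in> sets
    (\<S> \<Omega>)"
  by (simp_all add: bounded_smooth_domainD(1) borel_open borel_closed sets_surface_measure)

lemma domain_finite_measure: "bounded_smooth_domain \<Omega> \<Longrightarrow> emeasure lborel \<Omega> < \<infinity>"
  by (rule emeasure_bounded_finite) (rule bounded_smooth_domainD)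

lemma set_integral_const_domain:
  "bounded_smooth_domain \<Omega> \<Longrightarrow> (LINT x:\<Omega>|lborel. c) = c * measure lborel \<Omega>" for c :: real
  using domain_finite_measure[of \<Omega>] domain_sets(1)[of \<Omega>]
  by (simp add: set_lebesgue_integral_def)

lemma measure_domain_pos:
  assumes "bounded_smooth_domain \<Omega>" shows "measure lborel \<Omega> > 0"
proof -
  obtain p where "p \<in> \<Omega>" using bounded_smooth_domainD(3)[OF assms] by blast
  then obtain a b where ab: "p \<in> box a b" "cbox a b \<subseteq> \<Omega>" using open_contains_cbox bounded_smooth_domainD(1)[OF
      assms] by metis
  have "0 < (\<Prod>i\<in>Basis. (b - a) \<bullet> i)" using ab(1) by (intro prod_pos) (auto simp: mem_box inner_diff intro:
      less_trans)
  then have "0 < measure lborel (box a b)" using ab(1) by (subst measure_lborel_box)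
      (auto simp: mem_box intro: less_imp_le less_trans)
  also have "\<dots> \<le> measure lborel \<Omega>"
    using ab(2) box_subset_cbox[of a b] domain_finite_measure[OF assms] domain_sets(1)[OF assms]
    by (intro measure_mono_fmeasurable) (auto simp: fmeasurable_def)
  finally show ?thesis .
qed

lemma volume_eq_boundary_integral:
  fixes \<Omega> :: "(real^'n) set"
  assumes \<Omega>: "bounded_smooth_domain \<Omega>"
  shows "real CARD('n) * measure lborel \<Omega> = (LINT x:frontier \<Omega>|\<S> \<Omega>. (x - a) \<bullet> outer_unit_normal \<Omega> x)"
proof -
  have "(LINT x:\<Omega>|lborel. divergence (\<lambda>x. x - a) x) = (LINT x:frontier \<Omega>|\<S> \<Omega>. (x - a) \<bullet> outer_unit_normal \<Omega> x)"
    by (rule divergence_theorem[OF \<Omega> open_UNIV subset_UNIV]) (rule Ck_on_position, simp)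
  then show ?thesis by (simp add: divergence_position set_integral_const_domain[OF \<Omega>])
qed

text \<open>The function Z \<open>\<bullet>\<close> Z is constant on the boundary.\<close>
lemma normal_derivative_of_unit_field:
  assumes \<Omega>: "bounded_smooth_domain \<Omega>" and p: "p \<in> frontier \<Omega>"
    and Z: "(Z has_derivative L) (at p)" "\<And>x. x \<in> frontier \<Omega> \<Longrightarrow> Z x = outer_unit_normal \<Omega> x"
    and v: "v \<bullet> outer_unit_normal \<Omega> p = 0"
  shows "L v \<bullet> outer_unit_normal \<Omega> p = 0"
proof -
  have "((\<lambda>x. Z x \<bullet> Z x) has_derivative (\<lambda>v. Z p \<bullet> L v + L v \<bullet> Z p)) (at p within frontier \<Omega>)"
    by (rule has_derivative_at_withinI[OF has_derivative_inner[OF Z(1) Z(1)]])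
  from derivative_along_frontier_zero[OF \<Omega> p this open_UNIV UNIV_I _ v, of 1]
  have "Z p \<bullet> L v + L v \<bullet> Z p = 0"
    using Z(2) norm_outer_unit_normal[OF \<Omega>] by (auto simp: norm_eq_1)
  then show ?thesis using Z(2)[OF p] by (simp add: inner_commute)
qed

text \<open>Apply the divergence theorem to the flux of the position vector and an extension Z of the normal.
  Its divergence is (n-1) div Z, with total integral n-1 times the area. On the boundary the tangential
  part of x drops out of \<open>\<nu>\<close> \<open>\<bullet>\<close> DZ x, and what remains of the normal component is (x \<open>\<bullet>\<close> \<open>\<nu>\<close>) times the
  tangential divergence of Z.\<close>
lemma Minkowski_formula:
  fixes \<Omega> :: "(real^'n) set"
  assumes n: "CARD('n) \<ge> 2" and \<Omega>: "bounded_smooth_domain \<Omega>"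
  shows "(LINT x:frontier \<Omega>|\<S> \<Omega>. mean_curvature \<Omega> x * (x \<bullet> outer_unit_normal \<Omega> x)) = (LINT x:frontier \<Omega>|\<S> \<Omega>. 1)"
proof -
  obtain Z :: "real^'n \<Rightarrow> real^'n" where Z: "Ck_on 2 Z UNIV" "\<And>x. x \<in> frontier \<Omega> \<Longrightarrow> Z x = outer_unit_normal \<Omega> x"
    by (rule normal_extension[OF \<Omega>, where k=2]) blast
  let ?Y = "\<lambda>x::real^'n. x - 0" and ?n = "real CARD('n) - 1"
  have Y: "Ck_on 1 ?Y UNIV" by (rule Ck_on_position) simp
  have Z1: "Ck_on 1 Z UNIV" using Ck_on_le[OF Z(1)] by simp
  have dZ: "Z differentiable (at x)" for x
    using Ck_on_differentiable[of 0 Z UNIV x] Z1 by simp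
  have ZL: "(Z has_derivative frechet_derivative Z (at x)) (at x)" for x using dZ frechet_derivative_works by
      blast
  have div: "divergence (flux ?Y Z) x = ?n * divergence Z x" for x
  proof -
    have pY: "pderiv_at i (\<lambda>y::real^'n. (y - 0) $ j) x = (if i = j then 1 else 0)" for i j
    proof -
      have "((\<lambda>y::real^'n. (y - 0) $ j) has_derivative (\<lambda>v. v $ j)) (at x)"
        by (auto intro!: derivative_eq_intros bounded_linear.has_derivative[OF bounded_linear_vec_nth])
      from pderiv_at_eq[OF this, of i] show ?thesis by (auto simp: axis_def)
    qed
    have "(\<Sum>i\<in>UNIV. \<Sum>j\<in>UNIV. pderiv_at i (\<lambda>y. ?Y y $ j) x * pderiv_at j (\<lambda>y. Z y $ i) x) = divergence Z x"
      unfolding pY by (simp add: divergence_def if_distrib[of "\<lambda>c. c * _"] cong: if_cong)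
    then show ?thesis
      using divergence_flux[OF open_UNIV Y Z(1) UNIV_I, of x] by
          (simp add: divergence_position[of 0, simplified] algebra_simps)
  qed
  have bd: "flux ?Y Z x \<bullet> outer_unit_normal \<Omega> x = ?n * (mean_curvature \<Omega> x * (x \<bullet> outer_unit_normal \<Omega> x))" if
      x: "x \<in> frontier \<Omega>" for x
  proof -
    let ?\<nu> = "outer_unit_normal \<Omega> x" and ?L = "frechet_derivative Z (at x)"
    have lin: "linear ?L" using ZL has_derivative_linear by blast
    have \<nu>1: "?\<nu> \<bullet> ?\<nu> = 1" using norm_outer_unit_normal[OF \<Omega> x] by (simp add: norm_eq_1)
    have "?L (x - (x \<bullet> ?\<nu>) *\<^sub>R ?\<nu>) \<bullet> ?\<nu> = 0"
      by (rule normal_derivative_of_unit_field[OF \<Omega> x ZL Z(2)]) (simp_all add: inner_diff_left \<nu>1)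
    then have "?L x \<bullet> ?\<nu> = (x \<bullet> ?\<nu>) * (?L ?\<nu> \<bullet> ?\<nu>)"
      by (simp add: linear_diff[OF lin] linear_scale[OF lin] inner_diff_left)
    then have "flux ?Y Z x \<bullet> ?\<nu> = (x \<bullet> ?\<nu>) * tangential_trace ?\<nu> ?L"
      using flux_normal[OF open_UNIV Y Z(1) UNIV_I, of x ?\<nu>] divergence_eq_trace[OF dZ, of x]
      by (simp add: tangential_trace_def algebra_simps)
    also have "tangential_trace ?\<nu> ?L = ?n * mean_curvature \<Omega> x"
      using mean_curvature_eq[OF \<Omega> x ZL Z(2)] n by simp
    finally show ?thesis by simp
  qed
  have "?n * (LINT x:frontier \<Omega>|\<S> \<Omega>. mean_curvature \<Omega> x * (x \<bullet> outer_unit_normal \<Omega> x))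
      = (LINT x:frontier \<Omega>|\<S> \<Omega>. flux ?Y Z x \<bullet> outer_unit_normal \<Omega> x)"
    unfolding set_integral_mult_right[symmetric]
    by (rule set_lebesgue_integral_cong) (use domain_sets(2)[OF \<Omega>] bd in auto)
  also have "\<dots> = (LINT x:\<Omega>|lborel. divergence (flux ?Y Z) x)"
    by (rule divergence_theorem[OF \<Omega> open_UNIV subset_UNIV Ck_on_flux[OF open_UNIV Y Z(1)], symmetric])
  also have "\<dots> = ?n * (LINT x:\<Omega>|lborel. divergence Z x)" by (simp only: div set_integral_mult_right)
  also have "(LINT x:\<Omega>|lborel. divergence Z x) = (LINT x:frontier \<Omega>|\<S> \<Omega>. Z x \<bullet> outer_unit_normal \<Omega> x)"
    by (rule divergence_theorem[OF \<Omega> open_UNIV subset_UNIV Z1])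
  also have "\<dots> = (LINT x:frontier \<Omega>|\<S> \<Omega>. 1)"
    by (rule set_lebesgue_integral_cong)
      (use domain_sets(2)[OF \<Omega>] Z(2) norm_outer_unit_normal[OF \<Omega>] in \<open>auto simp: norm_eq_1\<close>)
  finally show ?thesis using n by simp
qed

text \<open>The complement of the closed ball is connected and misses the boundary, so it lies inside or
  outside \<open>\<Omega>\<close>; being unbounded it lies outside. The open ball is connected and misses the boundary as
  well, and it meets \<open>\<Omega>\<close>.\<close>
section \<open>Balls\<close>

lemma domain_with_frontier_in_sphere:
  fixes \<Omega> :: "'a::euclidean_space set"
  assumes D: "DIM('a) \<ge> 2" and \<Omega>: "open \<Omega>" "\<Omega> \<noteq> {}" "bounded \<Omega>" and fr: "frontier \<Omega> \<subseteq> sphere a r"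
  shows "r > 0 \<and> \<Omega> = ball a r"
proof -
  have disj: "\<Omega> \<inter> frontier \<Omega> = {}" using \<Omega>(1) by (auto simp: frontier_def interior_open)
  have sub: "\<Omega> \<subseteq> cball a r"
  proof (rule ccontr)
    assume "\<not> \<Omega> \<subseteq> cball a r"
    then have ne: "- cball a r \<inter> \<Omega> \<noteq> {}" by blast
    have "connected (- cball a r)" by (rule connected_complement_bounded_convex) (use D in auto)
    moreover have "- cball a r \<inter> frontier \<Omega> = {}" using fr by auto
    ultimately have "- cball a r - \<Omega> = {}" using connected_Int_frontier[OF _ ne] by blast
    then have "UNIV = \<Omega> \<union> cball a r" by blast
    then have "bounded (UNIV :: 'a set)" using \<Omega>(3) by (metis bounded_Un bounded_cball)
    then show False by simp
  qed
  have "\<Omega> \<subseteq> interior (cball a r)" by (rule interior_maximal[OF sub \<Omega>(1)])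
  then have sub': "\<Omega> \<subseteq> ball a r" by (simp add: interior_cball)
  then have ne: "ball a r \<inter> \<Omega> \<noteq> {}" using \<Omega>(2) by blast
  have "ball a r \<inter> frontier \<Omega> = {}" using fr by auto
  then have "ball a r - \<Omega> = {}" using connected_Int_frontier[OF connected_ball ne] by blast
  moreover have "r > 0" using ne by (metis ball_empty inf_bot_left linorder_not_le)
  ultimately show ?thesis using sub' by blast
qed

lemma ball_normal_and_curvature:
  fixes \<Omega> :: "(real^'n) set"
  assumes n: "CARD('n) \<ge> 2" and \<Omega>: "bounded_smooth_domain \<Omega>" and ball: "\<Omega> = ball a r" and r: "r > 0" and x:
      "x \<in> frontier \<Omega>"
  shows "outer_unit_normal \<Omega> x = (x - a) /\<^sub>R r" "mean_curvature \<Omega> x = 1 / r"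
proof -
  have fr: "frontier \<Omega> = sphere a r" unfolding ball using r by (simp add: frontier_ball)
  define \<rho> where "\<rho> = (\<lambda>x. (x - a) \<bullet> (x - a) - r\<^sup>2)"
  have g: "grad \<rho> x = 2 *\<^sub>R (x - a)" for x
  proof -
    have "(\<rho> has_derivative (\<lambda>v. 2 * ((x - a) \<bullet> v))) (at x)"
      unfolding \<rho>_def by (auto intro!: derivative_eq_intros simp: inner_commute)
    from pderiv_at_eq[OF this] show ?thesis by (simp add: grad_def vec_eq_iff inner_axis)
  qed
  have normal: "outer_unit_normal \<Omega> x = (x - a) /\<^sub>R r" if x: "x \<in> frontier \<Omega>" for x
  proof -
    have nx: "norm (x - a) = r" using x fr by (simp add: dist_norm norm_minus_commute)
    have "local_defining_function \<Omega> x (- {a}) \<rho>"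
      unfolding local_defining_function_def
    proof (intro conjI ballI)
      show "smooth_on \<rho> (- {a})" unfolding smooth_on_def \<rho>_def
        by (intro allI Ck_on_diff Ck_on_inner Ck_on_position
            Ck_on_const open_Compl closed_singleton)
      show "\<Omega> \<inter> - {a} = {x \<in> - {a}. \<rho> x < 0}"
        unfolding ball \<rho>_def using r
        by (auto simp: dist_norm norm_minus_commute power2_norm_eq_inner[symmetric] abs_square_less_1
            power2_less_imp_less intro: power_strict_mono)
    qed (use nx r g in \<open>auto intro: open_Compl\<close>)
    then have "outer_unit_normal \<Omega> x = sgn (grad \<rho> x)" by
        (rule outer_unit_normal_eq[OF _ bounded_smooth_domainD(1)[OF \<Omega>] x])
    then show ?thesis using nx r by (simp add: g sgn_scaleR sgn_div_norm)
  qed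
  show nx: "outer_unit_normal \<Omega> x = (x - a) /\<^sub>R r" by (rule normal[OF x])
  have d: "((\<lambda>x. (x - a) /\<^sub>R r) has_derivative (\<lambda>v. v /\<^sub>R r)) (at x)" by (auto intro!: derivative_eq_intros)
  have "norm (outer_unit_normal \<Omega> x) = 1" by (rule norm_outer_unit_normal[OF \<Omega> x])
  then have "tangential_trace (outer_unit_normal \<Omega> x) (\<lambda>v. v /\<^sub>R r) = (real CARD('n) - 1) / r"
    unfolding tangential_trace_def by (simp add: norm_eq_1 axis_def divide_inverse algebra_simps)
  then show "mean_curvature \<Omega> x = 1 / r"
    using mean_curvature_eq[OF \<Omega> x d] normal n r by simp
qed

lemma ball_equality:
  fixes \<Omega> :: "(real^'n) set"
  assumes n: "CARD('n) \<ge> 2" and \<Omega>: "bounded_smooth_domain \<Omega>" and ball: "\<Omega> = ball a r" and r: "r > 0"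
  shows "(LINT x:frontier \<Omega>|\<S> \<Omega>. 1 / mean_curvature \<Omega> x) = real CARD('n) * measure lborel \<Omega>"
proof -
  have "(LINT x:frontier \<Omega>|\<S> \<Omega>. 1 / mean_curvature \<Omega> x) = (LINT x:frontier \<Omega>|\<S> \<Omega>. (x - a) \<bullet> outer_unit_normal
      \<Omega> x)"
  proof (rule set_lebesgue_integral_cong[OF domain_sets(2)[OF \<Omega>]], intro allI impI)
    fix x assume x: "x \<in> frontier \<Omega>"
    have "x - a = r *\<^sub>R outer_unit_normal \<Omega> x" using ball_normal_and_curvature(1)[OF n \<Omega> ball r x] r by simp
    then have "(x - a) \<bullet> outer_unit_normal \<Omega> x = r"
      using norm_outer_unit_normal[OF \<Omega> x] by (metis inner_scaleR_left mult.right_neutral norm_eq_1)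
    then show "1 / mean_curvature \<Omega> x = (x - a) \<bullet> outer_unit_normal \<Omega> x"
      using ball_normal_and_curvature(2)[OF n \<Omega> ball r x] r by simp
  qed
  then show ?thesis using volume_eq_boundary_integral[OF \<Omega>, of a] by simp
qed

section \<open>Space-like graphs of constant mean curvature\<close>

text \<open>The hypotheses of the theorem.\<close>
locale spacelike_cmc_graph =
  fixes \<Omega> :: "(real^'n) set" and c :: real and u :: "real^'n \<Rightarrow> real"
  assumes n: "CARD('n) \<ge> 2"
    and \<Omega>: "bounded_smooth_domain \<Omega>"
    and u: "smooth_up_to_boundary u \<Omega>"
    and spacelike: "\<forall>x\<in>closure \<Omega>. norm (grad u x) < 1"
    and pde: "\<forall>x\<in>\<Omega>. divergence (\<lambda>y. grad u y /\<^sub>R w_fun u y) x = real CARD('n)"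
    and bc: "\<forall>x\<in>frontier \<Omega>. u x = c"
begin

lemma neighbourhood_exists: "\<exists>U. open U \<and> closure \<Omega> \<subseteq> U \<and> (\<forall>k. Ck_on k u U) \<and> (\<forall>x\<in>U. norm (grad u x) < 1)"
proof -
  obtain U0 where U0: "open U0" "closure \<Omega> \<subseteq> U0" "\<And>k. Ck_on k u U0"
    using u unfolding smooth_up_to_boundary_def smooth_on_def by blast
  have "continuous_on U0 (\<lambda>x. norm (grad u x))"
    using Ck_on_continuous_on[OF Ck_on_grad[OF U0(1) U0(3)[of "Suc 0"]]]
    by (intro continuous_intros)
  from continuous_open_preimage[OF this U0(1) open_lessThan[of 1]]
  have "open (U0 \<inter> (\<lambda>x. norm (grad u x)) -` {..<1})" .
  moreover have "closure \<Omega> \<subseteq> U0 \<inter> (\<lambda>x. norm (grad u x)) -` {..<1}" using U0(2) spacelike by auto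
  ultimately show ?thesis using U0(3) Ck_on_mono
    by (intro exI[of _ "U0 \<inter> (\<lambda>x. norm (grad u x)) -` {..<1}"]) blast
qed

text \<open>An open set containing the closure of \<open>\<Omega>\<close> on which u is smooth and still space-like. The equation
  holds in \<open>\<Omega>\<close> only, so facts on U concern the derivatives of u alone.\<close>
definition "U = (SOME U. open U \<and> closure \<Omega> \<subseteq> U \<and> (\<forall>k. Ck_on k u U) \<and> (\<forall>x\<in>U. norm (grad u x) < 1))"

lemma U_neighbourhood: "open U" "closure \<Omega> \<subseteq> U" "Ck_on k u U" "x \<in> U \<Longrightarrow> norm (grad u x) < 1"
  using someI_ex[OF neighbourhood_exists] unfolding U_def by blast+

lemma in_U: "x \<in> \<Omega> \<Longrightarrow> x \<in> U" "x \<in> frontier \<Omega> \<Longrightarrow> x \<in> U"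
  using U_neighbourhood(2) closure_subset frontier_subset_closure by blast+

abbreviation "w \<equiv> w_fun u"

lemma w_pos: "x \<in> U \<Longrightarrow> w x > 0" and w_sq: "x \<in> U \<Longrightarrow> (w x)\<^sup>2 = 1 - grad u x \<bullet> grad u x"
proof -
  assume x: "x \<in> U"
  have "(norm (grad u x))\<^sup>2 < 1" using U_neighbourhood(4)[OF x] by (simp add: abs_square_less_1)
  then show "w x > 0" "(w x)\<^sup>2 = 1 - grad u x \<bullet> grad u x" by (simp_all add: w_fun_def dot_square_norm)
qed

lemma grad_Ck_on: "Ck_on k (grad u) U"
  by (rule Ck_on_grad[OF U_neighbourhood(1) U_neighbourhood(3)])

lemma w_Ck_on: "Ck_on k w U"
proof -
  have "Ck_on k (\<lambda>x. sqrt (1 - grad u x \<bullet> grad u x)) U"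
  proof (rule Ck_on_sqrt[OF U_neighbourhood(1)])
    show "Ck_on k (\<lambda>x. 1 - grad u x \<bullet> grad u x) U"
      by (intro Ck_on_diff Ck_on_inner Ck_on_const grad_Ck_on U_neighbourhood(1))
    show "1 - grad u x \<bullet> grad u x > 0" if "x \<in> U" for x using w_sq[OF that] w_pos[OF that] by
        (metis zero_less_power)
  qed
  then show ?thesis by (simp add: w_fun_def[abs_def] dot_square_norm)
qed

definition X where "X x = grad u x /\<^sub>R w x"

lemma X_Ck_on: "Ck_on k X U"
  unfolding X_def[abs_def]
  by (intro Ck_on_scaleR Ck_on_inverse U_neighbourhood(1) w_Ck_on grad_Ck_on) (use w_pos in force)

lemma X_has_derivative: "x \<in> U \<Longrightarrow> (X has_derivative frechet_derivative X (at x)) (at x)"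
  using Ck_on_has_derivative[OF X_Ck_on[of "Suc 0"]] .

lemma shape_operator_eq: "shape_operator u x $ i $ j = pderiv_at i (\<lambda>y. X y $ j) x"
  by (simp add: shape_operator_def X_def grad_def divide_inverse mult.commute)

abbreviation "A x i j \<equiv> shape_operator u x $ i $ j"

lemma trace_shape_operator: "(\<Sum>i\<in>UNIV. A x i i) = divergence X x"
  unfolding shape_operator_eq divergence_def ..

lemma divergence_X: "x \<in> \<Omega> \<Longrightarrow> divergence X x = real CARD('n)"
  using pde unfolding X_def[abs_def] by blast

text \<open>In matrix form A = (D^2 u) P with P = (1/w) (I + Du Du^T / w^2), since the derivative of 1/w is
  (D^2 u) Du / w^3.\<close>
lemma shape_operator_entry:
  assumes x: "x \<in> U"
  shows "A x i j = pderiv_at i (pderiv_at j u) x / w x +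
    (\<Sum>k\<in>UNIV. pderiv_at i (pderiv_at k u) x * grad u x $ k) * grad u x $ j / w x ^ 3"
proof -
  let ?H = "\<lambda>i k. pderiv_at i (pderiv_at k u) x"
  have dk: "pderiv_at k u differentiable (at x)" for k
    using Ck_on_differentiable[of 0 "pderiv_at k u" U x] Ck_on_pderiv_at[OF U_neighbourhood(3)] x by simp
  have wp: "w x > 0" using w_pos[OF x] .
  \<comment> \<open>|Du|^2, with 1/w a function of it\<close>
  define g where "g = (\<lambda>y. \<Sum>k\<in>UNIV. pderiv_at k u y * pderiv_at k u y)"
  have w: "w y = sqrt (1 - g y)" for y
    unfolding w_fun_def g_def by (simp add: grad_def inner_vec_def flip: dot_square_norm)
  have gx: "1 - g x = (w x)\<^sup>2" using w_sq[OF x] by (simp add: g_def grad_def inner_vec_def)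
  have g1: "1 - g x > 0" unfolding gx using wp by simp
  have dg: "g differentiable (at x)" unfolding g_def by (intro differentiable_sum ballI differentiable_mult
      dk) auto
  have pg: "pderiv_at i g x = 2 * (\<Sum>k\<in>UNIV. ?H i k * grad u x $ k)"
    unfolding g_def by (subst pderiv_at_sum) (auto simp: pderiv_at_mult dk differentiable_mult
        sum_distrib_left grad_def intro!: sum.cong)
  have "((\<lambda>t. inverse (sqrt (1 - t))) has_real_derivative 1 / (2 * w x ^ 3)) (at (g x))"
    using g1 wp unfolding w by (auto intro!: derivative_eq_intros simp: field_simps power2_eq_square
        power3_eq_cube)
  then have "((\<lambda>t. inverse (sqrt (1 - t))) has_derivative (\<lambda>s. 1 / (2 * w x ^ 3) * s)) (at (g x))"
    by (simp only: has_field_derivative_def)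
  from has_derivative_compose[OF frechet_derivative_works[THEN iffD1, OF dg] this]
  have dw: "((\<lambda>y. inverse (w y)) has_derivative (\<lambda>v. 1 / (2 * w x ^ 3) * frechet_derivative g (at x) v)) (at x)"
    unfolding w .
  have pw: "pderiv_at i (\<lambda>y. inverse (w y)) x = (\<Sum>k\<in>UNIV. ?H i k * grad u x $ k) / w x ^ 3"
    unfolding pderiv_at_eq[OF dw] using pg by (simp add: pderiv_at_def)
  have "A x i j = pderiv_at i (\<lambda>y. pderiv_at j u y * inverse (w y)) x"
    by (simp add: shape_operator_def divide_inverse)
  also have "\<dots> = pderiv_at j u x * pderiv_at i (\<lambda>y. inverse (w y)) x + ?H i j * inverse (w x)"
    by (rule pderiv_at_mult[OF dk differentiableI[OF dw]])
  finally show ?thesis unfolding pw by (simp add: grad_def divide_inverse mult_ac)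
qed

text \<open>As 1 - |Du|^2 = w^2, the inverse of P is w (I - Du Du^T), so A - I = K P with the symmetric matrix
  K = D^2 u - w (I - Du Du^T). Moreover tr ((A - I)^2) = tr (A^2) - n because tr A = n.\<close>
lemma shape_operator_trace_square:
  assumes x: "x \<in> \<Omega>"
  shows "(\<Sum>i\<in>UNIV. \<Sum>j\<in>UNIV. A x i j * A x j i) \<ge> real CARD('n)"
    "(\<Sum>i\<in>UNIV. \<Sum>j\<in>UNIV. A x i j * A x j i) = real CARD('n) \<Longrightarrow> A x i j = (if i = j then 1 else 0)"
proof -
  have xU: "x \<in> U" using in_U x by blast
  let ?p = "\<lambda>k. grad u x $ k"
  define \<delta> :: "'n \<Rightarrow> 'n \<Rightarrow> real" where "\<delta> = (\<lambda>i j. if i = j then 1 else 0)"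
  define K where "K = (\<lambda>i j. pderiv_at i (pderiv_at j u) x - w x * (\<delta> i j - ?p i * ?p j))"
  have wp: "w x > 0" using w_pos[OF xU] .
  have sym: "K i j = K j i" for i j
    unfolding K_def \<delta>_def using pderiv_at_commute[OF U_neighbourhood(1) xU U_neighbourhood(3), of i j] by
        (simp add: mult.commute)
  have pp: "(\<Sum>k\<in>UNIV. ?p k * ?p k) = 1 - (w x)\<^sup>2" using w_sq[OF xU] by (simp add: inner_vec_def)
  have Kp: "(\<Sum>k\<in>UNIV. K i k * ?p k) = (\<Sum>k\<in>UNIV. pderiv_at i (pderiv_at k u) x * ?p k) - w x ^ 3 * ?p i" for i
  proof -
    have "K i k * ?p k = pderiv_at i (pderiv_at k u) x * ?p k - w x * (if k = i then ?p i else 0) + w x * ?p i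
        * (?p k * ?p k)" for k
      by (simp add: K_def \<delta>_def algebra_simps)
    then have "(\<Sum>k\<in>UNIV. K i k * ?p k) = (\<Sum>k\<in>UNIV. pderiv_at i (pderiv_at k u) x * ?p k) - w x * ?p i + w x *
        ?p i * (1 - (w x)\<^sup>2)"
      by (simp add: sum.distrib sum_subtractf sum_distrib_left[symmetric] pp)
    then show ?thesis by (simp add: algebra_simps power2_eq_square power3_eq_cube)
  qed
  have B: "1 / w x * K i j + 1 / w x ^ 3 * (\<Sum>k\<in>UNIV. K i k * ?p k) * ?p j = A x i j - \<delta> i j" for i j
    unfolding Kp unfolding shape_operator_entry[OF xU] unfolding K_def using wp by (simp add: field_simps)
  have tr: "(\<Sum>i\<in>UNIV. A x i i) = real CARD('n)" using trace_shape_operator divergence_X[OF x] by simp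
  have "(\<Sum>i\<in>UNIV. \<Sum>j\<in>UNIV. (A x i j - \<delta> i j) * (A x j i - \<delta> j i))
      = (\<Sum>i\<in>UNIV. \<Sum>j\<in>UNIV. A x i j * A x j i - (if j = i then 2 * A x i i - 1 else 0))"
    by (intro sum.cong refl) (auto simp: \<delta>_def algebra_simps)
  also have "\<dots> = (\<Sum>i\<in>UNIV. \<Sum>j\<in>UNIV. A x i j * A x j i) - (2 * (\<Sum>i\<in>UNIV. A x i i) - real CARD('n))"
    by (simp add: sum_subtractf sum_distrib_left)
  finally have eq: "(\<Sum>i\<in>UNIV. \<Sum>j\<in>UNIV. (A x i j - \<delta> i j) * (A x j i - \<delta> j i))
     = (\<Sum>i\<in>UNIV. \<Sum>j\<in>UNIV. A x i j * A x j i) - real CARD('n)" by (simp add: tr)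
  have ab: "1 / w x > 0" "1 / w x ^ 3 \<ge> 0" using wp by simp_all
  note T = trace_square_symmetric_times_positive[where K=K and p="?p" and a="1 / w x" and b="1 / w x ^ 3", OF
      ab sym, unfolded B eq]
  show "(\<Sum>i\<in>UNIV. \<Sum>j\<in>UNIV. A x i j * A x j i) \<ge> real CARD('n)" using T(1) by simp
  show "(\<Sum>i\<in>UNIV. \<Sum>j\<in>UNIV. A x i j * A x j i) = real CARD('n) \<Longrightarrow> A x i j = (if i = j then 1 else 0)"
    using T(2)[of i j] by (simp add: \<delta>_def)
qed

text \<open>At an interior maximum Du = 0 and w = 1, so A is the Hessian of u, whose trace would be n > 0; but
  then u increases along some coordinate axis.\<close>
lemma no_interior_maximum:
  assumes x: "x \<in> \<Omega>" and max: "\<And>y. y \<in> \<Omega> \<Longrightarrow> u y \<le> u x" shows False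
proof -
  have xU: "x \<in> U" using in_U x by blast
  have o\<Omega>: "open \<Omega>" using bounded_smooth_domainD(1)[OF \<Omega>] .
  have du: "(u has_derivative (\<lambda>v. grad u y \<bullet> v)) (at y)" if "y \<in> U" for y
    using has_derivative_grad[OF U_neighbourhood(3)[of "Suc 0"] that] .
  have "(\<lambda>v. grad u x \<bullet> v) = (\<lambda>v. 0)"
    by (rule differential_zero_maxmin[OF x o\<Omega> du[OF xU]]) (use max in blast)
  from fun_cong[OF this, of "grad u x"] have g0: "grad u x = 0" by simp
  have "w x = 1" by (simp add: w_fun_def g0)
  then have "A x i i = pderiv_at i (pderiv_at i u) x" for i using shape_operator_entry[OF xU, of i i] g0 by simp
  then have "(\<Sum>i\<in>UNIV. pderiv_at i (pderiv_at i u) x) = real CARD('n)"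
    using trace_shape_operator[of x] divergence_X[OF x] by simp
  then have "(\<Sum>i\<in>UNIV. pderiv_at i (pderiv_at i u) x) > 0" using n by simp
  then have "\<not> (\<forall>i. pderiv_at i (pderiv_at i u) x \<le> 0)" by (meson not_le sum_nonpos)
  then obtain i where i: "pderiv_at i (pderiv_at i u) x > 0" by (auto simp: not_le)
  have "(pderiv_at i u has_derivative (\<lambda>v. grad (pderiv_at i u) x \<bullet> v)) (at x)"
    by (rule has_derivative_grad[OF Ck_on_pderiv_at[OF U_neighbourhood(3)[of "Suc (Suc 0)"]] xU])
  from directional_derivative[OF this, of "axis i 1"]
  have "((\<lambda>t. pderiv_at i u (x + t *\<^sub>R axis i 1)) has_real_derivative pderiv_at i (pderiv_at i u) x) (at 0)"
    by (simp add: inner_axis grad_def)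
  from has_real_derivative_pos_inc_right[OF this i] g0
  obtain d where d: "d > 0" "\<And>t. 0 < t \<Longrightarrow> t < d \<Longrightarrow> pderiv_at i u (x + t *\<^sub>R axis i 1) > 0"
    by (auto simp: grad_def vec_eq_iff)
  obtain d' where d': "d' > 0" "\<And>t. 0 < t \<Longrightarrow> t < d' \<Longrightarrow> x + t *\<^sub>R axis i 1 \<in> \<Omega>"
    using eventually_on_ray[OF o\<Omega> x, of "axis i 1"] by metis
  obtain h where h: "0 < h" "h < d" "h < d'" using field_lbound_gt_zero[OF d(1) d'(1)] by blast
  have der: "((\<lambda>t. u (x + t *\<^sub>R axis i 1)) has_real_derivative pderiv_at i u (x + t *\<^sub>R axis i 1)) (at t)"
    if "0 \<le> t" "t \<le> h" for t
  proof -
    have "x + t *\<^sub>R axis i 1 \<in> U" using d'(2)[of t] h that xU in_U(1) by (cases "t = 0") auto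
    from du[OF this]
    have "((\<lambda>t. u (x + t *\<^sub>R axis i 1)) has_derivative (\<lambda>s. grad u (x + t *\<^sub>R axis i 1) \<bullet> (s *\<^sub>R axis i 1)))
        (at t)"
      by (rule has_derivative_compose[rotated]) (auto intro!: derivative_eq_intros)
    then show ?thesis by (rule has_real_derivativeI) (simp add: inner_axis grad_def)
  qed
  obtain \<xi> where "0 < \<xi>" "\<xi> < h" "u (x + h *\<^sub>R axis i 1) - u (x + 0 *\<^sub>R axis i 1) = h * pderiv_at i u
      (x + \<xi> *\<^sub>R axis i 1)"
    by (rule mean_value_1d[OF der h(1)])
  then have "u (x + h *\<^sub>R axis i 1) > u x" using d(2)[of \<xi>] h by (simp add: algebra_simps)
  then show False using max[OF d'(2)[OF h(1,3)]] by simp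
qed

lemma u_le_c: "x \<in> \<Omega> \<Longrightarrow> u x \<le> c"
proof -
  assume x: "x \<in> \<Omega>"
  have "continuous_on (closure \<Omega>) u" using Ck_on_continuous_on[OF U_neighbourhood(3)] U_neighbourhood(2)
      continuous_on_subset by blast
  moreover have "closure \<Omega> \<noteq> {}" using x closure_subset by blast
  ultimately obtain m where m: "m \<in> closure \<Omega>" "\<And>y. y \<in> closure \<Omega> \<Longrightarrow> u y \<le> u m"
    using continuous_attains_sup[OF bounded_smooth_domainD(6)[OF \<Omega>]] by blast
  have "m \<notin> \<Omega>" using no_interior_maximum[of m] m(2) closure_subset by blast
  then have "m \<in> frontier \<Omega>" using m(1) bounded_smooth_domainD(1)[OF \<Omega>] by
      (simp add: frontier_def interior_open)
  then show "u x \<le> c" using m(2)[of x] x closure_subset bc by fastforce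
qed

abbreviation "\<nu> \<equiv> outer_unit_normal \<Omega>"
abbreviation "H \<equiv> mean_curvature \<Omega>"

lemma \<nu>_unit: "x \<in> frontier \<Omega> \<Longrightarrow> \<nu> x \<bullet> \<nu> x = 1"
  using norm_outer_unit_normal[OF \<Omega>] norm_eq_1 by blast

text \<open>Constancy on the boundary makes Du normal; the maximum principle fixes the sign, since points
  slightly inside have values at most c.\<close>
lemma grad_normal:
  assumes p: "p \<in> frontier \<Omega>"
  shows "grad u p = (grad u p \<bullet> \<nu> p) *\<^sub>R \<nu> p" "grad u p \<bullet> \<nu> p \<ge> 0"
proof -
  have du: "(u has_derivative (\<lambda>v. grad u p \<bullet> v)) (at p)"
    using has_derivative_grad[OF U_neighbourhood(3)[of "Suc 0"] in_U(2)[OF p]] .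
  let ?t = "grad u p - (grad u p \<bullet> \<nu> p) *\<^sub>R \<nu> p"
  have t: "?t \<bullet> \<nu> p = 0" using \<nu>_unit[OF p] by (simp add: inner_diff_left)
  have "grad u p \<bullet> ?t = 0"
    by (rule derivative_along_frontier_zero[OF \<Omega> p has_derivative_at_withinI[OF du] open_UNIV UNIV_I _ t, of
        c]) (use bc in auto)
  moreover have "\<nu> p \<bullet> ?t = 0" using t by (simp only: inner_commute)
  moreover have "?t \<bullet> ?t = grad u p \<bullet> ?t - (grad u p \<bullet> \<nu> p) * (\<nu> p \<bullet> ?t)"
    by (subst inner_diff_left) (simp only: inner_scaleR_left)
  ultimately have "?t \<bullet> ?t = 0" by simp
  then show "grad u p = (grad u p \<bullet> \<nu> p) *\<^sub>R \<nu> p" by simp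
  obtain V \<rho> where ldf: "local_defining_function \<Omega> p V \<rho>" using bounded_smooth_domainD(7)[OF \<Omega> p] by blast
  note o = bounded_smooth_domainD(1)[OF \<Omega>]
  have \<nu>: "\<nu> p = sgn (grad \<rho> p)" by (rule outer_unit_normal_eq[OF ldf o p])
  have pV: "p \<in> V" "grad \<rho> p \<noteq> 0" using local_defining_functionD[OF ldf] by blast+
  have "\<rho> p = 0" using local_defining_function_frontier_iff[OF ldf o pV(1)] p by simp
  moreover have "grad \<rho> p \<bullet> (- \<nu> p) < 0" using pV(2) by (simp add: \<nu> sgn_div_norm dot_square_norm)
  ultimately obtain d where d: "d > 0" "\<And>t. 0 < t \<Longrightarrow> t < d \<Longrightarrow> p + t *\<^sub>R (- \<nu> p) \<in> \<Omega>"
    using inward_ray[OF ldf pV(1), of "- \<nu> p"] by auto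
  show "grad u p \<bullet> \<nu> p \<ge> 0"
  proof (rule ccontr)
    assume "\<not> grad u p \<bullet> \<nu> p \<ge> 0"
    then have "grad u p \<bullet> (- \<nu> p) > 0" by simp
    from has_real_derivative_pos_inc_right[OF directional_derivative[OF du] this]
    obtain d' where d': "d' > 0" "\<And>t. 0 < t \<Longrightarrow> t < d' \<Longrightarrow> u p < u (p + t *\<^sub>R (- \<nu> p))" by auto
    obtain t where t: "0 < t" "t < d" "t < d'" using field_lbound_gt_zero[OF d(1) d'(1)] by blast
    have "u (p + t *\<^sub>R (- \<nu> p)) \<le> c" by (rule u_le_c[OF d(2)[OF t(1,2)]])
    then show False using d'(2)[OF t(1,3)] bc p by auto
  qed
qed

definition v where "v x = X x \<bullet> \<nu> x"

lemma X_boundary: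
  assumes p: "p \<in> frontier \<Omega>"
  shows "X p = v p *\<^sub>R \<nu> p" "norm (grad u p) / w p = v p"
proof -
  note g = grad_normal[OF p]
  have vp: "v p = (grad u p \<bullet> \<nu> p) / w p" by (simp add: v_def X_def divide_inverse mult.commute)
  show "X p = v p *\<^sub>R \<nu> p" unfolding vp X_def by (subst g(1)) (simp add: divide_inverse mult.commute)
  have "norm (grad u p) = norm ((grad u p \<bullet> \<nu> p) *\<^sub>R \<nu> p)" using g(1) by simp
  also have "\<dots> = grad u p \<bullet> \<nu> p" using g(2) norm_outer_unit_normal[OF \<Omega> p] by simp
  finally show "norm (grad u p) / w p = v p" by (simp add: vp)
qed

lemma continuous_boundary: "continuous_on (frontier \<Omega>) v" "continuous_on (frontier \<Omega>) H"
proof -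
  have "continuous_on (frontier \<Omega>) X"
    using Ck_on_continuous_on[OF X_Ck_on] continuous_on_subset in_U(2) by blast
  then show "continuous_on (frontier \<Omega>) v" unfolding v_def[abs_def]
    by (intro continuous_intros continuous_on_outer_unit_normal \<Omega>)
  show "continuous_on (frontier \<Omega>) H" by (rule continuous_on_mean_curvature[OF \<Omega>])
qed

lemma frontier_sets: "frontier \<Omega> \<in> sets (\<S> \<Omega>)" by (rule domain_sets(2)[OF \<Omega>])

lemma volume_eq: "real CARD('n) * measure lborel \<Omega> = (LINT x:frontier \<Omega>|\<S> \<Omega>. v x)"
proof -
  have "(LINT x:frontier \<Omega>|\<S> \<Omega>. v x) = (LINT x:\<Omega>|lborel. divergence X x)"
    unfolding v_def by (rule divergence_theorem[OF \<Omega> U_neighbourhood(1,2) X_Ck_on, symmetric])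
  also have "\<dots> = (LINT x:\<Omega>|lborel. real CARD('n))"
    by (rule set_lebesgue_integral_cong[OF domain_sets(1)[OF \<Omega>]]) (simp add: divergence_X)
  finally show ?thesis by (simp add: set_integral_const_domain[OF \<Omega>])
qed

lemma S_fun_on_domain:
  assumes x: "x \<in> \<Omega>"
  shows "S_fun 1 u x = real CARD('n)" "2 * S_fun 2 u x = divergence (flux X X) x"
    "(\<Sum>i\<in>UNIV. \<Sum>j\<in>UNIV. A x i j * A x j i) = (real CARD('n))\<^sup>2 - 2 * S_fun 2 u x"
proof -
  show S1: "S_fun 1 u x = real CARD('n)"
    unfolding S_fun_eq(1) trace_shape_operator by (rule divergence_X[OF x])
  have xU: "x \<in> U" using in_U x by blast
  show "2 * S_fun 2 u x = divergence (flux X X) x"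
    unfolding S_fun_eq(2) divergence_flux[OF U_neighbourhood(1) X_Ck_on X_Ck_on xU] trace_shape_operator
    by (simp add: shape_operator_eq power2_eq_square)
  show "(\<Sum>i\<in>UNIV. \<Sum>j\<in>UNIV. A x i j * A x j i) = (real CARD('n))\<^sup>2 - 2 * S_fun 2 u x"
    unfolding S_fun_eq(2) trace_shape_operator divergence_X[OF x] by simp
qed

text \<open>The divergence theorem for the flux of X and X. On the boundary X = v \<open>\<nu>\<close>, so the normal component
  of the flux is v times the tangential divergence of X, which is v (n-1) H.\<close>
lemma integral_S2:
  "(LINT x:\<Omega>|lborel. 2 * S_fun 2 u x) = (real CARD('n) - 1) * (LINT x:frontier \<Omega>|\<S> \<Omega>. (v x)\<^sup>2 * H x)"
proof -
  obtain Z :: "real^'n \<Rightarrow> real^'n" where Z: "Ck_on 1 Z UNIV" "\<And>x. x \<in> frontier \<Omega> \<Longrightarrow> Z x = \<nu> x"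
    by (rule normal_extension[OF \<Omega>, where k=1]) blast
  have dZ: "(Z has_derivative frechet_derivative Z (at x)) (at x)" for x
    using Ck_on_has_derivative[of 0 Z UNIV x] Z(1) by simp
  have bd: "flux X X x \<bullet> \<nu> x = (real CARD('n) - 1) * ((v x)\<^sup>2 * H x)" if x: "x \<in> frontier \<Omega>" for x
  proof -
    let ?L = "frechet_derivative X (at x)"
    have xU: "x \<in> U" using in_U x by blast
    have lin: "linear ?L" using X_has_derivative[OF xU] has_derivative_linear by blast
    have X\<nu>: "X y = (X y \<bullet> \<nu> y) *\<^sub>R \<nu> y" if "y \<in> frontier \<Omega>" for y using X_boundary(1)[OF that] by
        (simp add: v_def)
    have "?L (X x) \<bullet> \<nu> x = v x * (?L (\<nu> x) \<bullet> \<nu> x)"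
      by (subst X_boundary(1)[OF x]) (simp add: linear_scale[OF lin])
    then have "flux X X x \<bullet> \<nu> x = v x * tangential_trace (\<nu> x) ?L"
      using flux_normal[OF U_neighbourhood(1) X_Ck_on X_Ck_on xU, of "\<nu> x"]
          divergence_eq_trace[OF differentiableI[OF X_has_derivative[OF xU]]]
      by (simp add: tangential_trace_def v_def[symmetric] algebra_simps)
    also have "tangential_trace (\<nu> x) ?L = v x * ((real CARD('n) - 1) * H x)"
      using tangential_trace_normal_field[OF n \<Omega> x dZ Z(2) X_has_derivative[OF xU] X\<nu>] by (simp add: v_def)
    finally show ?thesis by (simp add: power2_eq_square)
  qed
  have "(LINT x:\<Omega>|lborel. 2 * S_fun 2 u x) = (LINT x:\<Omega>|lborel. divergence (flux X X) x)"
    by (rule set_lebesgue_integral_cong[OF domain_sets(1)[OF \<Omega>]]) (simp add: S_fun_on_domain(2))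
  also have "\<dots> = (LINT x:frontier \<Omega>|\<S> \<Omega>. flux X X x \<bullet> \<nu> x)"
    by (rule divergence_theorem[OF \<Omega> U_neighbourhood(1,2) Ck_on_flux[OF U_neighbourhood(1) X_Ck_on X_Ck_on]])
  also have "\<dots> = (LINT x:frontier \<Omega>|\<S> \<Omega>. (real CARD('n) - 1) * ((v x)\<^sup>2 * H x))"
    by (rule set_lebesgue_integral_cong[OF frontier_sets]) (use bd in auto)
  finally show ?thesis by (simp only: set_integral_mult_right)
qed

text \<open>The integrand of the volume term; by \<open>deficit_trace\<close> it is tr ((A - I)^2).\<close>
definition deficit where "deficit x = (real CARD('n) - 1) / real CARD('n) * (S_fun 1 u x)\<^sup>2 - 2 * S_fun 2 u x"

lemma deficit_eq: "x \<in> \<Omega> \<Longrightarrow> deficit x = (real CARD('n) - 1) * real CARD('n) - divergence (flux X X) x"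
  unfolding deficit_def using S_fun_on_domain(1,2) n by (simp add: power2_eq_square)

lemma deficit_trace: "x \<in> \<Omega> \<Longrightarrow> deficit x = (\<Sum>i\<in>UNIV. \<Sum>j\<in>UNIV. A x i j * A x j i) - real CARD('n)"
proof -
  assume x: "x \<in> \<Omega>"
  have "(real CARD('n) - 1) / real CARD('n) * (real CARD('n))\<^sup>2 = (real CARD('n))\<^sup>2 - real CARD('n)"
    using n by (simp add: power2_eq_square field_simps)
  then show ?thesis unfolding deficit_def S_fun_on_domain(1)[OF x] S_fun_on_domain(3)[OF x] by simp
qed

lemma continuous_on_div_flux: "continuous_on U (divergence (flux X X))"
  using Ck_on_divergence[OF U_neighbourhood(1), of 0 "flux X X"] Ck_on_flux[OF U_neighbourhood(1) X_Ck_on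
      X_Ck_on] by simp

lemma set_integrable_deficit: "set_integrable lborel \<Omega> deficit"
proof -
  have "set_integrable lborel \<Omega> (\<lambda>x. (real CARD('n) - 1) * real CARD('n) - divergence (flux X X) x)"
    by (intro set_integrable_domain[OF \<Omega>] continuous_intros continuous_on_subset[OF continuous_on_div_flux
        U_neighbourhood(2)])
  then show ?thesis
    by (rule set_integrable_cong[THEN iffD1, rotated -1]) (auto simp: deficit_eq)
qed

lemma integral_deficit:
  "1 / (real CARD('n) - 1) * (LINT x:\<Omega>|lborel. deficit x) = real CARD('n) * measure lborel \<Omega> -
      (LINT x:frontier \<Omega>|\<S> \<Omega>. (v x)\<^sup>2 * H x)"
proof -
  have i1: "set_integrable lborel \<Omega> (\<lambda>x. (real CARD('n) - 1) * real CARD('n))"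
    and i2: "set_integrable lborel \<Omega> (divergence (flux X X))"
    by (intro set_integrable_domain[OF \<Omega>] continuous_intros continuous_on_subset[OF continuous_on_div_flux
        U_neighbourhood(2)])+
  have "(LINT x:\<Omega>|lborel. deficit x) = (LINT x:\<Omega>|lborel. (real CARD('n) - 1) * real CARD('n) - divergence
      (flux X X) x)"
    by (rule set_lebesgue_integral_cong[OF domain_sets(1)[OF \<Omega>]]) (simp add: deficit_eq)
  also have "\<dots> = (LINT x:\<Omega>|lborel. (real CARD('n) - 1) * real CARD('n)) - (LINT x:\<Omega>|lborel. divergence
      (flux X X) x)"
    by (rule set_integral_diff(2)[OF i1 i2])
  also have "(LINT x:\<Omega>|lborel. divergence (flux X X) x) = (LINT x:\<Omega>|lborel. 2 * S_fun 2 u x)"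
    by (rule set_lebesgue_integral_cong[OF domain_sets(1)[OF \<Omega>]]) (simp add: S_fun_on_domain(2))
  finally have "(LINT x:\<Omega>|lborel. deficit x) = (real CARD('n) - 1) * (real CARD('n) * measure lborel \<Omega> -
      (LINT x:frontier \<Omega>|\<S> \<Omega>. (v x)\<^sup>2 * H x))"
    unfolding integral_S2 set_integral_const_domain[OF \<Omega>] by (simp add: algebra_simps)
  then show ?thesis using n by simp
qed

lemma main_identity:
  assumes mc: "strictly_mean_convex \<Omega>"
  shows "1 / (real CARD('n) - 1) * (LINT x:\<Omega>|lborel. deficit x)
      + (LINT x:frontier \<Omega>|\<S> \<Omega>. (1 - norm (grad u x) / w x * H x)\<^sup>2 / H x)
    = (LINT x:frontier \<Omega>|\<S> \<Omega>. 1 / H x) - real CARD('n) * measure lborel \<Omega>"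
proof -
  have Hp: "H x > 0" if "x \<in> frontier \<Omega>" for x using mc that by (simp add: strictly_mean_convex_def)
  have i1: "set_integrable (\<S> \<Omega>) (frontier \<Omega>) (\<lambda>x. 1 / H x)"
    by (intro set_integrable_frontier[OF \<Omega>] continuous_intros continuous_boundary) (use Hp in force)
  have i2: "set_integrable (\<S> \<Omega>) (frontier \<Omega>) (\<lambda>x. 2 * v x)"
    by (intro set_integrable_frontier[OF \<Omega>] continuous_intros continuous_boundary)
  have i3: "set_integrable (\<S> \<Omega>) (frontier \<Omega>) (\<lambda>x. (v x)\<^sup>2 * H x)"
    by (intro set_integrable_frontier[OF \<Omega>] continuous_intros continuous_boundary)
  have "(LINT x:frontier \<Omega>|\<S> \<Omega>. (1 - norm (grad u x) / w x * H x)\<^sup>2 / H x)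
      = (LINT x:frontier \<Omega>|\<S> \<Omega>. 1 / H x - 2 * v x + (v x)\<^sup>2 * H x)"
  proof (rule set_lebesgue_integral_cong[OF frontier_sets], intro allI impI)
    fix x assume x: "x \<in> frontier \<Omega>"
    show "(1 - norm (grad u x) / w x * H x)\<^sup>2 / H x = 1 / H x - 2 * v x + (v x)\<^sup>2 * H x"
      unfolding X_boundary(2)[OF x] using Hp[OF x] by (simp add: power2_eq_square field_simps)
  qed
  also have "\<dots> = (LINT x:frontier \<Omega>|\<S> \<Omega>. 1 / H x) - (LINT x:frontier \<Omega>|\<S> \<Omega>. 2 * v x) +
      (LINT x:frontier \<Omega>|\<S> \<Omega>. (v x)\<^sup>2 * H x)"
    by (simp only: set_integral_add(2)[OF set_integral_diff(1)[OF i1 i2] i3] set_integral_diff(2)[OF i1 i2])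
  finally show ?thesis unfolding integral_deficit volume_eq by (simp only: set_integral_mult_right)
qed

lemma nonneg_terms:
  "(LINT x:\<Omega>|lborel. deficit x) \<ge> 0"
  "strictly_mean_convex \<Omega> \<Longrightarrow> (LINT x:frontier \<Omega>|\<S> \<Omega>. (1 - norm (grad u x) / w x * H x)\<^sup>2 / H x) \<ge> 0"
proof -
  show "(LINT x:\<Omega>|lborel. deficit x) \<ge> 0"
    unfolding set_lebesgue_integral_def
    by (rule Bochner_Integration.integral_nonneg)
      (use deficit_trace shape_operator_trace_square(1) in \<open>auto simp: indicator_def\<close>)
  show "(LINT x:frontier \<Omega>|\<S> \<Omega>. (1 - norm (grad u x) / w x * H x)\<^sup>2 / H x) \<ge> 0" if "strictly_mean_convex \<Omega>"
    unfolding set_lebesgue_integral_def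
    by (rule Bochner_Integration.integral_nonneg)
      (use that in \<open>auto simp: indicator_def strictly_mean_convex_def intro!: divide_nonneg_pos\<close>)
qed

text \<open>DX = I on the connected set \<open>\<Omega>\<close> gives X = x - a, hence 1/w^2 = 1 + |x - a|^2 and Du is the
  gradient of s(x) = sqrt (1 + |x - a|^2). So u - s is constant up to the boundary, where u = c.\<close>
lemma umbilic_implies_ball:
  assumes umb: "\<And>x i j. x \<in> \<Omega> \<Longrightarrow> A x i j = (if i = j then 1 else 0)"
  obtains a r where "r > 0" "\<Omega> = ball a r"
proof -
  note d = bounded_smooth_domainD[OF \<Omega>]
  have dX: "((\<lambda>x. X x - x) has_derivative (\<lambda>v. 0)) (at x)" if x: "x \<in> \<Omega>" for x
  proof -
    have xU: "x \<in> U" using in_U x by blast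
    have "frechet_derivative X (at x) v $ j = v $ j" for v j
      using frechet_derivative_component[OF differentiableI[OF X_has_derivative[OF xU]], of v j] umb[OF x]
      by (simp flip: shape_operator_eq) (simp add: if_distrib[of "\<lambda>c. _ * c"] cong: if_cong)
    then have "frechet_derivative X (at x) = (\<lambda>v. v)" by (simp add: fun_eq_iff vec_eq_iff)
    then show ?thesis using has_derivative_diff[OF X_has_derivative[OF xU] has_derivative_ident] by simp
  qed
  obtain x0 where x0: "x0 \<in> \<Omega>" using d(3) by blast
  define a where "a = - (X x0 - x0)"
  have Xa: "X x = x - a" if "x \<in> \<Omega>" for x
    using has_derivative_zero_unique_connected[OF d(1,2) dX that x0] by (simp add: a_def algebra_simps)
  define s where "s = (\<lambda>x. sqrt (1 + (x - a) \<bullet> (x - a)))"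
  have s1: "1 + (x - a) \<bullet> (x - a) > 0" for x by (rule add_pos_nonneg) auto
  have ds: "(s has_derivative (\<lambda>v. ((x - a) \<bullet> v) / s x)) (at x)" for x
    unfolding s_def using s1[of x] by (auto intro!: derivative_eq_intros simp: inner_commute field_simps)
  have du: "((\<lambda>x. u x - s x) has_derivative (\<lambda>v. 0)) (at x)" if x: "x \<in> \<Omega>" for x
  proof -
    have xU: "x \<in> U" using in_U x by blast
    have wp: "w x > 0" using w_pos[OF xU] .
    have g: "grad u x = w x *\<^sub>R (x - a)" using Xa[OF x] wp by (simp add: X_def field_simps flip: Xa[OF x])
    have "(w x)\<^sup>2 = 1 - (w x)\<^sup>2 * ((x - a) \<bullet> (x - a))" using w_sq[OF xU] by (simp add: g power2_eq_square)
    then have "(w x)\<^sup>2 * (s x)\<^sup>2 = 1" unfolding s_def using s1[of x] by (simp add: algebra_simps)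
    then have "(w x * s x)\<^sup>2 = 1" by (simp add: power_mult_distrib)
    moreover have "w x * s x > 0" using wp s1[of x] by (simp add: s_def)
    ultimately have "w x * s x = 1" by (metis abs_of_pos power2_eq_1_iff abs_1 abs_minus_cancel)
    then have w: "w x = 1 / s x" by (metis mult_eq_0_iff nonzero_eq_divide_eq zero_neq_one)
    have "(u has_derivative (\<lambda>v. grad u x \<bullet> v)) (at x)" by
        (rule has_derivative_grad[OF U_neighbourhood(3)[of "Suc 0"] xU])
    from has_derivative_diff[OF this ds] show ?thesis by (simp add: g w)
  qed
  define k where "k = u x0 - s x0"
  have usk: "u x - s x = k" if "x \<in> \<Omega>" for x
    using has_derivative_zero_unique_connected[OF d(1,2) du that x0] by (simp add: k_def)
  have cs: "continuous_on (closure \<Omega>) (\<lambda>x. u x - s x)"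
  proof (intro continuous_on_diff)
    show "continuous_on (closure \<Omega>) u" using Ck_on_continuous_on[OF U_neighbourhood(3)] U_neighbourhood(2)
        continuous_on_subset by blast
    show "continuous_on (closure \<Omega>) s" unfolding s_def by (intro continuous_intros)
  qed
  have "frontier \<Omega> \<subseteq> sphere a (sqrt ((c - k)\<^sup>2 - 1))"
  proof
    fix x assume x: "x \<in> frontier \<Omega>"
    then have "u x - s x = k"
      using continuous_constant_on_closure[OF cs usk] frontier_subset_closure by blast
    then have "s x = c - k" using bc x by auto
    then have "1 + (x - a) \<bullet> (x - a) = (c - k)\<^sup>2" using s1[of x] unfolding s_def by
        (metis less_imp_le real_sqrt_pow2)
    then have "(norm (x - a))\<^sup>2 = (c - k)\<^sup>2 - 1" by (simp add: power2_norm_eq_inner)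
    then have "norm (x - a) = sqrt ((c - k)\<^sup>2 - 1)" by (metis norm_ge_zero real_sqrt_unique)
    then show "x \<in> sphere a (sqrt ((c - k)\<^sup>2 - 1))" by (simp add: dist_norm norm_minus_commute)
  qed
  then have "0 < sqrt ((c - k)\<^sup>2 - 1) \<and> \<Omega> = ball a (sqrt ((c - k)\<^sup>2 - 1))"
    by (intro domain_with_frontier_in_sphere) (use n d in auto)
  then show thesis using that by blast
qed

text \<open>The integrand is nonnegative and continuous.\<close>
lemma deficit_zero:
  assumes z: "(LINT x:\<Omega>|lborel. deficit x) = 0" and x: "x \<in> \<Omega>" shows "deficit x = 0"
proof (rule ccontr)
  assume "deficit x \<noteq> 0"
  have nn: "deficit y \<ge> 0" if "y \<in> \<Omega>" for y using deficit_trace[OF that] shape_operator_trace_square(1)[OF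
      that] by simp
  have "AE y in lborel. indicator \<Omega> y *\<^sub>R deficit y = 0"
    using z integral_nonneg_eq_0_iff_AE[OF set_integrable_deficit[unfolded set_integrable_def]] nn
    unfolding set_lebesgue_integral_def by (auto simp: indicator_def)
  then have ae: "AE y in lborel. y \<in> \<Omega> \<longrightarrow> deficit y = 0" by eventually_elim auto
  let ?q = "\<lambda>y. (real CARD('n) - 1) * real CARD('n) - divergence (flux X X) y"
  have oS: "open (\<Omega> \<inter> ?q -` {0<..})"
    by (rule continuous_open_preimage[OF _ bounded_smooth_domainD(1)[OF \<Omega>] open_greaterThan])
      (intro continuous_intros continuous_on_subset[OF continuous_on_div_flux], use in_U in blast)
  have xS: "x \<in> \<Omega> \<inter> ?q -` {0<..}" using x \<open>deficit x \<noteq> 0\<close> nn[OF x] deficit_eq[OF x] by auto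
  obtain l b where lb: "x \<in> box l b" "cbox l b \<subseteq> \<Omega> \<inter> ?q -` {0<..}" by (rule box_neighbourhood[OF oS xS])
  have "AE y in lborel. y \<notin> box l b"
    using ae
  proof eventually_elim
    fix y assume "y \<in> \<Omega> \<longrightarrow> deficit y = 0"
    then show "y \<notin> box l b" using lb(2) box_subset_cbox[of l b] deficit_eq[of y] by force
  qed
  then have "emeasure lborel (box l b) = 0" by (subst (asm) AE_iff_measurable[of "box l b"]) auto
  moreover have "0 < (\<Prod>i\<in>Basis. (b - l) \<bullet> i)" using lb(1) by (intro prod_pos) (auto simp: mem_box inner_diff
      intro: less_trans)
  moreover have "emeasure lborel (box l b) = ennreal (\<Prod>i\<in>Basis. (b - l) \<bullet> i)"
    by (rule emeasure_lborel_box) (use lb(1) in \<open>auto simp: mem_box intro: less_imp_le less_trans\<close>)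
  ultimately show False by (metis ennreal_eq_0_iff not_le)
qed

lemma equality_implies_ball:
  assumes mc: "strictly_mean_convex \<Omega>"
    and eq: "(LINT x:frontier \<Omega>|\<S> \<Omega>. 1 / H x) = real CARD('n) * measure lborel \<Omega>"
  obtains a r where "r > 0" "\<Omega> = ball a r"
proof -
  have "1 / (real CARD('n) - 1) * (LINT x:\<Omega>|lborel. deficit x) \<ge> 0"
    using nonneg_terms(1) n by simp
  then have "1 / (real CARD('n) - 1) * (LINT x:\<Omega>|lborel. deficit x) = 0"
    using main_identity[OF mc] nonneg_terms(2)[OF mc] eq by linarith
  then have z: "(LINT x:\<Omega>|lborel. deficit x) = 0" using n by auto
  show thesis
  proof (rule umbilic_implies_ball)
    show "A x i j = (if i = j then 1 else 0)" if "x \<in> \<Omega>" for x i j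
      using shape_operator_trace_square(2)[OF that] deficit_zero[OF z that] deficit_trace[OF that] by simp
  qed (rule that)
qed

text \<open>The Minkowski formula gives |boundary| = h n |\<open>\<Omega>\<close>|. The boundary has positive measure because v
  has positive integral over it; so h > 0, and the formula becomes equality in the Heintze-Karcher
  inequality.\<close>
lemma constant_mean_curvature_implies_ball:
  assumes h: "\<forall>x\<in>frontier \<Omega>. H x = h"
  obtains a r where "r > 0" "\<Omega> = ball a r"
proof -
  let ?a = "LINT x:frontier \<Omega>|\<S> \<Omega>. (1::real)"
  have nv: "real CARD('n) * measure lborel \<Omega> > 0" using measure_domain_pos[OF \<Omega>] n by simp
  have "?a = (LINT x:frontier \<Omega>|\<S> \<Omega>. H x * (x \<bullet> \<nu> x))" by (rule Minkowski_formula[OF n \<Omega>, symmetric])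
  also have "\<dots> = (LINT x:frontier \<Omega>|\<S> \<Omega>. h * ((x - 0) \<bullet> \<nu> x))"
    by (rule set_lebesgue_integral_cong[OF frontier_sets]) (use h in auto)
  also have "\<dots> = h * (real CARD('n) * measure lborel \<Omega>)"
    unfolding set_integral_mult_right volume_eq_boundary_integral[OF \<Omega>, of 0] ..
  finally have area: "?a = h * (real CARD('n) * measure lborel \<Omega>)" .
  have a0: "?a \<ge> 0" unfolding set_lebesgue_integral_def by (rule Bochner_Integration.integral_nonneg) simp
  have "?a \<noteq> 0"
  proof
    interpret finite_measure "\<S> \<Omega>" by (rule finite_surface_measure[OF \<Omega>])
    assume "?a = 0"
    then have "measure (\<S> \<Omega>) (frontier \<Omega>) = 0" using frontier_sets by (simp add: set_lebesgue_integral_def)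
    then have "emeasure (\<S> \<Omega>) (frontier \<Omega>) = 0" by (simp add: emeasure_eq_measure)
    then have "AE x in \<S> \<Omega>. x \<notin> frontier \<Omega>" using frontier_sets by (intro AE_not_in) auto
    then have "(LINT x:frontier \<Omega>|\<S> \<Omega>. v x) = 0" unfolding set_lebesgue_integral_def
      by (intro integral_eq_zero_AE) (auto elim!: eventually_mono)
    then show False using volume_eq nv by simp
  qed
  then have hp: "h > 0" using area a0 nv by (metis mult_eq_0_iff mult_neg_pos not_less
      linorder_neqE_linordered_idom)
  have mc: "strictly_mean_convex \<Omega>" using h hp by (simp add: strictly_mean_convex_def)
  have "(LINT x:frontier \<Omega>|\<S> \<Omega>. 1 / H x) = (LINT x:frontier \<Omega>|\<S> \<Omega>. 1 / h * 1)"
    by (rule set_lebesgue_integral_cong[OF frontier_sets]) (use h in auto)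
  also have "\<dots> = 1 / h * ?a" by (rule set_integral_mult_right)
  also have "\<dots> = real CARD('n) * measure lborel \<Omega>" using area hp by simp
  finally show thesis using equality_implies_ball[OF mc] that by blast
qed

end

theorem theorem5p2:
  fixes \<Omega> :: "(real^'n) set" and c :: real and u :: "real^'n \<Rightarrow> real"
  assumes n: "CARD('n) \<ge> 2"
    and \<Omega>: "bounded_smooth_domain \<Omega>"
    and u: "smooth_up_to_boundary u \<Omega>"
    and spacelike: "\<forall>x\<in>closure \<Omega>. norm (grad u x) < 1"
    and pde: "\<forall>x\<in>\<Omega>. divergence (\<lambda>y. grad u y /\<^sub>R w_fun u y) x = real CARD('n)"
    and bc: "\<forall>x\<in>frontier \<Omega>. u x = c"
  shows
    "(strictly_mean_convex \<Omega> \<longrightarrow>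
        1 / (real CARD('n) - 1) *
          (LINT x:\<Omega>|lborel. (real CARD('n) - 1) / real CARD('n) * (S_fun 1 u x)\<^sup>2 - 2 * S_fun 2 u x)
        + (LINT x:frontier \<Omega>|surface_measure (frontier \<Omega>).
             (1 - norm (grad u x) / w_fun u x * mean_curvature \<Omega> x)\<^sup>2 / mean_curvature \<Omega> x)
        = (LINT x:frontier \<Omega>|surface_measure (frontier \<Omega>). 1 / mean_curvature \<Omega> x)
          - real CARD('n) * measure lborel \<Omega>
      \<and> (LINT x:frontier \<Omega>|surface_measure (frontier \<Omega>). 1 / mean_curvature \<Omega> x)
          \<ge> real CARD('n) * measure lborel \<Omega>
      \<and> ((LINT x:frontier \<Omega>|surface_measure (frontier \<Omega>). 1 / mean_curvature \<Omega> x)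
            = real CARD('n) * measure lborel \<Omega>
          \<longleftrightarrow> (\<exists>a r. r > 0 \<and> \<Omega> = ball a r)))
     \<and> ((\<exists>h. \<forall>x\<in>frontier \<Omega>. mean_curvature \<Omega> x = h)
          \<longrightarrow> (\<exists>a r. r > 0 \<and> frontier \<Omega> = sphere a r))"
proof -
  interpret spacelike_cmc_graph \<Omega> c u
    by unfold_locales (fact n \<Omega> u spacelike pde bc)+
  have nn: "1 / (real CARD('n) - 1) * (LINT x:\<Omega>|lborel. deficit x) \<ge> 0" using nonneg_terms(1) n by simp
  show ?thesis
  proof (intro conjI impI)
    assume mc: "strictly_mean_convex \<Omega>"
    note id = main_identity[OF mc]
    show "1 / (real CARD('n) - 1) *
          (LINT x:\<Omega>|lborel. (real CARD('n) - 1) / real CARD('n) * (S_fun 1 u x)\<^sup>2 - 2 * S_fun 2 u x)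
        + (LINT x:frontier \<Omega>|surface_measure (frontier \<Omega>).
             (1 - norm (grad u x) / w_fun u x * mean_curvature \<Omega> x)\<^sup>2 / mean_curvature \<Omega> x)
        = (LINT x:frontier \<Omega>|surface_measure (frontier \<Omega>). 1 / mean_curvature \<Omega> x)
          - real CARD('n) * measure lborel \<Omega>"
      using id unfolding deficit_def .
    show "(LINT x:frontier \<Omega>|surface_measure (frontier \<Omega>). 1 / mean_curvature \<Omega> x) \<ge> real CARD('n) * measure lborel \<Omega>"
      using id nn nonneg_terms(2)[OF mc] by linarith
    show "(LINT x:frontier \<Omega>|surface_measure (frontier \<Omega>). 1 / mean_curvature \<Omega> x)
            = real CARD('n) * measure lborel \<Omega>
          \<longleftrightarrow> (\<exists>a r. r > 0 \<and> \<Omega> = ball a r)"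
      using equality_implies_ball[OF mc] ball_equality[OF n \<Omega>] by metis
  next
    assume "\<exists>h. \<forall>x\<in>frontier \<Omega>. mean_curvature \<Omega> x = h"
    then obtain h where h: "\<forall>x\<in>frontier \<Omega>. mean_curvature \<Omega> x = h" by blast
    obtain a r where "r > 0" "\<Omega> = ball a r" using constant_mean_curvature_implies_ball[OF h] .
    then show "\<exists>a r. r > 0 \<and> frontier \<Omega> = sphere a r" by (metis frontier_ball)
  qed
qed

end
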